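(* Let $s_j=\sigma_j+it_j$ ($j=1,2,3$) satisfy $\sigma_1\ge0$, $\sigma_2\ge0$, $\sigma_3>0$, $t_1\ge0$, $t_2\ge0$, $2\le t_3\le T$, $\sigma_1+\sigma_3\le1$, $\sigma_2+\sigma_3\le1$, $\sigma_1+\sigma_2+\sigma_3>\tfrac32$, with $s_1,s_2,\sigma_3$ fixed. Assume that as $t_3$ runs from $2$ to $T$ the point $(s_1,s_2,s_3)$ never lies on any of the hyperplanes $s_1+s_3=1$, $s_2+s_3=1$, $s_1+s_2+s_3=2$. Then as $T\to\infty$, $$\int_2^T|\zeta_{MT,2}(s_1,s_2,s_3)|^2dt_3=\zeta_{MT,2}^{[2]}(s_1,s_2,2\sigma_3)T+\begin{cases}O(T^{5/2-\sigma_1-\sigma_2-\sigma_3})&(\tfrac32<\sigma_1+\sigma_2+\sigma_3<2),\\ O((T\log T)^{1/2})&(\sigma_1+\sigma_2+\sigma_3=2),\end{cases}$$ where the implied constants depend on $s_1,s_2$ and $\sigma_3$.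
   Context: Write $s_j=\sigma_j+it_j$ with $\sigma_j,t_j\in\mathbb{R}$; complex powers $n^{s}=e^{s\log n}$ use the real logarithm. The Mordell–Tornheim double zeta-function is $\zeta_{MT,2}(s_1,s_2,s_3)=\sum_{m=1}^\infty\sum_{n=1}^\infty m^{-s_1}n^{-s_2}(m+n)^{-s_3}$, absolutely convergent for $\sigma_1+\sigma_3>1$, $\sigma_2+\sigma_3>1$, $\sigma_1+\sigma_2+\sigma_3>2$, and meromorphically continued to $\mathbb{C}^3$; $\zeta_{MT,2}$ denotes this continuation. Also $$\zeta_{MT,2}^{[2]}(s_1,s_2,s_3)=\sum_{k=2}^\infty\left|\sum_{m=1}^{k-1}\frac{1}{m^{s_1}(k-m)^{s_2}}\right|^2\frac{1}{k^{s_3}},$$ absolutely convergent when $2\sigma_1+\sigma_3>1$, $2\sigma_2+\sigma_3>1$, $2\sigma_1+2\sigma_2+\sigma_3>2$. *)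

theory Defs
  imports "HOL-Analysis.Analysis" "HOL-Library.Landau_Symbols"
begin

definition MT2_conv_region :: "(complex \<times> complex \<times> complex) set" where
  "MT2_conv_region = {(s1, s2, s3). Re s1 + Re s3 > 1 \<and> Re s2 + Re s3 > 1 \<and>
                                    Re s1 + Re s2 + Re s3 > 2}"

definition zeta_MT2_series :: "complex \<Rightarrow> complex \<Rightarrow> complex \<Rightarrow> complex" where
  "zeta_MT2_series s1 s2 s3 =
     infsum (\<lambda>(m::nat, n::nat). 1 / (of_nat m powr s1 * of_nat n powr s2 * of_nat (m + n) powr s3))
            {(m, n). m \<ge> 1 \<and> n \<ge> 1}"

text \<open>Holomorphy in three complex variables: continuous and holomorphic in each variable
  separately (equivalent to joint holomorphy by Osgood's lemma).\<close>
definition holo3_on :: "(complex \<times> complex \<times> complex) set \<Rightarrow>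
                        (complex \<times> complex \<times> complex \<Rightarrow> complex) \<Rightarrow> bool" where
  "holo3_on U f \<longleftrightarrow> open U \<and> continuous_on U f \<and>
     (\<forall>a b c. (a, b, c) \<in> U \<longrightarrow>
        (\<lambda>z. f (z, b, c)) field_differentiable at a \<and>
        (\<lambda>z. f (a, z, c)) field_differentiable at b \<and>
        (\<lambda>z. f (a, b, z)) field_differentiable at c)"

text \<open>The meromorphic continuation of the Mordell--Tornheim double zeta-function, evaluated at a
  point: the value at that point of any holomorphic function on a connected open neighbourhood
  which meets the region of absolute convergence and agrees there with the series.
  (At non-singular points this is well defined by the identity theorem.)\<close>
definition zeta_MT2 :: "complex \<Rightarrow> complex \<Rightarrow> complex \<Rightarrow> complex" where
  "zeta_MT2 s1 s2 s3 = (THE v. \<exists>U f. open U \<and> connected U \<and> (s1, s2, s3) \<in> U \<and>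
      U \<inter> MT2_conv_region \<noteq> {} \<and> holo3_on U f \<and>
      (\<forall>q \<in> U \<inter> MT2_conv_region. f q = (case q of (a, b, c) \<Rightarrow> zeta_MT2_series a b c)) \<and>
      f (s1, s2, s3) = v)"

definition zeta_MT2_sq :: "complex \<Rightarrow> complex \<Rightarrow> complex \<Rightarrow> complex" where
  "zeta_MT2_sq s1 s2 s3 =
     infsum (\<lambda>k::nat. complex_of_real
                 ((cmod (\<Sum>m = 1..k - 1. 1 / (of_nat m powr s1 * of_nat (k - m) powr s2)))\<^sup>2)
               / of_nat k powr s3) {2..}"

end

(*
  Write u = s1 + s3, v = s2 + s3, w = s1 + s2 + s3 and sigma for the real part of w.

  Continuation. The double series is the sum of two sums over the cone n <= m minus a diagonal zeta
  series. On the cone, comparing the inner sum over m of g(x) = x^(-a) (x + n)^(-c) with its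
  integral and Taylor-expanding g to order J gives an incomplete beta function of (a, u) times
  zeta(w - 1), plus finitely many lattice sums of the same shape with u and w raised, plus a
  remainder that converges absolutely after lowering u and w by J. Induction continues the sum to
  every half-space, up to an entire factor that clears the poles. Any germ used in the definition
  of the zeta-function is connected to the convergence region by a compact path, which lies in one
  of these half-spaces, so the identity theorem in three variables makes its value unique.

  Mean square. The coefficient of k^(-s3) is a convolution of two powers. Replacing m^(-s) by a
  multiple of the binomial coefficients (1-s)_m / m!, whose convolutions are given by
  Vandermonde's identity, shows that it is a combination of three powers of k up to
  O(k^(-Re s1 - Re s2)). Hence the tail beyond k = q is a combination of tails of the Riemann zeta
  function, which are O(q^(1 - Re s) / Im s) as long as |s| <= q/4, so the tail is
  O(q^(2 - sigma) / t). With q of order T the Dirichlet polynomial is squared out and integrated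
  termwise, the off-diagonal terms being estimated trivially; the cross term with the tail gives
  the error T^(5/2 - sigma).
*)
theory Submission
  imports Defs "HOL-Complex_Analysis.Complex_Analysis" "HOL-Real_Asymp.Real_Asymp"
begin

section \<open>Holomorphic functions of three variables\<close>

text \<open>The definition of the zeta value admits every connected open set that meets the
  convergence region, so two germs at one point might have been continued around the singular
  hyperplanes in different ways. This is why the continuation is carried to all of C^3 although the
  mean square only uses Re s3 > 0. Keeping an entire denominator \<rho> and a holomorphic numerator
  \<Phi> apart avoids any theory of meromorphic functions of several variables.

  On the analytic side the tail bound must hold for |s| up to a fixed multiple of q. It does because
  the weights of the binomial recursion add up to (1 - 1/q)^(-q/2), which stays near sqrt(e) and
  below 2, so the recursion contracts. The gained factor 1/t is square integrable over [2, T]: the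
  tail alone contributes only the square of T^(2-sigma), and its cross term with a polynomial of
  mean square O(T) has size T^(1/2) T^(2-sigma).\<close>

lemma infsum_holomorphic_ball:
  fixes f :: "'i \<Rightarrow> complex \<Rightarrow> complex"
  assumes hol: "\<And>i. i \<in> I \<Longrightarrow> f i holomorphic_on ball a e"
    and bound: "\<And>i z. i \<in> I \<Longrightarrow> z \<in> ball a e \<Longrightarrow> norm (f i z) \<le> B i"
    and B: "B summable_on I" and e: "e > 0"
  shows "(\<lambda>z. \<Sum>\<^sub>\<infinity>i\<in>I. f i z) field_differentiable at a"
proof -
  \<comment> \<open>The limit theorem asks for continuity up to the boundary, hence the closed ball
    of half the radius.\<close>
  have ul: "uniform_limit (cball a (e/2)) (\<lambda>X z. \<Sum>i\<in>X. f i z) (\<lambda>z. \<Sum>\<^sub>\<infinity>i\<in>I. f i z)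
      (finite_subsets_at_top I)"
    by (rule Weierstrass_m_test_general[OF _ B], rule bound) (use e in auto)
  have ev: "\<forall>\<^sub>F X in finite_subsets_at_top I. continuous_on (cball a (e/2)) (\<lambda>z. \<Sum>i\<in>X. f i z)
      \<and> (\<lambda>z. \<Sum>i\<in>X. f i z) holomorphic_on ball a (e/2)"
  proof (rule eventually_finite_subsets_at_top_weakI)
    fix X assume X: "finite X" "X \<subseteq> I"
    have "(\<lambda>z. \<Sum>i\<in>X. f i z) holomorphic_on ball a e"
      using X hol by (intro holomorphic_on_sum) auto
    then show "continuous_on (cball a (e/2)) (\<lambda>z. \<Sum>i\<in>X. f i z) \<and> (\<lambda>z. \<Sum>i\<in>X. f i z) holomorphic_on ball a (e/2)"
      using e by (auto intro!: holomorphic_on_imp_continuous_on elim!: holomorphic_on_subset)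
  qed
  obtain "(\<lambda>z. \<Sum>\<^sub>\<infinity>i\<in>I. f i z) holomorphic_on ball a (e/2)"
    using holomorphic_uniform_limit[OF ev ul] by (metis finite_subsets_at_top_neq_bot)
  then show ?thesis
    using e by (intro holomorphic_on_imp_differentiable_at[of _ "ball a (e/2)"]) auto
qed

lemma infsum_holomorphic_on:
  fixes f :: "'i \<Rightarrow> complex \<Rightarrow> complex"
  assumes U: "open U" and hol: "\<And>i. i \<in> I \<Longrightarrow> f i holomorphic_on U"
    and bound: "\<And>a. a \<in> U \<Longrightarrow> \<exists>e>0. \<exists>B. B summable_on I \<and> (\<forall>i\<in>I. \<forall>z \<in> ball a e \<inter> U. norm (f i z) \<le> B i)"
  shows "(\<lambda>z. \<Sum>\<^sub>\<infinity>i\<in>I. f i z) holomorphic_on U"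
proof -
  have "(\<lambda>z. \<Sum>\<^sub>\<infinity>i\<in>I. f i z) field_differentiable at a" if "a \<in> U" for a
  proof -
    obtain e B where e: "e > 0" "B summable_on I" "\<forall>i\<in>I. \<forall>z\<in>ball a e \<inter> U. norm (f i z) \<le> B i"
      using bound[OF \<open>a \<in> U\<close>] by blast
    obtain r where r: "r > 0" "ball a r \<subseteq> U"
      by (rule openE[OF U \<open>a \<in> U\<close>])
    show ?thesis
      by (rule infsum_holomorphic_ball[of I f a "min e r" B])
         (use e r in \<open>auto intro!: holomorphic_on_subset[OF hol]\<close>)
  qed
  then show ?thesis
    by (simp add: U holomorphic_on_open field_differentiable_def)
qed

lemma holo3_onI:
  assumes "open U" "continuous_on U f"
    "\<And>a b c. (a,b,c) \<in> U \<Longrightarrow> (\<lambda>z. f (z,b,c)) field_differentiable at a"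
    "\<And>a b c. (a,b,c) \<in> U \<Longrightarrow> (\<lambda>z. f (a,z,c)) field_differentiable at b"
    "\<And>a b c. (a,b,c) \<in> U \<Longrightarrow> (\<lambda>z. f (a,b,z)) field_differentiable at c"
  shows "holo3_on U f"
  using assms by (auto simp: holo3_on_def)

lemma holo3_onD:
  assumes "holo3_on U f"
  shows "open U" "continuous_on U f"
    "\<And>a b c. (a,b,c) \<in> U \<Longrightarrow> (\<lambda>z. f (z,b,c)) field_differentiable at a"
    "\<And>a b c. (a,b,c) \<in> U \<Longrightarrow> (\<lambda>z. f (a,z,c)) field_differentiable at b"
    "\<And>a b c. (a,b,c) \<in> U \<Longrightarrow> (\<lambda>z. f (a,b,z)) field_differentiable at c"
  using assms by (auto simp: holo3_on_def)

lemma holo3_on_slice: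
  assumes "holo3_on U f" "open S"
  shows "(\<And>z. z \<in> S \<Longrightarrow> (z,b,c) \<in> U) \<Longrightarrow> (\<lambda>z. f (z,b,c)) holomorphic_on S"
    and "(\<And>z. z \<in> S \<Longrightarrow> (a,z,c) \<in> U) \<Longrightarrow> (\<lambda>z. f (a,z,c)) holomorphic_on S"
    and "(\<And>z. z \<in> S \<Longrightarrow> (a,b,z) \<in> U) \<Longrightarrow> (\<lambda>z. f (a,b,z)) holomorphic_on S"
  using holo3_onD(3-5)[OF assms(1)] assms(2)
  by (simp_all add: holomorphic_on_open field_differentiable_def)

lemma holo3_on_const: "open U \<Longrightarrow> holo3_on U (\<lambda>_. k)"
  by (intro holo3_onI) auto

lemma holo3_on_coord:
  assumes "open U"
  shows "holo3_on U fst" "holo3_on U (\<lambda>q. fst (snd q))" "holo3_on U (\<lambda>q. snd (snd q))"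
  by (rule holo3_onI; use assms in \<open>auto intro!: continuous_intros\<close>)+

lemma holo3_on_add: "holo3_on U f \<Longrightarrow> holo3_on U g \<Longrightarrow> holo3_on U (\<lambda>q. f q + g q)"
  by (intro holo3_onI) (auto dest: holo3_onD intro!: continuous_intros field_differentiable_add)

lemma holo3_on_diff: "holo3_on U f \<Longrightarrow> holo3_on U g \<Longrightarrow> holo3_on U (\<lambda>q. f q - g q)"
  by (intro holo3_onI) (auto dest: holo3_onD intro!: continuous_intros field_differentiable_diff)

lemma holo3_on_minus: "holo3_on U f \<Longrightarrow> holo3_on U (\<lambda>q. - f q)"
  by (intro holo3_onI) (auto dest: holo3_onD intro!: continuous_intros field_differentiable_minus)

lemma holo3_on_mult: "holo3_on U f \<Longrightarrow> holo3_on U g \<Longrightarrow> holo3_on U (\<lambda>q. f q * g q)"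
  by (intro holo3_onI) (auto dest: holo3_onD intro!: continuous_intros field_differentiable_mult)

lemma holo3_on_divide:
  "holo3_on U f \<Longrightarrow> holo3_on U g \<Longrightarrow> (\<And>q. q \<in> U \<Longrightarrow> g q \<noteq> 0) \<Longrightarrow> holo3_on U (\<lambda>q. f q / g q)"
  by (intro holo3_onI) (auto dest: holo3_onD intro!: continuous_intros field_differentiable_divide)

lemma holo3_on_exp:
  assumes "holo3_on U f" shows "holo3_on U (\<lambda>q. exp (f q))"
proof -
  have *: "(\<lambda>z. exp (g z)) field_differentiable at a" if "g field_differentiable at a" for g :: "complex \<Rightarrow> complex" and a
    using field_differentiable_compose[OF that, of exp]
    by (simp add: o_def field_differentiable_within_exp)
  show ?thesis
    using assms by (intro holo3_onI) (auto dest: holo3_onD intro!: continuous_intros *)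
qed

lemma holo3_on_sum:
  assumes "open U" "\<And>i. i \<in> I \<Longrightarrow> holo3_on U (f i)" shows "holo3_on U (\<lambda>q. \<Sum>i\<in>I. f i q)"
  using assms
proof (induction I rule: infinite_finite_induct)
  case (insert x F)
  then show ?case by (simp add: holo3_on_add)
qed (auto intro: holo3_on_const)

lemma holo3_on_prod:
  assumes "open U" "\<And>i. i \<in> I \<Longrightarrow> holo3_on U (f i)" shows "holo3_on U (\<lambda>q. \<Prod>i\<in>I. f i q)"
  using assms
proof (induction I rule: infinite_finite_induct)
  case (insert x F)
  then show ?case by (simp add: holo3_on_mult)
qed (auto intro: holo3_on_const)

lemma holo3_on_subset: "holo3_on U f \<Longrightarrow> open V \<Longrightarrow> V \<subseteq> U \<Longrightarrow> holo3_on V f"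
  by (auto simp: holo3_on_def intro: continuous_on_subset)

text \<open>A local majorant makes the sum a locally uniform limit. This yields joint continuity
  and, on the three coordinate discs through a point, holomorphy in each variable.\<close>

lemma holo3_on_infsum:
  fixes F :: "'i \<Rightarrow> complex \<times> complex \<times> complex \<Rightarrow> complex"
  assumes U: "open U" and hol: "\<And>i. i \<in> I \<Longrightarrow> holo3_on U (F i)"
    and bound: "\<And>q. q \<in> U \<Longrightarrow> \<exists>e>0. \<exists>B. B summable_on I \<and> (\<forall>i\<in>I. \<forall>p\<in>ball q e \<inter> U. norm (F i p) \<le> B i)"
  shows "holo3_on U (\<lambda>q. \<Sum>\<^sub>\<infinity>i\<in>I. F i q)"
proof -
  have loc: "\<exists>e>0. \<exists>B. ball q e \<subseteq> U \<and> B summable_on I \<and> (\<forall>i\<in>I. \<forall>p\<in>ball q e. norm (F i p) \<le> B i)" if q: "q \<in> U" for q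
  proof -
    obtain e B where e: "e > 0" "B summable_on I" "\<forall>i\<in>I. \<forall>z\<in>ball q e \<inter> U. norm (F i z) \<le> B i"
      using bound[OF q] by blast
    obtain r where r: "r > 0" "ball q r \<subseteq> U"
      by (rule openE[OF U q])
    show ?thesis
      by (rule exI[of _ "min e r"], intro conjI exI[of _ B]) (use e r in auto)
  qed
  show ?thesis
  proof (rule holo3_onI[OF U])
    show "continuous_on U (\<lambda>q. \<Sum>\<^sub>\<infinity>i\<in>I. F i q)"
    proof -
      have "isCont (\<lambda>q. \<Sum>\<^sub>\<infinity>i\<in>I. F i q) q" if q: "q \<in> U" for q
      proof -
        obtain e B where e: "e > 0" "ball q e \<subseteq> U" "B summable_on I" "\<And>i p. i \<in> I \<Longrightarrow> p \<in> ball q e \<Longrightarrow> norm (F i p) \<le> B i"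
          using loc[OF q] by blast
        have ul: "uniform_limit (ball q e) (\<lambda>X z. \<Sum>i\<in>X. F i z) (\<lambda>z. \<Sum>\<^sub>\<infinity>i\<in>I. F i z) (finite_subsets_at_top I)"
          by (rule Weierstrass_m_test_general[OF _ e(3)], rule e(4))
        have "\<forall>\<^sub>F X in finite_subsets_at_top I. continuous_on (ball q e) (\<lambda>z. \<Sum>i\<in>X. F i z)"
          by (rule eventually_finite_subsets_at_top_weakI)
             (intro continuous_on_sum continuous_on_subset[OF holo3_onD(2)[OF hol] e(2)], auto)
        then have "continuous_on (ball q e) (\<lambda>z. \<Sum>\<^sub>\<infinity>i\<in>I. F i z)"
          by (rule uniform_limit_theorem[OF _ ul]) simp
        then show ?thesis
          using e(1) by (simp add: continuous_on_eq_continuous_at)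
      qed
      then show ?thesis using U by (simp add: continuous_on_eq_continuous_at)
    qed
  next
    fix a b c assume abc: "(a,b,c) \<in> U"
    obtain e B where e: "e > 0" "ball (a,b,c) e \<subseteq> U" "B summable_on I" "\<And>i p. i \<in> I \<Longrightarrow> p \<in> ball (a,b,c) e \<Longrightarrow> norm (F i p) \<le> B i"
      using loc[OF abc] by blast
    have sub: "\<And>z. z \<in> ball a e \<Longrightarrow> (z,b,c) \<in> ball (a,b,c) e" "\<And>z. z \<in> ball b e \<Longrightarrow> (a,z,c) \<in> ball (a,b,c) e"
      "\<And>z. z \<in> ball c e \<Longrightarrow> (a,b,z) \<in> ball (a,b,c) e"
      by (auto simp: dist_Pair_Pair)
    show "(\<lambda>z. \<Sum>\<^sub>\<infinity>i\<in>I. F i (z, b, c)) field_differentiable at a"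
      by (rule infsum_holomorphic_ball[where e = e and B = B])
         (use e(1,3) e(4)[OF _ sub(1)] e(4)[OF _ sub(2)] e(4)[OF _ sub(3)] in \<open>auto intro!: holo3_on_slice[OF hol] subsetD[OF e(2)] sub\<close>)
    show "(\<lambda>z. \<Sum>\<^sub>\<infinity>i\<in>I. F i (a, z, c)) field_differentiable at b"
      by (rule infsum_holomorphic_ball[where e = e and B = B])
         (use e(1,3) e(4)[OF _ sub(1)] e(4)[OF _ sub(2)] e(4)[OF _ sub(3)] in \<open>auto intro!: holo3_on_slice[OF hol] subsetD[OF e(2)] sub\<close>)
    show "(\<lambda>z. \<Sum>\<^sub>\<infinity>i\<in>I. F i (a, b, z)) field_differentiable at c"
      by (rule infsum_holomorphic_ball[where e = e and B = B])
         (use e(1,3) e(4)[OF _ sub(1)] e(4)[OF _ sub(2)] e(4)[OF _ sub(3)] in \<open>auto intro!: holo3_on_slice[OF hol] subsetD[OF e(2)] sub\<close>)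
  qed
qed

text \<open>The one-variable step for spreading agreement through a polydisc. The small ball may
  stick out of the large one and is shrunk first.\<close>

lemma holomorphic_ball_eqI:
  assumes "f holomorphic_on ball a r" "g holomorphic_on ball a r" "x \<in> ball a r" "d > 0"
    "\<And>z. z \<in> ball x d \<Longrightarrow> f z = g z" "y \<in> ball a r"
  shows "f y = g y"
proof -
  define d' where "d' = min d (r - dist a x)"
  have d': "d' > 0" using assms by (auto simp: d'_def)
  have "dist x z < d' \<Longrightarrow> dist a z < r" for z using dist_triangle[of a z x] by (auto simp: d'_def)
  then have sub: "ball x d' \<subseteq> ball a r" by auto
  show ?thesis
    by (rule analytic_continuation_open[of "ball x d'" "ball a r" f g])
       (use assms d' sub in \<open>auto simp: d'_def\<close>)
qed

text \<open>A connectedness argument: the interior \<open>G\<close> of the agreement set is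
  relatively closed in \<open>U\<close>. Near a point of its closure, agreement on a small polydisc
  spreads to a full polydisc one coordinate at a time.\<close>

lemma holo3_identity:
  assumes f: "holo3_on U f" and g: "holo3_on U g" and conn: "connected U"
    and V: "open V" "V \<subseteq> U" "V \<noteq> {}" and eq: "\<And>q. q \<in> V \<Longrightarrow> f q = g q" and p: "p \<in> U"
  shows "f p = g p"
proof -
  have U: "open U" using f by (simp add: holo3_on_def)
  define G where "G = interior {q \<in> U. f q = g q}"
  have GU: "G \<subseteq> U" "\<And>q. q \<in> G \<Longrightarrow> f q = g q" using interior_subset[of "{q \<in> U. f q = g q}"] by (auto simp: G_def)
  have step: "q \<in> G" if q: "q \<in> U" "q \<in> closure G" for q
  proof -
    obtain a b c where q3: "q = (a,b,c)" by (cases q)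
    obtain e where e: "e > 0" "ball q e \<subseteq> U" by (rule openE[OF U q(1)])
    \<comment> \<open>Half the radius lets a product of three discs fit into the ball, because 3 r^2
      < (2 r)^2; \<open>s\<close> below is chosen in the same way.\<close>
    define r where "r = e / 2"
    have r: "r > 0" and r2: "e\<^sup>2 = 4 * r\<^sup>2" using e by (auto simp: r_def power2_eq_square)
    define P where "P = ball a r \<times> ball b r \<times> ball c r"
    have PU: "P \<subseteq> U"
    proof
      fix x assume "x \<in> P"
      then obtain x1 x2 x3 where x: "x = (x1,x2,x3)" "dist a x1 < r" "dist b x2 < r" "dist c x3 < r" by (auto simp: P_def)
      have "sqrt ((dist a x1)\<^sup>2 + (dist b x2)\<^sup>2 + (dist c x3)\<^sup>2) < sqrt (e\<^sup>2)"
      proof (rule real_sqrt_less_mono)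
        have "(dist a x1)\<^sup>2 < r\<^sup>2" "(dist b x2)\<^sup>2 < r\<^sup>2" "(dist c x3)\<^sup>2 < r\<^sup>2"
          using x by (auto intro!: power_strict_mono)
        then show "(dist a x1)\<^sup>2 + (dist b x2)\<^sup>2 + (dist c x3)\<^sup>2 < e\<^sup>2" unfolding r2 using zero_le_power2[of r] by linarith
      qed
      then have "dist q x < e" using e by (simp add: q3 x dist_Pair_Pair add.assoc)
      then show "x \<in> U" using e by auto
    qed
    have Pop: "open P" by (simp add: P_def open_Times)
    have "q \<in> P" using r by (auto simp: q3 P_def)
    then obtain x where "x \<in> G \<inter> P" using q(2) open_Int_closure_eq_empty[OF Pop, of G] by blast
    moreover have GP: "open (G \<inter> P)" using Pop unfolding G_def by (intro open_Int open_interior)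
    ultimately obtain d where d: "d > 0" "ball x d \<subseteq> G \<inter> P" by (meson openE)
    obtain x1 x2 x3 where x: "x = (x1,x2,x3)" by (cases x)
    define s where "s = d / 2"
    have s: "s > 0" and s2: "d\<^sup>2 = 4 * s\<^sup>2" using d by (auto simp: s_def power2_eq_square)
    have Q: "(y1,y2,y3) \<in> G \<inter> P" if "dist x1 y1 < s" "dist x2 y2 < s" "dist x3 y3 < s" for y1 y2 y3
    proof -
      have "sqrt ((dist x1 y1)\<^sup>2 + (dist x2 y2)\<^sup>2 + (dist x3 y3)\<^sup>2) < sqrt (d\<^sup>2)"
      proof (rule real_sqrt_less_mono)
        have "(dist x1 y1)\<^sup>2 < s\<^sup>2" "(dist x2 y2)\<^sup>2 < s\<^sup>2" "(dist x3 y3)\<^sup>2 < s\<^sup>2"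
          using that by (auto intro!: power_strict_mono)
        then show "(dist x1 y1)\<^sup>2 + (dist x2 y2)\<^sup>2 + (dist x3 y3)\<^sup>2 < d\<^sup>2" unfolding s2 using zero_le_power2[of s] by linarith
      qed
      then have "dist x (y1,y2,y3) < d" using d by (simp add: x dist_Pair_Pair add.assoc)
      then show ?thesis using d by auto
    qed
    have xP: "x1 \<in> ball a r" "x2 \<in> ball b r" "x3 \<in> ball c r"
      using Q[of x1 x2 x3] s by (auto simp: P_def)
    have hol1: "(\<lambda>z. h (z,y2,y3)) holomorphic_on ball a r" if "holo3_on U h" "y2 \<in> ball b r" "y3 \<in> ball c r" for h y2 y3
      by (rule holo3_on_slice[OF that(1)]) (use that PU in \<open>auto simp: P_def\<close>)
    have hol2: "(\<lambda>z. h (y1,z,y3)) holomorphic_on ball b r" if "holo3_on U h" "y1 \<in> ball a r" "y3 \<in> ball c r" for h y1 y3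
      by (rule holo3_on_slice[OF that(1)]) (use that PU in \<open>auto simp: P_def\<close>)
    have hol3: "(\<lambda>z. h (y1,y2,z)) holomorphic_on ball c r" if "holo3_on U h" "y2 \<in> ball b r" "y1 \<in> ball a r" for h y2 y1
      by (rule holo3_on_slice[OF that(1)]) (use that PU in \<open>auto simp: P_def\<close>)
    have in1: "y2 \<in> ball b r" "y3 \<in> ball c r" if "dist x2 y2 < s" "dist x3 y3 < s" for y2 y3
      using Q[of x1 y2 y3] that s by (auto simp: P_def)
    \<comment> \<open>\<open>e1\<close>, \<open>e2\<close> and \<open>e3\<close> free the first,
      second and third coordinate in turn from the small disc around \<open>x\<close>.\<close>
    have e1: "f (y1,y2,y3) = g (y1,y2,y3)" if "y1 \<in> ball a r" "dist x2 y2 < s" "dist x3 y3 < s" for y1 y2 y3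
      by (rule holomorphic_ball_eqI[where a = a and r = r and x = x1 and d = s])
         (use that in1[OF that(2,3)] hol1 f g xP s Q GU in auto)
    have e2: "f (y1,y2,y3) = g (y1,y2,y3)" if "y1 \<in> ball a r" "y2 \<in> ball b r" "dist x3 y3 < s" for y1 y2 y3
      by (rule holomorphic_ball_eqI[where a = b and r = r and x = x2 and d = s])
         (use that in1[of x2 y3] hol2 f g xP s e1 in auto)
    have e3: "f (y1,y2,y3) = g (y1,y2,y3)" if "y1 \<in> ball a r" "y2 \<in> ball b r" "y3 \<in> ball c r" for y1 y2 y3
      by (rule holomorphic_ball_eqI[where a = c and r = r and x = x3 and d = s])
         (use that hol3 f g xP s e2 in auto)
    have "P \<subseteq> {q \<in> U. f q = g q}" using e3 PU by (auto simp: P_def)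
    then have "P \<subseteq> G" using Pop by (simp add: G_def interior_maximal)
    then show "q \<in> G" using \<open>q \<in> P\<close> by auto
  qed
  have "V \<subseteq> G" using V eq by (auto simp: G_def intro!: interior_maximal[THEN subsetD, of V])
  moreover have "openin (top_of_set U) G" using GU by (auto simp: G_def openin_open_eq U)
  moreover have "closedin (top_of_set U) G"
  proof -
    have "G = U \<inter> closure G" using step GU closure_subset by blast
    then show ?thesis by (metis closed_closure closedin_closed_Int)
  qed
  ultimately have "G = U" using conn V unfolding connected_clopen by blast
  then show ?thesis using GU p by auto
qed

section \<open>The kernel and its Taylor remainders\<close>

text \<open>Differentiation under the integral sign. \<open>L1\<close> and \<open>L2\<close> will be
  minus the logarithms of the two bases of the kernel, which makes its integral entire in the
  exponents.\<close>

lemma holo3_on_integral_exp: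
  fixes L1 L2 :: "real \<Rightarrow> complex"
  assumes "continuous_on {0..1} L1" "continuous_on {0..1} L2"
  shows "holo3_on UNIV (\<lambda>(a,b,c). integral {0..1} (\<lambda>y. exp (a * L1 y) * exp (c * L2 y)))"
proof (rule holo3_onI)
  have cont: "continuous_on (UNIV \<times> {0..1}) (\<lambda>x :: (complex \<times> complex \<times> complex) \<times> real. L1 (snd x))"
       "continuous_on (UNIV \<times> {0..1}) (\<lambda>x :: (complex \<times> complex \<times> complex) \<times> real. L2 (snd x))"
    by (rule continuous_on_compose2[OF assms(1)] continuous_on_compose2[OF assms(2)], auto intro!: continuous_intros)+
  have "continuous_on UNIV (\<lambda>q :: complex \<times> complex \<times> complex. integral (cbox 0 1) (\<lambda>y. exp (fst q * L1 y) * exp (snd (snd q) * L2 y)))"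
    by (rule integral_continuous_on_param) (auto simp: case_prod_unfold intro!: continuous_intros cont)
  then show "continuous_on UNIV (\<lambda>(a::complex,b::complex,c). integral {0..1} (\<lambda>y. exp (a * L1 y) * exp (c * L2 y)))"
    by (simp add: case_prod_unfold)
next
  have cont: "continuous_on (UNIV \<times> {0..1}) (\<lambda>x :: complex \<times> real. L1 (snd x))"
       "continuous_on (UNIV \<times> {0..1}) (\<lambda>x :: complex \<times> real. L2 (snd x))"
    by (rule continuous_on_compose2[OF assms(1)] continuous_on_compose2[OF assms(2)], auto intro!: continuous_intros)+
  note int = integrable_continuous_real
  fix a b c :: complex
  have "(\<lambda>a. integral (cbox 0 1) (\<lambda>y. exp (a * L1 y) * exp (c * L2 y))) holomorphic_on UNIV"
    by (rule leibniz_rule_holomorphic[where fx = "\<lambda>a y. L1 y * exp (a * L1 y) * exp (c * L2 y)"])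
       (auto simp: case_prod_unfold intro!: continuous_intros cont assms int derivative_eq_intros)
  then show "(\<lambda>z. case (z,b,c) of (a,b,c) \<Rightarrow> integral {0..1} (\<lambda>y. exp (a * L1 y) * exp (c * L2 y))) field_differentiable at a"
    by (auto intro: holomorphic_on_imp_differentiable_at)
  have "(\<lambda>c. integral (cbox 0 1) (\<lambda>y. exp (a * L1 y) * exp (c * L2 y))) holomorphic_on UNIV"
    by (rule leibniz_rule_holomorphic[where fx = "\<lambda>c y. exp (a * L1 y) * (L2 y * exp (c * L2 y))"])
       (auto simp: case_prod_unfold intro!: continuous_intros cont assms int derivative_eq_intros)
  then show "(\<lambda>z. case (a,b,z) of (a,b,c) \<Rightarrow> integral {0..1} (\<lambda>y. exp (a * L1 y) * exp (c * L2 y))) field_differentiable at c"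
    by (auto intro: holomorphic_on_imp_differentiable_at)
qed auto

lemma holo3_on_shift:
  assumes "holo3_on U f"
  shows "holo3_on {q. q + d \<in> U} (\<lambda>q. f (q + d))"
proof -
  obtain d1 d2 d3 where d: "d = (d1,d2,d3)" by (cases d)
  have "open ((\<lambda>q. q + d) -` U)"
    using assms by (intro open_vimage) (auto simp: holo3_on_def intro!: continuous_intros)
  moreover have "continuous_on {q. q + d \<in> U} (\<lambda>q. f (q + d))"
    by (rule continuous_on_compose2[OF holo3_onD(2)[OF assms]]) (auto intro!: continuous_intros)
  moreover have *: "(\<lambda>z. h (z + k)) field_differentiable at x" if "h field_differentiable at (x + k)" for h :: "complex \<Rightarrow> complex" and x k
    using field_differentiable_compose[of "\<lambda>z. z + k" x h] that by (simp add: o_def field_differentiable_add)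
  have "(\<lambda>z. f ((z, b, c) + d)) field_differentiable at a" "(\<lambda>z. f ((a, z, c) + d)) field_differentiable at b"
    "(\<lambda>z. f ((a, b, z) + d)) field_differentiable at c" if "(a,b,c) + d \<in> U" for a b c
    using holo3_onD(3-5)[OF assms, of "a + d1" "b + d2" "c + d3"] that
    by (auto simp: d intro!: *)
  ultimately show ?thesis by (intro holo3_onI) (auto simp: vimage_def)
qed

lemma holo3_on_powr:
  assumes "holo3_on U f" "x \<noteq> 0"
  shows "holo3_on U (\<lambda>q. x powr f q)"
  unfolding powr_def using assms
  by (auto intro!: holo3_on_exp holo3_on_mult holo3_on_const dest: holo3_onD)

text \<open>The derivatives in \<open>x\<close> are written through shifts of \<open>a\<close> and \<open>c\<close>, so that sums of derivatives are
  combinations of shifted sums.\<close>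
fun ker_deriv :: "nat \<Rightarrow> real \<Rightarrow> complex \<Rightarrow> complex \<Rightarrow> complex \<Rightarrow> complex" where
  "ker_deriv 0 n a c z = z powr (-a) * (z + of_real n) powr (-c)"
| "ker_deriv (Suc r) n a c z = - a * ker_deriv r n (a+1) c z - c * ker_deriv r n a (c+1) z"

lemma ker_deriv_deriv:
  assumes "Re z > 0" "n \<ge> 0"
  shows "(ker_deriv r n a c has_field_derivative ker_deriv (Suc r) n a c z) (at z)"
proof (induction r arbitrary: a c)
  case 0
  have [simp]: "z \<notin> \<real>\<^sub>\<le>\<^sub>0" "z + of_real n \<notin> \<real>\<^sub>\<le>\<^sub>0"
    using assms by (auto simp: complex_nonpos_Reals_iff)
  show ?case
    by (auto intro!: derivative_eq_intros simp: mult_ac)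
next
  case (Suc r)
  note [derivative_intros] = Suc.IH
  show ?case
    unfolding ker_deriv.simps(2)[of r n a c, abs_def]
    by (auto intro!: derivative_eq_intros)
qed

text \<open>For n <= x the base x + n lies between x and 2 x, so both factors are comparable with
  powers of x, uniformly in n. The recursion raises one exponent by 1, so each order gains a factor
  1/x, and the induction has to enlarge R by 1.\<close>

lemma ker_deriv_bound:
  "\<exists>K\<ge>0. \<forall>a c n x. norm a \<le> R \<longrightarrow> norm c \<le> R \<longrightarrow> 0 \<le> n \<longrightarrow> n \<le> x \<longrightarrow> 1 \<le> x \<longrightarrow>
     norm (ker_deriv r n a c (of_real x)) \<le> K * x powr (- Re (a + c) - real r)"
proof (induction r arbitrary: R)
  case 0
  show ?case
  proof (intro exI[of _ "2 powr \<bar>R\<bar>"] conjI allI impI)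
    fix a c :: complex and n x :: real
    assume H: "norm a \<le> R" "norm c \<le> R" "0 \<le> n" "n \<le> x" "1 \<le> x"
    have "(x + n) powr (- Re c) \<le> 2 powr \<bar>R\<bar> * x powr (- Re c)"
    proof (cases "Re c \<ge> 0")
      case True
      have "(x + n) powr (- Re c) \<le> x powr (- Re c)"
        using H True by (intro powr_mono2') auto
      also have "\<dots> \<le> 2 powr \<bar>R\<bar> * x powr (- Re c)"
        using ge_one_powr_ge_zero[of 2 "\<bar>R\<bar>"] mult_right_mono[of 1 "2 powr \<bar>R\<bar>" "x powr (- Re c)"] by simp
      finally show ?thesis .
    next
      case False
      have "(x + n) powr (- Re c) \<le> (2 * x) powr (- Re c)"
        using H False by (intro powr_mono2) auto
      also have "\<dots> = 2 powr (- Re c) * x powr (- Re c)"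
        using H by (simp add: powr_mult)
      also have "\<dots> \<le> 2 powr \<bar>R\<bar> * x powr (- Re c)"
        using H abs_Re_le_cmod[of c] by (intro mult_right_mono powr_mono) auto
      finally show ?thesis .
    qed
    moreover have "norm (ker_deriv 0 n a c (of_real x)) = x powr (- Re a) * (x + n) powr (- Re c)"
      using H by (simp add: norm_mult norm_powr_real_powr flip: of_real_add)
    moreover have "x powr (- Re (a + c)) = x powr (- Re a) * x powr (- Re c)"
      using H by (simp flip: powr_add)
    ultimately show "norm (ker_deriv 0 n a c (of_real x)) \<le> 2 powr \<bar>R\<bar> * x powr (- Re (a + c) - real 0)"
      by (simp add: mult.left_commute mult_left_mono)
  qed auto
next
  case (Suc r)
  obtain K where K: "K \<ge> 0" "\<And>a c n x. norm a \<le> \<bar>R\<bar> + 1 \<Longrightarrow> norm c \<le> \<bar>R\<bar> + 1 \<Longrightarrow> 0 \<le> n \<Longrightarrow> n \<le> x \<Longrightarrow> 1 \<le> x \<Longrightarrow>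
     norm (ker_deriv r n a c (of_real x)) \<le> K * x powr (- Re (a + c) - real r)"
    using Suc.IH[of "\<bar>R\<bar> + 1"] by metis
  show ?case
  proof (intro exI[of _ "2 * \<bar>R\<bar> * K"] conjI allI impI)
    fix a c :: complex and n x :: real
    assume H: "norm a \<le> R" "norm c \<le> R" "0 \<le> n" "n \<le> x" "1 \<le> x"
    have t: "norm (a + 1) \<le> \<bar>R\<bar> + 1" "norm (c + 1) \<le> \<bar>R\<bar> + 1" "norm a \<le> \<bar>R\<bar> + 1" "norm c \<le> \<bar>R\<bar> + 1"
      using H norm_triangle_ineq[of a 1] norm_triangle_ineq[of c 1] by auto
    define Y where "Y = x powr (- Re (a + c) - real (Suc r))"
    have e: "- Re (a + 1 + c) - real r = - Re (a + c) - real (Suc r)" "- Re (a + (c + 1)) - real r = - Re (a + c) - real (Suc r)"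
      by auto
    have k1: "norm (ker_deriv r n (a+1) c (of_real x)) \<le> K * Y"
      using K(2)[of "a+1" c n x] t H unfolding e Y_def by simp
    have k2: "norm (ker_deriv r n a (c+1) (of_real x)) \<le> K * Y"
      using K(2)[of a "c+1" n x] t H unfolding e Y_def by simp
    have "norm (ker_deriv (Suc r) n a c (of_real x)) \<le> norm a * norm (ker_deriv r n (a+1) c (of_real x)) + norm c * norm (ker_deriv r n a (c+1) (of_real x))"
      by (simp add: norm_mult[symmetric] norm_triangle_ineq4[THEN order_trans])
    also have "\<dots> \<le> \<bar>R\<bar> * (K * Y) + \<bar>R\<bar> * (K * Y)"
      using H k1 k2 by (intro add_mono mult_mono) auto
    finally show "norm (ker_deriv (Suc r) n a c (of_real x)) \<le> 2 * \<bar>R\<bar> * K * x powr (- Re (a + c) - real (Suc r))"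
      by (simp add: Y_def mult_ac)
  qed (use K in auto)
qed

lemma holo3_ker_deriv:
  assumes "z \<noteq> 0" "z + of_real n \<noteq> 0"
  shows "holo3_on UNIV (\<lambda>(a,b,c). ker_deriv r n a c z)"
proof (induction r)
  case 0
  show ?case unfolding case_prod_unfold ker_deriv.simps
    by (intro holo3_on_mult holo3_on_powr holo3_on_minus holo3_on_coord assms) auto
next
  case (Suc r)
  have "holo3_on UNIV (\<lambda>q. - fst q * (case q + (1,0,0) of (a,b,c) \<Rightarrow> ker_deriv r n a c z)
            - snd (snd q) * (case q + (0,0,1) of (a,b,c) \<Rightarrow> ker_deriv r n a c z))"
    using holo3_on_shift[OF Suc, of "(1,0,0)"] holo3_on_shift[OF Suc, of "(0,0,1)"]
    by (intro holo3_on_diff holo3_on_mult holo3_on_minus holo3_on_coord) auto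
  then show ?case by (simp add: case_prod_unfold)
qed

definition ker_int :: "nat \<Rightarrow> nat \<Rightarrow> complex \<Rightarrow> complex \<Rightarrow> complex" where
  "ker_int m n a c = integral {0..1} (\<lambda>y. ker_deriv 0 (real n) a c (of_nat m + of_real y))"

lemma holo3_ker_int:
  assumes "m \<ge> 1"
  shows "holo3_on UNIV (\<lambda>(a,b,c). ker_int m n a c)"
proof -
  define L1 L2 :: "real \<Rightarrow> complex" where "L1 = (\<lambda>y. - Ln (of_nat m + of_real y))" and "L2 = (\<lambda>y. - Ln (of_nat m + of_real y + of_nat n))"
  have nz: "of_nat m + complex_of_real y \<notin> \<real>\<^sub>\<le>\<^sub>0" "of_nat m + complex_of_real y + of_nat n \<notin> \<real>\<^sub>\<le>\<^sub>0"
       "of_nat m + complex_of_real y \<noteq> 0" "of_nat m + complex_of_real y + of_nat n \<noteq> 0" if "y \<in> {0..1}" for y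
    using that assms by (auto simp: complex_nonpos_Reals_iff complex_eq_iff)
  have "continuous_on {0..1} L1" "continuous_on {0..1} L2"
    unfolding L1_def L2_def using nz by (auto intro!: continuous_intros)
  from holo3_on_integral_exp[OF this]
  have "holo3_on UNIV (\<lambda>(a,b,c). integral {0..1} (\<lambda>y. exp (a * L1 y) * exp (c * L2 y)))" .
  moreover have "integral {0..1} (\<lambda>y. exp (a * L1 y) * exp (c * L2 y)) = ker_int m n a c" for a c
    unfolding ker_int_def by (intro integral_cong) (use nz in \<open>auto simp: L1_def L2_def powr_def\<close>)
  ultimately show ?thesis by simp
qed

text \<open>An integrated Taylor remainder at m: the factor 1/(i+1)! is the integral of y^i / i!
  over [0, 1].\<close>

definition ker_rem :: "nat \<Rightarrow> nat \<Rightarrow> nat \<Rightarrow> complex \<Rightarrow> complex \<Rightarrow> complex" where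
  "ker_rem J m n a c = ker_int m n a c - (\<Sum>i<J. ker_deriv i (real n) a c (of_nat m) / fact (Suc i))"

lemma holo3_ker_rem:
  assumes "m \<ge> 1"
  shows "holo3_on UNIV (\<lambda>(a,b,c). ker_rem J m n a c)"
proof -
  have "holo3_on UNIV (\<lambda>q. (case q of (a,b,c) \<Rightarrow> ker_int m n a c) - (\<Sum>i<J. (case q of (a,b,c) \<Rightarrow> ker_deriv i (real n) a c (of_nat m)) / fact (Suc i)))"
    by (intro holo3_on_diff holo3_on_sum holo3_on_divide holo3_ker_int holo3_ker_deriv holo3_on_const)
       (use assms in \<open>auto simp: complex_eq_iff\<close>)
  then show ?thesis by (simp add: ker_rem_def case_prod_unfold)
qed

text \<open>Taylor's theorem on the segment [m, m + 1], where the J-th derivative is smaller than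
  the kernel by m^(-J). This gain is what makes the remainder sum converge in a larger
  half-space.\<close>

lemma ker_rem_bound:
  assumes "J \<ge> 1"
  shows "\<exists>K\<ge>0. \<forall>a c n m. norm a \<le> R \<longrightarrow> norm c \<le> R \<longrightarrow> n \<le> m \<longrightarrow> 1 \<le> m \<longrightarrow>
     norm (ker_rem J m n a c) \<le> K * real m powr (- Re (a + c) - real J)"
proof -
  obtain K where K: "K \<ge> 0" "\<And>a c n x. norm a \<le> R \<Longrightarrow> norm c \<le> R \<Longrightarrow> 0 \<le> n \<Longrightarrow> n \<le> x \<Longrightarrow> 1 \<le> x \<Longrightarrow>
     norm (ker_deriv J n a c (of_real x)) \<le> K * x powr (- Re (a + c) - real J)"
    using ker_deriv_bound[of R J] by metis
  \<comment> \<open>The extra power of 2 compares t in [m, m + 1] with m, their quotient being at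
    most 2.\<close>
  define K' where "K' = K * 2 powr (2 * \<bar>R\<bar>)"
  show ?thesis
  proof (intro exI[of _ K'] conjI allI impI)
    fix a c :: complex and n m :: nat
    assume H: "norm a \<le> R" "norm c \<le> R" "n \<le> m" "1 \<le> m"
    define e where "e = - Re (a + c) - real J"
    define B where "B = K' * real m powr e"
    define S where "S = complex_of_real ` {real m..real m + 1}"
    have Sconv: "convex S" unfolding S_def by (intro convex_linear_image linear_of_real) auto
    have Re_uc: "- Re (a + c) \<le> 2 * \<bar>R\<bar>" using H abs_Re_le_cmod[of a] abs_Re_le_cmod[of c] by auto
    have bS: "norm (ker_deriv J (real n) a c x) \<le> B" if x: "x \<in> S" for x
    proof -
      obtain t where t: "x = of_real t" "real m \<le> t" "t \<le> real m + 1" using x by (auto simp: S_def)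
      have "t powr e \<le> 2 powr (2 * \<bar>R\<bar>) * real m powr e"
      proof (cases "e \<le> 0")
        case True
        have "t powr e \<le> real m powr e" using t H True by (intro powr_mono2') auto
        also have "\<dots> \<le> 2 powr (2 * \<bar>R\<bar>) * real m powr e"
          using ge_one_powr_ge_zero[of 2 "2 * \<bar>R\<bar>"] mult_right_mono[of 1 "2 powr (2 * \<bar>R\<bar>)" "real m powr e"] by simp
        finally show ?thesis .
      next
        case False
        have "t powr e \<le> (2 * real m) powr e" using t H False by (intro powr_mono2) auto
        also have "\<dots> = 2 powr e * real m powr e" using H by (simp add: powr_mult)
        also have "\<dots> \<le> 2 powr (2 * \<bar>R\<bar>) * real m powr e"
          using Re_uc by (intro mult_right_mono powr_mono) (auto simp: e_def)
        finally show ?thesis .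
      qed
      then have "K * t powr e \<le> B"
        using K(1) by (simp add: B_def K'_def mult.assoc mult_left_mono)
      then show ?thesis using K(2)[of a c "real n" t] H t by (auto simp: e_def)
    qed
    have B0: "B \<ge> 0" using K by (simp add: B_def K'_def)
    have taylor: "norm (ker_deriv 0 (real n) a c (of_nat m + of_real y) - (\<Sum>i\<le>J - 1. ker_deriv i (real n) a c (of_nat m) * of_real y ^ i / fact i)) \<le> B"
      if y: "y \<in> {0..1}" for y
    proof -
      have "norm (ker_deriv 0 (real n) a c (of_nat m + of_real y) - (\<Sum>i\<le>J - 1. ker_deriv i (real n) a c (of_nat m) * (of_nat m + of_real y - of_nat m) ^ i / fact i))
          \<le> B * norm ((of_nat m + of_real y) - (of_nat m :: complex)) ^ (Suc (J - 1)) / fact (J - 1)"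
      proof (rule complex_Taylor[OF Sconv, where f = "\<lambda>i. ker_deriv i (real n) a c" and n = "J - 1" and B = B])
        fix i x assume "x \<in> S"
        then show "(ker_deriv i (real n) a c has_field_derivative ker_deriv (Suc i) (real n) a c x) (at x within S)"
          using H by (auto simp: S_def simp del: ker_deriv.simps intro: has_field_derivative_at_within[OF ker_deriv_deriv])
      next
        fix x assume "x \<in> S"
        then show "norm (ker_deriv (Suc (J - 1)) (real n) a c x) \<le> B" using bS assms by simp
      next
        show "of_nat m \<in> S" by (auto simp: S_def image_iff intro!: bexI[of _ "real m"])
        show "of_nat m + of_real y \<in> S" using y by (auto simp: S_def image_iff intro!: bexI[of _ "real m + y"])
      qed
      also have "\<dots> \<le> B"
      proof -
        have e: "norm ((of_nat m + of_real y) - (of_nat m :: complex)) = y" using y by simp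
        have "B * y ^ Suc (J - 1) / fact (J - 1) \<le> B * y ^ Suc (J - 1) / 1"
          using B0 y by (intro divide_left_mono mult_nonneg_nonneg zero_le_power) (auto simp: fact_ge_1)
        also have "\<dots> \<le> B * 1"
          unfolding div_by_1 using B0 y by (intro mult_left_mono power_le_one) auto
        finally show ?thesis unfolding e by simp
      qed
      finally show ?thesis by simp
    qed
    have lt: "{..<J} = {..J - 1}" using assms by auto
    have int1: "(\<lambda>y. ker_deriv 0 (real n) a c (of_nat m + of_real y)) integrable_on {0..1}"
      using H by (intro integrable_continuous_real) (auto intro!: continuous_intros simp: complex_nonpos_Reals_iff complex_eq_iff)
    have hp: "((\<lambda>y::real. ker_deriv i (real n) a c (of_nat m) * of_real y ^ i / fact i) has_integral ker_deriv i (real n) a c (of_nat m) / fact (Suc i)) {0..1}" for i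
    proof -
      have "((\<lambda>y::real. y ^ i) has_integral (1 ^ Suc i / real (Suc i) - 0 ^ Suc i / real (Suc i))) {0..1}"
        by (rule fundamental_theorem_of_calculus)
           (auto intro!: derivative_eq_intros simp del: power_Suc of_nat_Suc simp flip: has_real_derivative_iff_has_vector_derivative)
      from has_integral_linear[OF this bounded_linear_of_real[where 'a = complex]]
      have "((\<lambda>y::real. of_real y ^ i :: complex) has_integral (1 / of_nat (Suc i))) {0..1}"
        by (simp add: o_def del: of_nat_Suc)
      from has_integral_mult_right[OF this, of "ker_deriv i (real n) a c (of_nat m) / fact i"]
      show ?thesis by (simp add: field_simps)
    qed
    have "((\<lambda>y. ker_deriv 0 (real n) a c (of_nat m + of_real y) - (\<Sum>i\<le>J - 1. ker_deriv i (real n) a c (of_nat m) * of_real y ^ i / fact i)) has_integral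
        (ker_int m n a c - (\<Sum>i\<le>J - 1. ker_deriv i (real n) a c (of_nat m) / fact (Suc i)))) {0..1}"
      unfolding ker_int_def by (intro has_integral_diff has_integral_sum hp integrable_integral int1) auto
    from has_integral_bound[OF B0 this[folded cbox_interval]] taylor
    have "norm (ker_rem J m n a c) \<le> B" by (simp add: ker_rem_def lt)
    then show "norm (ker_rem J m n a c) \<le> K' * real m powr (- Re (a + c) - real J)"
      by (simp add: B_def e_def)
  qed (use K in \<open>auto simp: K'_def\<close>)
qed

section \<open>Lattice sums over a cone\<close>

abbreviation abs_summable :: "('a \<Rightarrow> 'b::real_normed_vector) \<Rightarrow> 'a set \<Rightarrow> bool" where
  "abs_summable f A \<equiv> (\<lambda>x. norm (f x)) summable_on A"

lemma has_sum_diff: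
  fixes f g :: "'a \<Rightarrow> 'b::real_normed_vector"
  assumes "(f has_sum x) A" "(g has_sum y) A"
  shows "((\<lambda>p. f p - g p) has_sum (x - y)) A"
  using has_sum_add[OF assms(1), of "\<lambda>p. - g p" "- y"] assms(2) by (simp add: has_sum_uminus)

lemma has_sum_finite_sum:
  fixes f :: "'i \<Rightarrow> 'a \<Rightarrow> 'b::real_normed_vector"
  assumes "\<And>i. i \<in> I \<Longrightarrow> (f i has_sum s i) A"
  shows "((\<lambda>p. \<Sum>i\<in>I. f i p) has_sum (\<Sum>i\<in>I. s i)) A"
  using assms by (induction I rule: infinite_finite_induct) (auto intro!: has_sum_add has_sum_0)

text \<open>Where the sum of n^(-b) m^(-(a+c)-k) over 1 <= n <= m converges absolutely: the first
  inequality serves the inner sum over m, the second the outer sum over n. The original sums live on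
  k = 0, and larger k are the targets of the continuation.\<close>

definition halfspace_uw :: "nat \<Rightarrow> (complex \<times> complex \<times> complex) set" where
  "halfspace_uw k = {(a,b,c). Re (a + c) > 1 - real k \<and> Re (a + b + c) > 2 - real k}"

definition cone :: "(nat \<times> nat) set" where
  "cone = {(m,n). 1 \<le> n \<and> n \<le> m}"

lemma open_halfspace_uw: "open (halfspace_uw k)"
proof -
  have "halfspace_uw k = {q. Re (fst q + snd (snd q)) > 1 - real k} \<inter> {q. Re (fst q + fst (snd q) + snd (snd q)) > 2 - real k}"
    by (auto simp: halfspace_uw_def)
  then show ?thesis by (auto intro!: open_Int open_Collect_less continuous_intros)
qed

lemma halfspace_uw_mono: "k \<le> l \<Longrightarrow> halfspace_uw k \<subseteq> halfspace_uw l"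
  by (auto simp: halfspace_uw_def)

lemma summable_on_powr_nat:
  assumes "s > 1" shows "(\<lambda>n::nat. real n powr (- s)) summable_on UNIV"
  using assms by (subst summable_on_UNIV_nonneg_real_iff) (auto simp: summable_real_powr_iff)

lemma summable_on_powr_prod:
  assumes "s > 1"
  shows "(\<lambda>(m::nat,n::nat). real m powr (- s) * real n powr (- s)) summable_on A"
proof -
  have "(\<lambda>p. case p of (m::nat,n::nat) \<Rightarrow> real m powr (- s) * real n powr (- s)) summable_on (UNIV \<times> UNIV)"
  proof (rule summable_on_SigmaI)
    fix m :: nat
    show "((\<lambda>n. case (m, n) of (m, n) \<Rightarrow> real m powr (- s) * real n powr (- s)) has_sum
            real m powr (- s) * (\<Sum>\<^sub>\<infinity>n\<in>UNIV. real n powr (- s))) UNIV"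
      using summable_on_powr_nat[OF assms] by (simp add: has_sum_cmult_right)
  qed (use summable_on_powr_nat[OF assms] in \<open>auto intro: summable_on_cmult_left\<close>)
  then show ?thesis by (rule summable_on_subset) auto
qed

text \<open>On n <= m surplus decay in m can be traded for decay in n. Hence lower bounds for u and
  w alone dominate the terms by (m n)^(-1-d), locally uniformly.\<close>

lemma cone_sum:
  fixes F :: "nat \<times> nat \<Rightarrow> complex \<times> complex \<times> complex \<Rightarrow> complex"
  assumes A: "A \<subseteq> cone"
    and hol: "\<And>m n. (m,n) \<in> A \<Longrightarrow> holo3_on UNIV (F (m,n))"
    and bound: "\<And>R. \<exists>K\<ge>0. \<forall>m n a b c. (m,n) \<in> A \<longrightarrow> norm a \<le> R \<longrightarrow> norm c \<le> R \<longrightarrow>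
       norm (F (m,n) (a,b,c)) \<le> K * real n powr (- Re b) * real m powr (- Re (a + c) - real k)"
  shows "holo3_on (halfspace_uw k) (\<lambda>q. \<Sum>\<^sub>\<infinity>p\<in>A. F p q)" "\<And>q. q \<in> halfspace_uw k \<Longrightarrow> abs_summable (\<lambda>p. F p q) A"
proof -
  have loc: "\<exists>e>0. \<exists>B. B summable_on A \<and> (\<forall>i\<in>A. \<forall>p\<in>ball q e \<inter> halfspace_uw k. norm (F i p) \<le> B i)" if q: "q \<in> halfspace_uw k" for q
  proof -
    obtain a0 b0 c0 where q3: "q = (a0,b0,c0)" by (cases q)
    define u0 w0 where "u0 = Re (a0 + c0) + real k" and "w0 = Re b0 + u0"
    have uw: "u0 > 1" "w0 > 2" using q by (auto simp: q3 halfspace_uw_def u0_def w0_def)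
    \<comment> \<open>Moving the point by less than d costs up to 3 d in the weight, and an exponent
      1 + d is split off twice; an eighth of the smaller slack covers these 5 d.\<close>
    define d where "d = min (u0 - 1) (w0 - 2) / 8"
    have d: "d > 0" "8 * d \<le> u0 - 1" "8 * d \<le> w0 - 2" using uw by (auto simp: d_def)
    define R where "R = norm a0 + norm c0 + d"
    obtain K where K: "K \<ge> 0" "\<And>m n a b c. (m,n) \<in> A \<Longrightarrow> norm a \<le> R \<Longrightarrow> norm c \<le> R \<Longrightarrow>
       norm (F (m,n) (a,b,c)) \<le> K * real n powr (- Re b) * real m powr (- Re (a + c) - real k)"
      using bound[of R] by metis
    define B where "B = (\<lambda>p. K * (case p of (m,n) \<Rightarrow> real m powr (- (1 + d)) * real n powr (- (1 + d))))"
    show ?thesis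
    proof (intro exI[of _ d] conjI exI[of _ B] ballI)
      show "B summable_on A" unfolding B_def using d by (intro summable_on_cmult_right summable_on_powr_prod) auto
    next
      fix i p assume i: "i \<in> A" and p: "p \<in> ball q d \<inter> halfspace_uw k"
      obtain a b c where p3: "p = (a,b,c)" by (cases p)
      obtain m n where mn: "i = (m,n)" by (cases i)
      have mn1: "1 \<le> n" "n \<le> m" using i A by (auto simp: mn cone_def)
      have dists: "norm (a - a0) < d" "norm (b - b0) < d" "norm (c - c0) < d"
      proof -
        have D: "dist p q < d" using p by (simp add: dist_commute)
        have "dist a a0 \<le> dist p q" "dist (b,c) (b0,c0) \<le> dist p q" "dist b b0 \<le> dist (b,c) (b0,c0)" "dist c c0 \<le> dist (b,c) (b0,c0)"
          using dist_fst_le[of p q] dist_snd_le[of p q] dist_fst_le[of "(b,c)" "(b0,c0)"] dist_snd_le[of "(b,c)" "(b0,c0)"]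
          by (simp_all add: p3 q3)
        with D show "norm (a - a0) < d" "norm (b - b0) < d" "norm (c - c0) < d"
          unfolding dist_norm[symmetric] by linarith+
      qed
      have "norm a \<le> norm (a - a0) + norm a0" "norm c \<le> norm (c - c0) + norm c0"
        using norm_triangle_ineq[of "a - a0" a0] norm_triangle_ineq[of "c - c0" c0] by auto
      then have nR: "norm a \<le> R" "norm c \<le> R" using dists norm_ge_zero[of a0] norm_ge_zero[of c0] unfolding R_def by linarith+
      have Re: "Re a \<ge> Re a0 - d" "Re b \<ge> Re b0 - d" "Re c \<ge> Re c0 - d"
        using dists abs_Re_le_cmod[of "a - a0"] abs_Re_le_cmod[of "b - b0"] abs_Re_le_cmod[of "c - c0"] by auto
      define al be where "al = u0 - 2 * d" and "be = Re b0 - d"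
      have "norm (F i p) \<le> K * real n powr (- Re b) * real m powr (- Re (a + c) - real k)"
        using K(2)[of m n a c b] i nR by (simp add: mn p3)
      also have "\<dots> \<le> K * real n powr (- be) * real m powr (- al)"
        using Re mn1 K(1) by (intro mult_mono powr_mono mult_nonneg_nonneg) (auto simp: al_def be_def u0_def)
      also have "real m powr (- al) = real m powr (- (1 + d)) * real m powr (- (al - 1 - d))"
        by (simp flip: powr_add)
      \<comment> \<open>Here n <= m enters: al - 1 - d is nonnegative, so this part of the decay
        passes from m to n.\<close>
      also have "K * real n powr (- be) * (real m powr (- (1 + d)) * real m powr (- (al - 1 - d)))
          \<le> K * real n powr (- be) * (real m powr (- (1 + d)) * real n powr (- (al - 1 - d)))"
        using mn1 d K(1) by (intro mult_left_mono powr_mono2' mult_nonneg_nonneg) (auto simp: al_def)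
      also have "\<dots> = K * (real m powr (- (1 + d)) * real n powr (- (be + al - 1 - d)))"
      proof -
        have "real n powr (- be) * real n powr (- (al - 1 - d)) = real n powr (- (be + al - 1 - d))"
          by (subst powr_add[symmetric]) (rule arg_cong[of _ _ "\<lambda>t. real n powr t"], simp)
        then show ?thesis by (simp add: mult_ac)
      qed
      also have "\<dots> \<le> K * (real m powr (- (1 + d)) * real n powr (- (1 + d)))"
        using mn1 d K(1) by (intro mult_left_mono powr_mono) (auto simp: al_def be_def w0_def)
      finally show "norm (F i p) \<le> B i" by (simp add: B_def mn)
    qed (use d in auto)
  qed
  show "holo3_on (halfspace_uw k) (\<lambda>q. \<Sum>\<^sub>\<infinity>p\<in>A. F p q)"
    by (rule holo3_on_infsum[OF open_halfspace_uw _ loc]) (use hol in \<open>auto intro: holo3_on_subset open_halfspace_uw\<close>)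
  show "abs_summable (\<lambda>p. F p q) A" if q: "q \<in> halfspace_uw k" for q
  proof -
    obtain e B where e: "e > 0" "B summable_on A" "\<forall>i\<in>A. \<forall>p\<in>ball q e \<inter> halfspace_uw k. norm (F i p) \<le> B i"
      using loc[OF q] by auto
    show ?thesis
      by (rule summable_on_comparison_test[OF e(2)]) (use e q in auto)
  qed
qed

text \<open>The index set is a parameter because the continuation argument is run first over
  \<open>axis_points\<close>, where it produces the Riemann zeta function, and then over
  \<open>cone\<close>.\<close>

definition lattice_sum :: "(nat \<times> nat) set \<Rightarrow> nat \<Rightarrow> complex \<times> complex \<times> complex \<Rightarrow> complex" where
  "lattice_sum A r = (\<lambda>(a,b,c). \<Sum>\<^sub>\<infinity>(m,n)\<in>A. of_nat n powr (-b) * ker_deriv r (real n) a c (of_nat m))"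

definition lattice_rem :: "(nat \<times> nat) set \<Rightarrow> nat \<Rightarrow> complex \<times> complex \<times> complex \<Rightarrow> complex" where
  "lattice_rem A J = (\<lambda>(a,b,c). \<Sum>\<^sub>\<infinity>(m,n)\<in>A. of_nat n powr (-b) * ker_rem J m n a c)"

definition lattice_int :: "(nat \<times> nat) set \<Rightarrow> complex \<times> complex \<times> complex \<Rightarrow> complex" where
  "lattice_int A = (\<lambda>(a,b,c). \<Sum>\<^sub>\<infinity>(m,n)\<in>A. of_nat n powr (-b) * ker_int m n a c)"

lemma norm_nat_powr: "n \<ge> 1 \<Longrightarrow> norm (of_nat n powr s :: complex) = real n powr Re s"
  using norm_powr_real_powr[of "of_nat n" s] by simp

lemma lattice_sum_props:
  assumes A: "A \<subseteq> cone"
  shows "holo3_on (halfspace_uw r) (lattice_sum A r)"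
    and "\<And>a b c. (a,b,c) \<in> halfspace_uw r \<Longrightarrow>
      abs_summable (\<lambda>(m,n). of_nat n powr (-b) * ker_deriv r (real n) a c (of_nat m)) A"
proof -
  define F :: "nat \<times> nat \<Rightarrow> complex \<times> complex \<times> complex \<Rightarrow> complex"
    where "F = (\<lambda>(m,n) q. of_nat n powr (- fst (snd q)) * (case q of (a,b,c) \<Rightarrow> ker_deriv r (real n) a c (of_nat m)))"
  have hol: "holo3_on UNIV (F (m,n))" if "(m,n) \<in> A" for m n
    unfolding F_def prod.case using that A
    by (intro holo3_on_mult holo3_on_powr holo3_on_minus holo3_on_coord holo3_ker_deriv)
       (auto simp: cone_def complex_eq_iff)
  have bound: "\<exists>K\<ge>0. \<forall>m n a b c. (m,n) \<in> A \<longrightarrow> norm a \<le> R \<longrightarrow> norm c \<le> R \<longrightarrow>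
       norm (F (m,n) (a,b,c)) \<le> K * real n powr (- Re b) * real m powr (- Re (a + c) - real r)" for R
  proof -
    obtain K where K: "K \<ge> 0" "\<And>a c n x. norm a \<le> R \<Longrightarrow> norm c \<le> R \<Longrightarrow> 0 \<le> n \<Longrightarrow> n \<le> x \<Longrightarrow> 1 \<le> x \<Longrightarrow>
       norm (ker_deriv r n a c (of_real x)) \<le> K * x powr (- Re (a + c) - real r)"
      using ker_deriv_bound[of R r] by metis
    have "norm (F (m,n) (a,b,c)) \<le> K * real n powr (- Re b) * real m powr (- Re (a + c) - real r)"
      if "(m,n) \<in> A" "norm a \<le> R" "norm c \<le> R" for m n a b c
    proof -
      have mn: "1 \<le> n" "n \<le> m" using that A by (auto simp: cone_def)
      have "norm (F (m,n) (a,b,c)) = real n powr (- Re b) * norm (ker_deriv r (real n) a c (of_real (real m)))"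
        using mn by (simp add: F_def norm_mult norm_nat_powr)
      also have "\<dots> \<le> real n powr (- Re b) * (K * real m powr (- Re (a + c) - real r))"
        using mn that by (intro mult_left_mono K) auto
      finally show ?thesis by (simp add: mult_ac)
    qed
    then show ?thesis using K(1) by blast
  qed
  have "lattice_sum A r = (\<lambda>q. \<Sum>\<^sub>\<infinity>p\<in>A. F p q)"
    by (auto simp: lattice_sum_def F_def fun_eq_iff intro!: infsum_cong)
  then show "holo3_on (halfspace_uw r) (lattice_sum A r)"
    using cone_sum(1)[where F = F, OF A _ bound] hol by simp
  fix a b c :: complex
  assume q: "(a,b,c) \<in> halfspace_uw r"
  have "(\<lambda>(m,n). of_nat n powr (-b) * ker_deriv r (real n) a c (of_nat m)) = (\<lambda>p. F p (a,b,c))"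
    by (auto simp: F_def)
  then show "abs_summable (\<lambda>(m,n). of_nat n powr (-b) * ker_deriv r (real n) a c (of_nat m)) A"
    using cone_sum(2)[where F = F, OF A _ bound q] hol by simp
qed

lemma lattice_rem_props:
  assumes A: "A \<subseteq> cone" and J: "J \<ge> 1"
  shows "holo3_on (halfspace_uw J) (lattice_rem A J)"
    and "\<And>a b c. (a,b,c) \<in> halfspace_uw J \<Longrightarrow>
      abs_summable (\<lambda>(m,n). of_nat n powr (-b) * ker_rem J m n a c) A"
proof -
  define F :: "nat \<times> nat \<Rightarrow> complex \<times> complex \<times> complex \<Rightarrow> complex"
    where "F = (\<lambda>(m,n) q. of_nat n powr (- fst (snd q)) * (case q of (a,b,c) \<Rightarrow> ker_rem J m n a c))"
  have hol: "holo3_on UNIV (F (m,n))" if "(m,n) \<in> A" for m n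
    unfolding F_def prod.case using that A
    by (intro holo3_on_mult holo3_on_powr holo3_on_minus holo3_on_coord holo3_ker_rem)
       (auto simp: cone_def complex_eq_iff)
  have bound: "\<exists>K\<ge>0. \<forall>m n a b c. (m,n) \<in> A \<longrightarrow> norm a \<le> R \<longrightarrow> norm c \<le> R \<longrightarrow>
       norm (F (m,n) (a,b,c)) \<le> K * real n powr (- Re b) * real m powr (- Re (a + c) - real J)" for R
  proof -
    obtain K where K: "K \<ge> 0" "\<And>a c n m. norm a \<le> R \<Longrightarrow> norm c \<le> R \<Longrightarrow> n \<le> m \<Longrightarrow> 1 \<le> m \<Longrightarrow>
       norm (ker_rem J m n a c) \<le> K * real m powr (- Re (a + c) - real J)"
      using ker_rem_bound[OF J, of R] by metis
    have "norm (F (m,n) (a,b,c)) \<le> K * real n powr (- Re b) * real m powr (- Re (a + c) - real J)"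
      if "(m,n) \<in> A" "norm a \<le> R" "norm c \<le> R" for m n a b c
    proof -
      have mn: "1 \<le> n" "n \<le> m" using that A by (auto simp: cone_def)
      have "norm (F (m,n) (a,b,c)) = real n powr (- Re b) * norm (ker_rem J m n a c)"
        using mn by (simp add: F_def norm_mult norm_nat_powr)
      also have "\<dots> \<le> real n powr (- Re b) * (K * real m powr (- Re (a + c) - real J))"
        using mn that by (intro mult_left_mono K) auto
      finally show ?thesis by (simp add: mult_ac)
    qed
    then show ?thesis using K(1) by blast
  qed
  have "lattice_rem A J = (\<lambda>q. \<Sum>\<^sub>\<infinity>p\<in>A. F p q)"
    by (auto simp: lattice_rem_def F_def fun_eq_iff intro!: infsum_cong)
  then show "holo3_on (halfspace_uw J) (lattice_rem A J)"
    using cone_sum(1)[where F = F, OF A _ bound] hol by simp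
  fix a b c :: complex
  assume q: "(a,b,c) \<in> halfspace_uw J"
  have "(\<lambda>(m,n). of_nat n powr (-b) * ker_rem J m n a c) = (\<lambda>p. F p (a,b,c))"
    by (auto simp: F_def)
  then show "abs_summable (\<lambda>(m,n). of_nat n powr (-b) * ker_rem J m n a c) A"
    using cone_sum(2)[where F = F, OF A _ bound q] hol by simp
qed

text \<open>The two shifts raise u and w by 1, so a continuation of the sum of order r to one
  half-space gives that of order r + 1 on the next larger one.\<close>

lemma lattice_sum_Suc:
  assumes A: "A \<subseteq> cone" and q: "q \<in> halfspace_uw 0"
  shows "lattice_sum A (Suc r) q = - fst q * lattice_sum A r (q + (1,0,0)) - snd (snd q) * lattice_sum A r (q + (0,0,1))"
proof -
  obtain a b c where q3: "q = (a,b,c)" by (cases q)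
  have in1: "(a+1,b,c) \<in> halfspace_uw r" "(a,b,c+1) \<in> halfspace_uw r" using q by (auto simp: q3 halfspace_uw_def)
  note s1 = lattice_sum_props(2)[OF A in1(1), THEN abs_summable_summable] and s2 = lattice_sum_props(2)[OF A in1(2), THEN abs_summable_summable]
  have "lattice_sum A (Suc r) q = (\<Sum>\<^sub>\<infinity>p\<in>A. - a * (case p of (m,n) \<Rightarrow> of_nat n powr (-b) * ker_deriv r (real n) (a+1) c (of_nat m))
          - c * (case p of (m,n) \<Rightarrow> of_nat n powr (-b) * ker_deriv r (real n) a (c+1) (of_nat m)))"
    unfolding lattice_sum_def q3 prod.case by (intro infsum_cong) (auto simp: algebra_simps)
  also have "\<dots> = - a * lattice_sum A r (a+1,b,c) - c * lattice_sum A r (a,b,c+1)"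
    unfolding lattice_sum_def prod.case by (intro infsumI has_sum_diff has_sum_cmult_right has_sum_infsum s1 s2)
  finally show ?thesis by (simp add: q3)
qed

text \<open>The integral is the value of the kernel at m plus the first-order remainder, and both
  are already summable.\<close>

lemma ker_int_summable:
  assumes A: "A \<subseteq> cone" and q: "(a,b,c) \<in> halfspace_uw 0"
  shows "abs_summable (\<lambda>(m,n). of_nat n powr (-b) * ker_int m n a c) A"
proof -
  have "(a,b,c) \<in> halfspace_uw 1" using q halfspace_uw_mono[of 0 1] by auto
  from summable_on_add[OF abs_summable_summable[OF lattice_rem_props(2)[OF A _ this]] abs_summable_summable[OF lattice_sum_props(2)[OF A q]]]
  have "abs_summable (\<lambda>p. (case p of (m, n) \<Rightarrow> of_nat n powr - b * ker_rem 1 m n a c) +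
          (case p of (m, n) \<Rightarrow> of_nat n powr - b * ker_deriv 0 (real n) a c (of_nat m))) A"
    by (simp flip: summable_on_iff_abs_summable_on_complex)
  then show ?thesis
    by (rule back_subst[of "\<lambda>f. abs_summable f A"])
       (auto simp: ker_rem_def fun_eq_iff algebra_simps simp del: ker_deriv.simps)
qed

lemma lattice_int_expand:
  assumes A: "A \<subseteq> cone" and J: "J \<ge> 1" and q: "q \<in> halfspace_uw 0"
  shows "lattice_int A q = (\<Sum>i<J. lattice_sum A i q / fact (Suc i)) + lattice_rem A J q"
proof -
  obtain a b c where q3: "q = (a,b,c)" by (cases q)
  have qk: "(a,b,c) \<in> halfspace_uw k" for k using q halfspace_uw_mono[of 0 k] by (auto simp: q3)
  have "((\<lambda>p. (\<Sum>i<J. (case p of (m,n) \<Rightarrow> of_nat n powr (-b) * ker_deriv i (real n) a c (of_nat m)) / fact (Suc i))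
        + (case p of (m,n) \<Rightarrow> of_nat n powr (-b) * ker_rem J m n a c)) has_sum
        ((\<Sum>i<J. lattice_sum A i q / fact (Suc i)) + lattice_rem A J q)) A"
    unfolding lattice_sum_def lattice_rem_def q3 prod.case
    by (intro has_sum_add has_sum_finite_sum has_sum_divide_const has_sum_infsum
         abs_summable_summable[OF lattice_sum_props(2)[OF A qk]] abs_summable_summable[OF lattice_rem_props(2)[OF A J qk]])
  also have "?this \<longleftrightarrow> ((\<lambda>(m,n). of_nat n powr (-b) * ker_int m n a c) has_sum ((\<Sum>i<J. lattice_sum A i q / fact (Suc i)) + lattice_rem A J q)) A"
    by (intro has_sum_cong) (auto simp: ker_rem_def sum_distrib_left algebra_simps simp del: ker_deriv.simps)
  finally show ?thesis by (simp add: lattice_int_def q3 infsumI)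
qed

section \<open>Integrals of the kernel\<close>

definition beta_coeff :: "complex \<Rightarrow> complex \<Rightarrow> nat \<Rightarrow> complex" where
  "beta_coeff a u j = pochhammer a j / fact j / (u - 1 + of_nat j)"

text \<open>For Re u > 1 this is the incomplete beta integral of y^(u-2) (1-y)^(-a) over [0, 1/2],
  integrated term by term. The substitution y = 1/(x+1) turns it into the integral of x^(-a)
  (x+1)^(a-u) over [1, oo). The series shows the poles u = 1 - j in its denominators.\<close>

definition beta_series :: "complex \<Rightarrow> complex \<Rightarrow> complex" where
  "beta_series a u = 2 powr (1 - u) * (\<Sum>j. beta_coeff a u j * (1/2) ^ j)"

lemma pochhammer_sums:
  fixes z a :: complex assumes "norm z < 1"
  shows "(\<lambda>j. pochhammer a j / fact j * z ^ j) sums ((1 - z) powr (- a))"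
proof -
  have "(\<lambda>j. ((- a) gchoose j) * (- z) ^ j) sums (1 + (- z)) powr (- a)"
    by (rule gen_binomial_complex) (use assms in simp)
  moreover have "((- a) gchoose j) * (- z) ^ j = pochhammer a j / fact j * z ^ j" for j
  proof -
    have "(- 1) ^ j * P / F * ((- 1) ^ j * Z) = ((- 1) ^ j * (- 1) ^ j) * (P / F * Z)" for P F Z :: complex by simp
    moreover have "(- 1) ^ j * (- 1) ^ j = (1 :: complex)" by (simp flip: power_mult_distrib)
    ultimately show ?thesis by (simp only: gbinomial_pochhammer power_minus[of z] minus_minus mult_1_left)
  qed
  ultimately show ?thesis by simp
qed

lemma pochhammer_summable_norm:
  fixes z a :: complex assumes "norm z < 1"
  shows "summable (\<lambda>j. norm (pochhammer a j / fact j * z ^ j))"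
proof -
  obtain r where r: "norm z < r" "r < 1" using assms dense by blast
  have r0: "0 < r" using norm_ge_zero[of z] r(1) by linarith
  have "summable (\<lambda>j. pochhammer a j / fact j * (of_real r) ^ j)"
    using pochhammer_sums[of "of_real r" a] r r0 by (auto simp: sums_iff)
  from powser_insidea[OF this, of z] r r0 show ?thesis by auto
qed

lemma psi_summable:
  fixes z :: complex assumes "norm z < 1" "Re u > 1"
  shows "summable (\<lambda>j. beta_coeff a u j * z ^ j)"
proof (rule summable_comparison_test)
  define d where "d = Re u - 1"
  have d: "d > 0" using assms by (simp add: d_def)
  show "summable (\<lambda>j. norm (pochhammer a j / fact j * z ^ j) / d)"
    by (intro summable_divide pochhammer_summable_norm assms)
  have "norm (beta_coeff a u j * z ^ j) \<le> norm (pochhammer a j / fact j * z ^ j) / d" for j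
  proof -
    have "d \<le> norm (u - 1 + of_nat j)" using complex_Re_le_cmod[of "u - 1 + of_nat j"] by (simp add: d_def)
    then have "norm (pochhammer a j / fact j * z ^ j) / norm (u - 1 + of_nat j) \<le> norm (pochhammer a j / fact j * z ^ j) / d"
      using d by (intro divide_left_mono) (auto intro!: mult_pos_pos)
    then show ?thesis by (simp add: beta_coeff_def norm_mult norm_divide)
  qed
  then show "\<exists>N. \<forall>n\<ge>N. norm (beta_coeff a u n * z ^ n) \<le> norm (pochhammer a n / fact n * z ^ n) / d" by blast
qed

text \<open>The operator (u - 1) + z d/dz multiplies the j-th coefficient by u - 1 + j, which
  cancels the denominator and leaves the binomial series. This first-order equation is what gives
  \<open>ker_antideriv\<close> its derivative.\<close>

lemma psi_deriv:
  fixes z :: complex assumes z: "norm z < 1" and u: "Re u > 1"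
  obtains D where "((\<lambda>z. \<Sum>j. beta_coeff a u j * z ^ j) has_field_derivative D) (at z)"
    "(u - 1) * (\<Sum>j. beta_coeff a u j * z ^ j) + z * D = (1 - z) powr (- a)"
proof -
  obtain r where r: "norm z < r" "r < 1" using assms dense by blast
  have r0: "0 < r" using norm_ge_zero[of z] r(1) by linarith
  define c where "c = beta_coeff a u"
  define D where "D = (\<Sum>n. diffs c n * z ^ n)"
  have sr: "summable (\<lambda>n. c n * (of_real r) ^ n)"
    unfolding c_def using r r0 by (intro psi_summable u) auto
  have D: "((\<lambda>z. \<Sum>j. c j * z ^ j) has_field_derivative D) (at z)"
    unfolding D_def by (rule termdiffs_strong[OF sr]) (use r r0 in simp)
  have "summable (\<lambda>n. diffs c n * z ^ n)"
    by (rule termdiff_converges[of _ 1])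
       (use z psi_summable[OF _ u, of _ a] in \<open>auto simp: c_def\<close>)
  from sums_mult[OF diffs_equiv[OF this], of z]
  have "(\<lambda>n. z * (of_nat n * c n * z ^ (n - Suc 0))) sums (z * D)" by (simp add: D_def)
  moreover have "z * (of_nat n * c n * z ^ (n - Suc 0)) = of_nat n * c n * z ^ n" for n
    by (cases n) auto
  ultimately have "(\<lambda>n. of_nat n * c n * z ^ n) sums (z * D)" by simp
  moreover have "(\<lambda>n. c n * z ^ n) sums (\<Sum>j. c j * z ^ j)"
    using psi_summable[OF z u, of a] by (simp add: c_def summable_sums)
  ultimately have "(\<lambda>n. (u - 1) * (c n * z ^ n) + of_nat n * c n * z ^ n) sums ((u - 1) * (\<Sum>j. c j * z ^ j) + z * D)"
    by (intro sums_add sums_mult)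
  moreover have "(u - 1) * (c n * z ^ n) + of_nat n * c n * z ^ n = pochhammer a n / fact n * z ^ n" for n
  proof -
    have "u - 1 + of_nat n \<noteq> 0" using u by (auto simp: complex_eq_iff)
    then have "(u - 1 + of_nat n) * c n = pochhammer a n / fact n" by (simp add: c_def beta_coeff_def)
    moreover have "(u - 1) * (c n * z ^ n) + of_nat n * c n * z ^ n = (u - 1 + of_nat n) * c n * z ^ n"
      by (simp add: algebra_simps)
    ultimately show ?thesis by simp
  qed
  ultimately have "(\<lambda>n. pochhammer a n / fact n * z ^ n) sums ((u - 1) * (\<Sum>j. c j * z ^ j) + z * D)" by simp
  with pochhammer_sums[OF z, of a] have "(u - 1) * (\<Sum>j. c j * z ^ j) + z * D = (1 - z) powr (- a)"
    by (simp add: sums_iff)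
  with D that show ?thesis by (simp add: c_def)
qed

text \<open>An antiderivative of the kernel, found by expanding \<open>x\<^sup>-\<^sup>a\<close> in powers of \<open>n / (x + n)\<close>,
  which stays bounded by \<open>1/2\<close> for \<open>x \<ge> n\<close>.\<close>
definition ker_antideriv :: "nat \<Rightarrow> complex \<Rightarrow> complex \<Rightarrow> complex \<Rightarrow> complex" where
  "ker_antideriv n a c z = (z + of_nat n) powr (1 - (a + c)) * (\<Sum>j. beta_coeff a (a + c) j * (of_nat n / (z + of_nat n)) ^ j)"

text \<open>With p = x + n and z = n/p the product rule gives -p^(-u) times the left side of the
  equation in \<open>psi_deriv\<close>, hence -p^(-u) (1-z)^(-a); since 1 - z = x/p this is minus
  the kernel. The sign comes from normalising the antiderivative to vanish at infinity.\<close>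

lemma ker_antideriv_deriv:
  assumes n: "n \<ge> 1" and x: "x > 0" and u: "Re (a + c) > 1"
  shows "(ker_antideriv n a c has_field_derivative - ker_deriv 0 (real n) a c (of_real x)) (at (of_real x))"
proof -
  define u where "u = a + c"
  define p :: complex where "p = of_real x + of_nat n"
  have pr: "p = of_real (x + real n)" by (simp add: p_def)
  have p: "p \<notin> \<real>\<^sub>\<le>\<^sub>0" "p \<noteq> 0" using x unfolding pr by (auto simp del: of_real_add)
  define z where "z = of_nat n / p"
  have z1: "z = of_real (real n / (x + real n))" by (simp add: z_def pr)
  have nz: "norm z < 1" unfolding z1 norm_of_real using x by (auto simp: divide_simps)
  obtain D where D: "((\<lambda>z. \<Sum>j. beta_coeff a u j * z ^ j) has_field_derivative D) (at z)"
    "(u - 1) * (\<Sum>j. beta_coeff a u j * z ^ j) + z * D = (1 - z) powr (- a)"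
    using psi_deriv[OF nz, of u a] u by (auto simp: u_def)
  define P where "P = (\<Sum>j. beta_coeff a u j * z ^ j)"
  have dz: "((\<lambda>y. of_nat n / (y + of_nat n)) has_field_derivative (- of_nat n / p\<^sup>2)) (at (of_real x))"
    using p unfolding p_def by (auto intro!: derivative_eq_intros simp: power2_eq_square field_simps)
  have d2: "((\<lambda>y. \<Sum>j. beta_coeff a u j * (of_nat n / (y + of_nat n)) ^ j) has_field_derivative D * (- of_nat n / p\<^sup>2)) (at (of_real x))"
    using DERIV_chain2[OF D(1)[unfolded z_def p_def] dz] .
  have d1: "((\<lambda>y. (y + of_nat n) powr (1 - u)) has_field_derivative ((1 - u) * p powr (- u))) (at (of_real x))"
    using p unfolding p_def by (auto intro!: derivative_eq_intros)
  have "(ker_antideriv n a c has_field_derivative ((1 - u) * p powr (- u) * P + D * (- of_nat n / p\<^sup>2) * p powr (1 - u))) (at (of_real x))"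
    using DERIV_mult[OF d1 d2] unfolding ker_antideriv_def[abs_def] u_def[symmetric] P_def z_def p_def by (simp add: algebra_simps)
  also have "(1 - u) * p powr (- u) * P + D * (- of_nat n / p\<^sup>2) * p powr (1 - u) = - (p powr (- u) * ((u - 1) * P + z * D))"
    using p by (simp add: powr_diff powr_minus z_def field_simps power2_eq_square)
  also have "(u - 1) * P + z * D = (1 - z) powr (- a)" using D(2) by (simp add: P_def)
  also have "p powr (- u) * (1 - z) powr (- a) = ker_deriv 0 (real n) a c (of_real x)"
  proof -
    have q1: "1 - real n / (x + real n) = x / (x + real n)" and q2: "x / (x + real n) * (x + real n) = x"
      using x by (simp_all add: field_simps)
    have "1 - z = of_real (x / (x + real n))" unfolding z1 q1[symmetric] by simp
    moreover have "of_real x powr (- a) = (of_real (x / (x + real n)) * of_real (x + real n) :: complex) powr (- a)"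
      unfolding of_real_mult[symmetric] q2 ..
    moreover have "\<dots> = of_real (x / (x + real n)) powr (- a) * p powr (- a)"
      unfolding pr using x by (intro powr_times_real) auto
    moreover have "p powr (- u) = p powr (- a) * p powr (- c)" using p by (simp add: u_def flip: powr_add)
    ultimately show ?thesis by (simp add: p_def)
  qed
  finally show ?thesis .
qed

lemma ker_int_eq_antideriv:
  assumes n: "n \<ge> 1" and m: "m \<ge> 1" and u: "Re (a + c) > 1"
  shows "ker_int m n a c = ker_antideriv n a c (of_nat m) - ker_antideriv n a c (of_nat (Suc m))"
proof -
  have "((\<lambda>y. ker_deriv 0 (real n) a c (of_nat m + of_real y)) has_integral
      (- ker_antideriv n a c (of_nat m + of_real 1)) - (- ker_antideriv n a c (of_nat m + of_real 0))) {0..1}"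
  proof (rule fundamental_theorem_of_calculus)
    fix y :: real assume y: "y \<in> {0..1}"
    have "((\<lambda>z. - ker_antideriv n a c (of_nat m + z)) has_field_derivative ker_deriv 0 (real n) a c (of_nat m + of_real y)) (at (of_real y))"
      using ker_antideriv_deriv[OF n _ u, of "real m + y"] y m
      by (auto intro!: derivative_eq_intros DERIV_chain2[where f = "ker_antideriv n a c"] simp del: ker_deriv.simps)
    then show "((\<lambda>y. - ker_antideriv n a c (of_nat m + of_real y)) has_vector_derivative ker_deriv 0 (real n) a c (of_nat m + of_real y)) (at y within {0..1})"
      by (rule has_vector_derivative_real_field)
  qed auto
  then show ?thesis by (simp add: ker_int_def integral_unique add.commute del: ker_deriv.simps)
qed

lemma ker_antideriv_tendsto_0:
  assumes u: "Re (a + c) > 1"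
  shows "(\<lambda>m. ker_antideriv n a c (of_nat m)) \<longlonglongrightarrow> 0"
proof -
  have "(\<lambda>m. (of_nat m + of_nat n :: complex) powr (1 - (a + c))) \<longlonglongrightarrow> 0"
  proof (rule Lim_null_comparison)
    show "\<forall>\<^sub>F m in sequentially. norm ((of_nat m + of_nat n :: complex) powr (1 - (a + c))) \<le> real (m + n) powr (- (Re (a + c) - 1))"
      using eventually_gt_at_top[of 0]
      by eventually_elim (use norm_nat_powr[of "_ + n" "1 - (a + c)"] in \<open>auto simp flip: of_nat_add\<close>)
    show "(\<lambda>m. real (m + n) powr (- (Re (a + c) - 1))) \<longlonglongrightarrow> 0"
      using u by (intro tendsto_neg_powr filterlim_compose[OF filterlim_real_sequentially] filterlim_add_const_nat_at_top) auto
  qed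
  moreover have "(\<lambda>m. \<Sum>j. beta_coeff a (a + c) j * (of_nat n / (of_nat m + of_nat n)) ^ j) \<longlonglongrightarrow> (\<Sum>j. beta_coeff a (a + c) j * 0 ^ j)"
  proof -
    obtain D where "((\<lambda>z. \<Sum>j. beta_coeff a (a + c) j * z ^ j) has_field_derivative D) (at 0)"
      using psi_deriv[of 0 "a + c" a] u by auto
    then have "isCont (\<lambda>z. \<Sum>j. beta_coeff a (a + c) j * z ^ j) 0" by (rule DERIV_isCont)
    moreover have "(\<lambda>m. of_nat n / (of_nat m + of_nat n) :: complex) \<longlonglongrightarrow> 0"
    proof -
      have "(\<lambda>m. of_nat n / of_nat (m + n) :: complex) \<longlonglongrightarrow> 0"
        using LIMSEQ_ignore_initial_segment[OF lim_const_over_n[of "of_nat n"], of n] by simp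
      then show ?thesis by simp
    qed
    ultimately show ?thesis by (rule isCont_tendsto_compose)
  qed
  ultimately show ?thesis unfolding ker_antideriv_def by (metis (no_types) tendsto_mult mult_zero_left)
qed

text \<open>The unit intervals from n onwards telescope to the antiderivative at n. There the
  argument of the series is n/(2n) = 1/2 and the prefactor is (2n)^(1-u), which explains the shape
  of \<open>beta_series\<close>.\<close>

lemma ker_int_has_sum:
  assumes n: "n \<ge> 1" and u: "Re (a + c) > 1" and s: "(\<lambda>m. ker_int m n a c) summable_on {n..}"
  shows "((\<lambda>m. ker_int m n a c) has_sum (of_nat n powr (1 - (a + c)) * beta_series a (a + c))) {n..}"
proof -
  obtain S where S: "((\<lambda>m. ker_int m n a c) has_sum S) {n..}" using s by (auto simp: summable_on_def)
  then have "((\<lambda>i. ker_int (i + n) n a c) has_sum S) UNIV"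
    by (subst has_sum_reindex_bij_witness[where S = UNIV and T = "{n..}" and i = "\<lambda>m. m - n" and j = "\<lambda>i. i + n" and h = "\<lambda>m. ker_int m n a c" and s' = S]) auto
  then have "(\<lambda>i. ker_int (i + n) n a c) sums S" by (rule has_sum_imp_sums)
  moreover have "(\<lambda>i. ker_antideriv n a c (of_nat (i + n)) - ker_antideriv n a c (of_nat (Suc i + n))) sums (ker_antideriv n a c (of_nat (0 + n)) - 0)"
    by (rule telescope_sums') (use LIMSEQ_ignore_initial_segment[OF ker_antideriv_tendsto_0[OF u], of n n] in simp)
  moreover have "ker_int (i + n) n a c = ker_antideriv n a c (of_nat (i + n)) - ker_antideriv n a c (of_nat (Suc i + n))" for i
    using ker_int_eq_antideriv[OF n _ u, of "i + n"] n by simp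
  ultimately have "S = ker_antideriv n a c (of_nat n)" by (simp add: sums_iff)
  also have "\<dots> = of_nat n powr (1 - (a + c)) * beta_series a (a + c)"
  proof -
    have e: "of_nat n + of_nat n = of_real (real n) * (of_real 2 :: complex)" by simp
    have "(of_nat n + of_nat n :: complex) powr (1 - (a + c)) = of_nat n powr (1 - (a + c)) * 2 powr (1 - (a + c))"
      unfolding e by (subst powr_times_real) auto
    moreover have "of_nat n / (of_nat n + of_nat n :: complex) = 1/2" using n by (simp add: field_simps)
    ultimately show ?thesis by (simp add: ker_antideriv_def beta_series_def)
  qed
  finally show ?thesis using S by simp
qed

section \<open>Meromorphic continuation\<close>

text \<open>The factor \<open>\<rho>\<close> clears the poles of the continuation of \<open>F\<close> from \<open>C\<close> to \<open>X\<close>; \<open>P\<close> is a set free of poles.\<close>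
definition mero_cont :: "(complex \<times> complex \<times> complex) set \<Rightarrow> (complex \<times> complex \<times> complex) set \<Rightarrow>
    (complex \<times> complex \<times> complex) set \<Rightarrow> (complex \<times> complex \<times> complex \<Rightarrow> complex) \<Rightarrow> bool" where
  "mero_cont X C P F \<longleftrightarrow> (\<exists>\<rho> \<Phi>. holo3_on UNIV \<rho> \<and> (\<forall>q\<in>P. \<rho> q \<noteq> 0) \<and> holo3_on X \<Phi> \<and> (\<forall>q\<in>C. \<Phi> q = \<rho> q * F q))"

section \<open>Calculus of pole-clearing pairs\<close>

lemma mero_contI:
  "holo3_on UNIV \<rho> \<Longrightarrow> (\<And>q. q \<in> P \<Longrightarrow> \<rho> q \<noteq> 0) \<Longrightarrow> holo3_on X \<Phi> \<Longrightarrow> (\<And>q. q \<in> C \<Longrightarrow> \<Phi> q = \<rho> q * F q) \<Longrightarrow> mero_cont X C P F"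
  unfolding mero_cont_def by blast

lemma mero_contE:
  assumes "mero_cont X C P F"
  obtains \<rho> \<Phi> where "holo3_on UNIV \<rho>" "\<And>q. q \<in> P \<Longrightarrow> \<rho> q \<noteq> 0" "holo3_on X \<Phi>" "\<And>q. q \<in> C \<Longrightarrow> \<Phi> q = \<rho> q * F q"
  using assms unfolding mero_cont_def by blast

lemma mero_cont_holo: "holo3_on X F \<Longrightarrow> mero_cont X C P F"
  by (rule mero_contI[of "\<lambda>_. 1" _ _ F]) (auto intro: holo3_on_const)

lemma mero_cont_cong: "mero_cont X C P F \<Longrightarrow> (\<And>q. q \<in> C \<Longrightarrow> F q = G q) \<Longrightarrow> mero_cont X C P G"
  unfolding mero_cont_def by metis

lemma mero_cont_subset:
  "mero_cont X C P F \<Longrightarrow> open X' \<Longrightarrow> X' \<subseteq> X \<Longrightarrow> C' \<subseteq> C \<Longrightarrow> P' \<subseteq> P \<Longrightarrow> mero_cont X' C' P' F"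
  unfolding mero_cont_def by (meson holo3_on_subset subset_iff)

lemma mero_cont_open: "mero_cont X C P F \<Longrightarrow> open X"
  by (auto simp: mero_cont_def holo3_on_def)

lemma mero_cont_add:
  assumes "mero_cont X C P F" "mero_cont X C P G" shows "mero_cont X C P (\<lambda>q. F q + G q)"
proof -
  note o = mero_cont_open[OF assms(1)]
  from assms(1) obtain r1 f1 where 1: "holo3_on UNIV r1" "\<And>q. q \<in> P \<Longrightarrow> r1 q \<noteq> 0" "holo3_on X f1" "\<And>q. q \<in> C \<Longrightarrow> f1 q = r1 q * F q" by (rule mero_contE) blast
  from assms(2) obtain r2 f2 where 2: "holo3_on UNIV r2" "\<And>q. q \<in> P \<Longrightarrow> r2 q \<noteq> 0" "holo3_on X f2" "\<And>q. q \<in> C \<Longrightarrow> f2 q = r2 q * G q" by (rule mero_contE) blast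
  show ?thesis
    by (rule mero_contI[of "\<lambda>q. r1 q * r2 q" _ _ "\<lambda>q. r2 q * f1 q + r1 q * f2 q"])
       (use 1 2 o in \<open>auto simp: algebra_simps intro!: holo3_on_add holo3_on_mult intro: holo3_on_subset\<close>)
qed

lemma mero_cont_mult:
  assumes "mero_cont X C P F" "mero_cont X C P G" shows "mero_cont X C P (\<lambda>q. F q * G q)"
proof -
  from assms(1) obtain r1 f1 where 1: "holo3_on UNIV r1" "\<And>q. q \<in> P \<Longrightarrow> r1 q \<noteq> 0" "holo3_on X f1" "\<And>q. q \<in> C \<Longrightarrow> f1 q = r1 q * F q" by (rule mero_contE) blast
  from assms(2) obtain r2 f2 where 2: "holo3_on UNIV r2" "\<And>q. q \<in> P \<Longrightarrow> r2 q \<noteq> 0" "holo3_on X f2" "\<And>q. q \<in> C \<Longrightarrow> f2 q = r2 q * G q" by (rule mero_contE) blast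
  show ?thesis
    by (rule mero_contI[of "\<lambda>q. r1 q * r2 q" _ _ "\<lambda>q. f1 q * f2 q"])
       (use 1 2 in \<open>auto intro!: holo3_on_mult\<close>)
qed

lemma mero_cont_diff:
  assumes "mero_cont X C P F" "mero_cont X C P G" shows "mero_cont X C P (\<lambda>q. F q - G q)"
  using mero_cont_add[OF assms(1) mero_cont_mult[OF mero_cont_holo[OF holo3_on_const[of X "-1"]] assms(2)]] mero_cont_open[OF assms(1)]
  by simp

lemma mero_cont_sum:
  assumes "open X" "\<And>i. i \<in> I \<Longrightarrow> mero_cont X C P (F i)" shows "mero_cont X C P (\<lambda>q. \<Sum>i\<in>I. F i q)"
  using assms(2)
proof (induction I rule: infinite_finite_induct)
  case (insert x F)
  then show ?case by (simp add: mero_cont_add)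
qed (use assms(1) in \<open>auto intro: mero_cont_holo holo3_on_const\<close>)

lemma mero_cont_shift:
  assumes "mero_cont X C P F"
  shows "mero_cont {q. q + d \<in> X} {q. q + d \<in> C} {q. q + d \<in> P} (\<lambda>q. F (q + d))"
proof -
  from assms obtain r f where 1: "holo3_on UNIV r" "\<And>q. q \<in> P \<Longrightarrow> r q \<noteq> 0" "holo3_on X f" "\<And>q. q \<in> C \<Longrightarrow> f q = r q * F q" by (rule mero_contE) blast
  show ?thesis
    by (rule mero_contI[of "\<lambda>q. r (q + d)" _ _ "\<lambda>q. f (q + d)"])
       (use 1 holo3_on_shift[OF 1(1), of d] holo3_on_shift[OF 1(3), of d] in auto)
qed

text \<open>The symmetry between m and n in the double series, which carries the sum over n <= m to
  the one over m <= n.\<close>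

definition swap12 :: "complex \<times> complex \<times> complex \<Rightarrow> complex \<times> complex \<times> complex" where
  "swap12 q = (fst (snd q), fst q, snd (snd q))"

lemma holo3_on_swap:
  assumes "holo3_on U f" shows "holo3_on (swap12 -` U) (\<lambda>q. f (swap12 q))"
proof -
  have "open (swap12 -` U)"
    using assms by (intro open_vimage) (auto simp: holo3_on_def swap12_def intro!: continuous_intros)
  moreover have "continuous_on (swap12 -` U) (\<lambda>q. f (swap12 q))"
    by (rule continuous_on_compose2[OF holo3_onD(2)[OF assms]]) (auto simp: swap12_def intro!: continuous_intros)
  ultimately show ?thesis
    by (rule holo3_onI) (auto simp: swap12_def intro: holo3_onD[OF assms])
qed

lemma mero_cont_swap:
  assumes "mero_cont X C P F"
  shows "mero_cont (swap12 -` X) (swap12 -` C) (swap12 -` P) (\<lambda>q. F (swap12 q))"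
proof -
  from assms obtain r f where 1: "holo3_on UNIV r" "\<And>q. q \<in> P \<Longrightarrow> r q \<noteq> 0" "holo3_on X f" "\<And>q. q \<in> C \<Longrightarrow> f q = r q * F q" by (rule mero_contE) blast
  show ?thesis
    by (rule mero_contI[of "\<lambda>q. r (swap12 q)" _ _ "\<lambda>q. f (swap12 q)"])
       (use 1 holo3_on_swap[OF 1(1)] holo3_on_swap[OF 1(3)] in auto)
qed

text \<open>The sum over \<open>axis_points\<close> does not depend on the second coordinate; the value \<open>1\<close> makes the
  conditions defining \<open>halfspace_uw\<close> equivalent to one condition on the weight.\<close>
definition weight_line :: "complex \<Rightarrow> complex \<times> complex \<times> complex \<Rightarrow> complex \<times> complex \<times> complex" where
  "weight_line d q = (fst q + fst (snd q) + snd (snd q) - d, 1, 0)"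

lemma holo3_on_weight_line:
  assumes "holo3_on U f" shows "holo3_on (weight_line d -` U) (\<lambda>q. f (weight_line d q))"
proof -
  have "open (weight_line d -` U)"
    using assms by (intro open_vimage) (auto simp: holo3_on_def weight_line_def intro!: continuous_intros)
  moreover have "continuous_on (weight_line d -` U) (\<lambda>q. f (weight_line d q))"
    by (rule continuous_on_compose2[OF holo3_onD(2)[OF assms]]) (auto simp: weight_line_def intro!: continuous_intros)
  moreover have *: "(\<lambda>z. h (g z)) field_differentiable at x" if "h field_differentiable at (g x)" "g field_differentiable at x" for h g :: "complex \<Rightarrow> complex" and x
    using field_differentiable_compose[OF that(2,1)] by (simp add: o_def)
  have "(\<lambda>z. f (weight_line d (z, b, c))) field_differentiable at a" "(\<lambda>z. f (weight_line d (a, z, c))) field_differentiable at b"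
    "(\<lambda>z. f (weight_line d (a, b, z))) field_differentiable at c" if "(a,b,c) \<in> weight_line d -` U" for a b c
    using holo3_onD(3)[OF assms, of "a + b + c - d" 1 0] that
    by (auto simp: weight_line_def intro!: *[where h = "\<lambda>z. f (z, 1, 0)"] derivative_intros)
  ultimately show ?thesis by (intro holo3_onI) auto
qed

lemma mero_cont_weight_line:
  assumes "mero_cont X C P F"
  shows "mero_cont (weight_line d -` X) (weight_line d -` C) (weight_line d -` P) (\<lambda>q. F (weight_line d q))"
proof -
  from assms obtain r f where 1: "holo3_on UNIV r" "\<And>q. q \<in> P \<Longrightarrow> r q \<noteq> 0" "holo3_on X f" "\<And>q. q \<in> C \<Longrightarrow> f q = r q * F q" by (rule mero_contE) blast
  show ?thesis
    by (rule mero_contI[of "\<lambda>q. r (weight_line d q)" _ _ "\<lambda>q. f (weight_line d q)"])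
       (use 1 holo3_on_weight_line[OF 1(1)] holo3_on_weight_line[OF 1(3)] in auto)
qed

text \<open>The poles lie on hyperplanes where u or w is a real constant, so positive imaginary
  parts keep clear of all of them at once, whatever the half-space.\<close>

definition upper_uw :: "(complex \<times> complex \<times> complex) set" where
  "upper_uw = {(a,b,c). Im (a + c) > 0 \<and> Im (a + b + c) > 0}"

text \<open>With n = 1 and c = 0 the kernel at m is m^(-a), so the lattice sum becomes the Riemann
  zeta series; zeta is thereby a special case of the cone argument.\<close>

definition axis_points :: "(nat \<times> nat) set" where
  "axis_points = {(m,n). 1 \<le> m \<and> n = 1}"

lemma axis_points_subset_cone: "axis_points \<subseteq> cone" by (auto simp: axis_points_def cone_def)

section \<open>Continuation of the incomplete beta function\<close>

lemma norm_pochhammer_le: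
  fixes a :: complex assumes "norm a \<le> R" shows "norm (pochhammer a j) \<le> pochhammer R j"
proof -
  have "norm (pochhammer a j) = (\<Prod>i = 0..<j. norm (a + of_nat i))" by (simp add: pochhammer_prod prod_norm)
  also have "\<dots> \<le> (\<Prod>i = 0..<j. R + real i)"
    using assms norm_triangle_ineq[of a "of_nat _"] by (intro prod_mono) (auto intro: order_trans[OF norm_triangle_ineq])
  finally show ?thesis by (simp add: pochhammer_prod)
qed

text \<open>A term with j < k has only the pole u = 1 - j, cleared by the factor u - 1 + j. For j >=
  k the denominators do not vanish on \<open>halfspace_uw k\<close>, and the rest of the series is
  dominated by a binomial series at 1/2.\<close>

lemma mero_cont_beta_series: "mero_cont (halfspace_uw k) (halfspace_uw 0) upper_uw (\<lambda>q. beta_series (fst q) (fst q + snd (snd q)))"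
proof -
  define t where "t = (\<lambda>j (q::complex\<times>complex\<times>complex). beta_coeff (fst q) (fst q + snd (snd q)) j * (1/2) ^ j :: complex)"
  have poch: "holo3_on U (\<lambda>q. pochhammer (fst q) j)" if "open U" for j U
    unfolding pochhammer_prod using that by (intro holo3_on_prod holo3_on_add holo3_on_coord holo3_on_const)
  have mj: "mero_cont (halfspace_uw k) (halfspace_uw 0) upper_uw (t j)" for j
  proof (rule mero_contI[of "\<lambda>q. fst q + snd (snd q) - 1 + of_nat j" _ _ "\<lambda>q. pochhammer (fst q) j / fact j * (1/2) ^ j"])
    show "holo3_on UNIV (\<lambda>q. fst q + snd (snd q) - 1 + of_nat j)"
      by (intro holo3_on_add holo3_on_diff holo3_on_coord holo3_on_const) auto
    show "holo3_on (halfspace_uw k) (\<lambda>q. pochhammer (fst q) j / fact j * (1/2) ^ j)"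
      by (intro holo3_on_mult holo3_on_divide poch holo3_on_const open_halfspace_uw) auto
    fix q assume "q \<in> upper_uw" then show "fst q + snd (snd q) - 1 + of_nat j \<noteq> 0"
      by (auto simp: upper_uw_def complex_eq_iff)
  next
    fix q assume "q \<in> halfspace_uw 0"
    then have "fst q + snd (snd q) - 1 + of_nat j \<noteq> 0" by (auto simp: halfspace_uw_def complex_eq_iff)
    then show "pochhammer (fst q) j / fact j * (1 / 2) ^ j = (fst q + snd (snd q) - 1 + of_nat j) * t j q"
      by (simp add: t_def beta_coeff_def)
  qed
  have tail: "holo3_on (halfspace_uw k) (\<lambda>q. \<Sum>\<^sub>\<infinity>j\<in>{k..}. t j q)"
  proof (rule holo3_on_infsum[OF open_halfspace_uw])
    fix j assume j: "j \<in> {k..}"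
    show "holo3_on (halfspace_uw k) (t j)"
      unfolding t_def beta_coeff_def
      by (intro holo3_on_mult holo3_on_divide holo3_on_add holo3_on_diff poch holo3_on_const holo3_on_coord open_halfspace_uw)
         (use j in \<open>auto simp: halfspace_uw_def complex_eq_iff\<close>)
  next
    fix q0 assume q0: "q0 \<in> halfspace_uw k"
    obtain a0 b0 c0 where q3: "q0 = (a0,b0,c0)" by (cases q0)
    \<comment> \<open>A third of the distance to the nearest pole: a and c may each move by d, and d
      is left over.\<close>
    define d where "d = (Re (a0 + c0) - 1 + real k) / 3"
    have d: "d > 0" using q0 by (auto simp: q3 halfspace_uw_def d_def)
    define R where "R = norm a0 + d"
    define B where "B = (\<lambda>j. pochhammer R j / fact j * (1/2) ^ j / d)"
    have R0: "R \<ge> 0" using d by (simp add: R_def)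
    have "summable (\<lambda>j. norm (complex_of_real (pochhammer R j / fact j * (1/2) ^ j)))"
      using pochhammer_summable_norm[of "1/2" "of_real R"] by (simp add: pochhammer_of_real norm_mult norm_divide)
    then have "summable (\<lambda>j. norm (pochhammer R j / fact j * (1/2) ^ j))" unfolding norm_of_real real_norm_def .
    from summable_divide[OF this, of d] have "summable (\<lambda>j. norm (B j))" using d by (simp add: B_def abs_mult)
    then have "B summable_on UNIV" by (rule norm_summable_imp_summable_on)
    then have Bs: "B summable_on {k..}" by (rule summable_on_subset) auto
    show "\<exists>e>0. \<exists>B. B summable_on {k..} \<and> (\<forall>j\<in>{k..}. \<forall>p\<in>ball q0 e \<inter> halfspace_uw k. norm (t j p) \<le> B j)"
    proof (intro exI[of _ d] conjI exI[of _ B] ballI Bs d)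
      fix j p assume j: "j \<in> {k..}" and p: "p \<in> ball q0 d \<inter> halfspace_uw k"
      obtain a b c where p3: "p = (a,b,c)" by (cases p)
      have D: "dist p q0 < d" using p by (simp add: dist_commute)
      have "dist a a0 \<le> dist p q0" "dist (b,c) (b0,c0) \<le> dist p q0" "dist c c0 \<le> dist (b,c) (b0,c0)"
        using dist_fst_le[of p q0] dist_snd_le[of p q0] dist_snd_le[of "(b,c)" "(b0,c0)"]
        by (simp_all add: p3 q3)
      with D have ds: "norm (a - a0) < d" "norm (c - c0) < d"
        unfolding dist_norm[symmetric] by linarith+
      have "norm a \<le> norm (a - a0) + norm a0" using norm_triangle_ineq[of "a - a0" a0] by simp
      with ds have aR: "norm a \<le> R" by (simp add: R_def)
      have "Re (a + c) - 1 + real j \<ge> d"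
        using ds abs_Re_le_cmod[of "a - a0"] abs_Re_le_cmod[of "c - c0"] j by (auto simp: d_def field_simps)
      then have den: "norm (a + c - 1 + of_nat j) \<ge> d" using complex_Re_le_cmod[of "a + c - 1 + of_nat j"] by simp
      have "norm (t j p) = norm (pochhammer a j) / fact j * (1/2) ^ j / norm (a + c - 1 + of_nat j)"
        by (simp add: t_def beta_coeff_def p3 norm_mult norm_divide norm_power)
      also have "\<dots> \<le> pochhammer R j / fact j * (1/2) ^ j / d"
        using den d norm_pochhammer_le[OF aR, of j] by (intro frac_le mult_right_mono divide_right_mono mult_nonneg_nonneg divide_nonneg_nonneg) (auto intro: order_trans[OF norm_ge_zero])
      finally show "norm (t j p) \<le> B j" by (simp add: B_def)
    qed
  qed
  have "mero_cont (halfspace_uw k) (halfspace_uw 0) upper_uw (\<lambda>q. 2 powr (1 - (fst q + snd (snd q))) * ((\<Sum>j<k. t j q) + (\<Sum>\<^sub>\<infinity>j\<in>{k..}. t j q)))"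
    by (intro mero_cont_mult mero_cont_add mero_cont_sum mj open_halfspace_uw mero_cont_holo tail holo3_on_powr holo3_on_diff holo3_on_add holo3_on_const holo3_on_coord) auto
  then show ?thesis
  proof (rule mero_cont_cong)
    fix q assume q: "q \<in> halfspace_uw 0"
    have sn: "summable (\<lambda>j. norm (t j q))"
    proof -
      \<comment> \<open>Convergence at the larger radius 3/4 yields absolute convergence at
        1/2.\<close>
      have "summable (\<lambda>j. beta_coeff (fst q) (fst q + snd (snd q)) j * (3/4) ^ j)"
        by (rule psi_summable) (use q in \<open>auto simp: halfspace_uw_def\<close>)
      from powser_insidea[OF this, of "1/2"] show ?thesis unfolding t_def by simp
    qed
    have hs: "((\<lambda>j. t j q) has_sum (\<Sum>j. t j q)) UNIV"
      using norm_summable_imp_has_sum[OF sn summable_sums[OF summable_norm_cancel[OF sn]]] by simp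
    then have sm: "(\<lambda>j. t j q) summable_on UNIV" by (auto simp: summable_on_def)
    have "(\<Sum>j. t j q) = (\<Sum>\<^sub>\<infinity>j\<in>{..<k} \<union> {k..}. t j q)"
    proof -
      have "{..<k} \<union> {k..} = UNIV" by auto
      then show ?thesis using infsumI[OF hs] by simp
    qed
    also have "\<dots> = (\<Sum>j<k. t j q) + (\<Sum>\<^sub>\<infinity>j\<in>{k..}. t j q)"
      by (subst infsum_Un_disjoint) (auto intro: summable_on_subset[OF sm])
    finally show "2 powr (1 - (fst q + snd (snd q))) * ((\<Sum>j<k. t j q) + (\<Sum>\<^sub>\<infinity>j\<in>{k..}. t j q)) = beta_series (fst q) (fst q + snd (snd q))"
      by (simp add: beta_series_def t_def)
  qed
qed

section \<open>Continuation of lattice sums by induction on the half-space\<close>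

lemma mero_cont_lattice_sum_Suc:
  assumes A: "A \<subseteq> cone" and m: "mero_cont (halfspace_uw k) (halfspace_uw 0) upper_uw (lattice_sum A r)"
  shows "mero_cont (halfspace_uw (Suc k)) (halfspace_uw 0) upper_uw (lattice_sum A (Suc r))"
proof -
  have s1: "mero_cont (halfspace_uw (Suc k)) (halfspace_uw 0) upper_uw (\<lambda>q. lattice_sum A r (q + (1,0,0)))"
    by (rule mero_cont_subset[OF mero_cont_shift[OF m, of "(1,0,0)"]]) (rule open_halfspace_uw, auto simp: halfspace_uw_def upper_uw_def)
  have s2: "mero_cont (halfspace_uw (Suc k)) (halfspace_uw 0) upper_uw (\<lambda>q. lattice_sum A r (q + (0,0,1)))"
    by (rule mero_cont_subset[OF mero_cont_shift[OF m, of "(0,0,1)"]]) (rule open_halfspace_uw, auto simp: halfspace_uw_def upper_uw_def)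
  have "mero_cont (halfspace_uw (Suc k)) (halfspace_uw 0) upper_uw (\<lambda>q. - fst q * lattice_sum A r (q + (1,0,0)) - snd (snd q) * lattice_sum A r (q + (0,0,1)))"
    by (intro mero_cont_diff mero_cont_mult s1 s2 mero_cont_holo holo3_on_minus holo3_on_coord open_halfspace_uw)
  then show ?thesis by (rule mero_cont_cong) (simp add: lattice_sum_Suc[OF A])
qed

text \<open>The Taylor expansion is solved for its term of order 0. The integral side is continued
  by hypothesis, the remainder of order k + 1 converges on the next half-space, and the sums of
  order at least 1 get there from the half-space already reached, by the shift recursion.\<close>

lemma mero_cont_lattice_sum:
  assumes A: "A \<subseteq> cone" and L: "\<And>k. mero_cont (halfspace_uw k) (halfspace_uw 0) upper_uw (lattice_int A)"
  shows "mero_cont (halfspace_uw k) (halfspace_uw 0) upper_uw (lattice_sum A 0)"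
proof (induction k)
  case 0
  show ?case by (rule mero_cont_holo[OF lattice_sum_props(1)[OF A]])
next
  case (Suc k)
  have r: "mero_cont (halfspace_uw (k + r)) (halfspace_uw 0) upper_uw (lattice_sum A r)" for r
    by (induction r) (use Suc.IH mero_cont_lattice_sum_Suc[OF A] in auto)
  have r': "mero_cont (halfspace_uw (Suc k)) (halfspace_uw 0) upper_uw (lattice_sum A (Suc i))" for i
    by (rule mero_cont_subset[OF r[of "Suc i"]]) (use halfspace_uw_mono[of "Suc k" "k + Suc i"] open_halfspace_uw in auto)
  have "mero_cont (halfspace_uw (Suc k)) (halfspace_uw 0) upper_uw (\<lambda>q. lattice_int A q - (\<Sum>i<k. lattice_sum A (Suc i) q * (1 / fact (Suc (Suc i)))) - lattice_rem A (Suc k) q)"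
    by (intro mero_cont_diff mero_cont_sum mero_cont_mult L r' mero_cont_holo[OF holo3_on_const] open_halfspace_uw mero_cont_holo[OF lattice_rem_props(1)[OF A]]) auto
  then show ?case
  proof (rule mero_cont_cong)
    fix q assume q: "q \<in> halfspace_uw 0"
    show "lattice_int A q - (\<Sum>i<k. lattice_sum A (Suc i) q * (1 / fact (Suc (Suc i)))) - lattice_rem A (Suc k) q = lattice_sum A 0 q"
      using lattice_int_expand[OF A _ q, of "Suc k"] by (simp add: sum.lessThan_Suc_shift del: sum.lessThan_Suc)
  qed
qed

lemma lattice_int_axis:
  assumes q: "q \<in> halfspace_uw 0"
  shows "lattice_int axis_points q = beta_series (fst q) (fst q + snd (snd q))"
proof -
  obtain a b c where q3: "q = (a,b,c)" by (cases q)
  have "(\<lambda>(m,n). of_nat n powr (-b) * ker_int m n a c) summable_on axis_points"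
    using abs_summable_summable[OF ker_int_summable[OF axis_points_subset_cone q[unfolded q3]]] .
  also have "?this \<longleftrightarrow> (\<lambda>m. ker_int m 1 a c) summable_on {1..}"
    by (rule summable_on_reindex_bij_witness[of _ "\<lambda>m. (m,1)" fst]) (auto simp: axis_points_def)
  finally have s: "(\<lambda>m. ker_int m 1 a c) summable_on {1..}" .
  have "lattice_int axis_points q = (\<Sum>\<^sub>\<infinity>m\<in>{1..}. ker_int m 1 a c)"
    unfolding lattice_int_def q3 prod.case
    by (rule infsum_reindex_bij_witness[of _ "\<lambda>m. (m,1)" fst]) (auto simp: axis_points_def)
  also have "\<dots> = beta_series a (a + c)"
    using infsumI[OF ker_int_has_sum[OF _ _ s]] q by (simp add: q3 halfspace_uw_def)
  finally show ?thesis by (simp add: q3)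
qed

lemma lattice_sum_axis:
  "lattice_sum axis_points 0 (s, b, 0) = (\<Sum>\<^sub>\<infinity>m\<in>{1..}. of_nat m powr (- s))"
  unfolding lattice_sum_def prod.case
  by (rule infsum_reindex_bij_witness[of _ "\<lambda>m. (m,1)" fst]) (auto simp: axis_points_def complex_eq_iff)

text \<open>The integral of the kernel over [n, oo) is homogeneous in n of degree 1 - u, so it is
  n^(1-u) times a factor free of n, and the outer sum becomes zeta at b + u - 1 = w - 1.\<close>

lemma lattice_int_cone:
  assumes q: "q \<in> halfspace_uw 0"
  shows "lattice_int cone q = beta_series (fst q) (fst q + snd (snd q)) * lattice_sum axis_points 0 (weight_line 1 q)"
proof -
  obtain a b c where q3: "q = (a,b,c)" by (cases q)
  have u: "Re (a + c) > 1" using q by (simp add: q3 halfspace_uw_def)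
  have "(\<lambda>(m,n). of_nat n powr (-b) * ker_int m n a c) summable_on cone"
    using abs_summable_summable[OF ker_int_summable[OF subset_refl q[unfolded q3]]] .
  also have "?this \<longleftrightarrow> (\<lambda>(n,m). of_nat n powr (-b) * ker_int m n a c) summable_on (Sigma {1..} (\<lambda>n. {n..}))"
    by (rule summable_on_reindex_bij_witness[of _ prod.swap prod.swap]) (auto simp: cone_def)
  finally have s: "(\<lambda>(n,m). of_nat n powr (-b) * ker_int m n a c) summable_on (Sigma {1..} (\<lambda>n. {n..}))" .
  have "lattice_int cone q = (\<Sum>\<^sub>\<infinity>(n,m)\<in>Sigma {1..} (\<lambda>n. {n..}). of_nat n powr (-b) * ker_int m n a c)"
    unfolding lattice_int_def q3 prod.case
    by (rule infsum_reindex_bij_witness[of _ prod.swap prod.swap]) (auto simp: cone_def)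
  also have "\<dots> = (\<Sum>\<^sub>\<infinity>n\<in>{1..}. \<Sum>\<^sub>\<infinity>m\<in>{n..}. of_nat n powr (-b) * ker_int m n a c)"
    by (rule infsum_Sigma'_banach[OF s, symmetric])
  also have "\<dots> = (\<Sum>\<^sub>\<infinity>n\<in>{1..}. beta_series a (a + c) * of_nat n powr (- (a + b + c - 1)))"
  proof (rule infsum_cong)
    fix n :: nat assume n: "n \<in> {1..}"
    have nz: "(of_nat n powr (- b) :: complex) \<noteq> 0" using n by auto
    have "(\<lambda>m. of_nat n powr (-b) * ker_int m n a c) summable_on {n..}"
      using summable_on_SigmaD1[OF s n] .
    from summable_on_cmult_right[OF this, of "inverse (of_nat n powr (-b))"] nz
    have "(\<lambda>m. ker_int m n a c) summable_on {n..}" by (simp add: mult.assoc[symmetric])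
    from has_sum_cmult_right[OF ker_int_has_sum[OF _ u this], of "of_nat n powr (-b)"] n
    have "(\<Sum>\<^sub>\<infinity>m\<in>{n..}. of_nat n powr (-b) * ker_int m n a c) = of_nat n powr (-b) * (of_nat n powr (1 - (a + c)) * beta_series a (a + c))"
      by (auto intro: infsumI)
    also have "\<dots> = beta_series a (a + c) * (of_nat n powr (-b) * of_nat n powr (1 - (a + c)))" by (simp add: mult_ac)
    also have "of_nat n powr (-b) * of_nat n powr (1 - (a + c)) = (of_nat n powr (- (a + b + c - 1)) :: complex)"
      by (subst powr_add[symmetric]) (rule arg_cong[of _ _ "\<lambda>t. of_nat n powr t"], simp)
    finally show "(\<Sum>\<^sub>\<infinity>m\<in>{n..}. of_nat n powr (-b) * ker_int m n a c) = beta_series a (a + c) * of_nat n powr (- (a + b + c - 1))" .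
  qed
  also have "\<dots> = beta_series a (a + c) * lattice_sum axis_points 0 (weight_line 1 q)"
    by (simp add: infsum_cmult_right' weight_line_def lattice_sum_axis q3)
  finally show ?thesis by (simp add: q3)
qed

lemma mero_cont_axis_sum: "mero_cont (halfspace_uw k) (halfspace_uw 0) upper_uw (lattice_sum axis_points 0)"
  by (rule mero_cont_lattice_sum[OF axis_points_subset_cone]) (rule mero_cont_cong[OF mero_cont_beta_series], simp add: lattice_int_axis)

text \<open>d = 1 is the zeta factor of the integrated cone sum, d = 0 the diagonal.\<close>

lemma mero_cont_zeta_weight_line:
  assumes "d \<in> {0,1}"
  shows "mero_cont (halfspace_uw k) (halfspace_uw 0) upper_uw (\<lambda>q. lattice_sum axis_points 0 (weight_line d q))"
  by (rule mero_cont_subset[OF mero_cont_weight_line[OF mero_cont_axis_sum[of k]]])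
     (rule open_halfspace_uw, use assms in \<open>auto simp: halfspace_uw_def upper_uw_def weight_line_def\<close>)

lemma mero_cont_cone_sum: "mero_cont (halfspace_uw k) (halfspace_uw 0) upper_uw (lattice_sum cone 0)"
  by (rule mero_cont_lattice_sum[OF subset_refl])
     (rule mero_cont_cong[OF mero_cont_mult[OF mero_cont_beta_series mero_cont_zeta_weight_line[of 1]]], auto simp: lattice_int_cone)

section \<open>Assembling the double series from cones and diagonal\<close>

definition MT_series :: "complex \<times> complex \<times> complex \<Rightarrow> complex" where
  "MT_series q = zeta_MT2_series (fst q) (fst (snd q)) (snd (snd q))"

lemma MT_series_has_sum:
  assumes q: "(a,b,c) \<in> MT2_conv_region"
  shows "((\<lambda>(m,n). 1 / (of_nat m powr a * of_nat n powr b * of_nat (m + n) powr c)) has_sum MT_series (a,b,c)) {(m,n). m \<ge> 1 \<and> n \<ge> 1}"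
    and "MT_series (a,b,c) = lattice_sum cone 0 (a,b,c) + lattice_sum cone 0 (b,a,c) - 2 powr (- c) * lattice_sum axis_points 0 (weight_line 0 (a,b,c))"
proof -
  define f where "f = (\<lambda>(m::nat,n::nat). 1 / (of_nat m powr a * of_nat n powr b * of_nat (m + n) powr c :: complex))"
  define D where "D = {(m::nat,n). 1 \<le> m \<and> m = n}"
  have H: "(a,b,c) \<in> halfspace_uw 0" "(b,a,c) \<in> halfspace_uw 0" using q by (auto simp: MT2_conv_region_def halfspace_uw_def)
  have S1: "(f has_sum lattice_sum cone 0 (a,b,c)) cone"
  proof -
    have "((\<lambda>(m,n). of_nat n powr (-b) * ker_deriv 0 (real n) a c (of_nat m)) has_sum lattice_sum cone 0 (a,b,c)) cone"
      unfolding lattice_sum_def prod.case by (rule has_sum_infsum[OF abs_summable_summable[OF lattice_sum_props(2)[OF subset_refl H(1)]]])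
    also have "?this \<longleftrightarrow> (f has_sum lattice_sum cone 0 (a,b,c)) cone"
      by (rule has_sum_cong) (auto simp: f_def powr_minus divide_simps)
    finally show ?thesis .
  qed
  have S2: "(f has_sum lattice_sum cone 0 (b,a,c)) (prod.swap ` cone)"
  proof -
    have "((\<lambda>(m,n). of_nat n powr (-a) * ker_deriv 0 (real n) b c (of_nat m)) has_sum lattice_sum cone 0 (b,a,c)) cone"
      unfolding lattice_sum_def prod.case by (rule has_sum_infsum[OF abs_summable_summable[OF lattice_sum_props(2)[OF subset_refl H(2)]]])
    also have "?this \<longleftrightarrow> (f \<circ> prod.swap has_sum lattice_sum cone 0 (b,a,c)) cone"
      by (rule has_sum_cong) (auto simp: f_def powr_minus divide_simps add.commute)
    also have "\<dots> \<longleftrightarrow> (f has_sum lattice_sum cone 0 (b,a,c)) (prod.swap ` cone)"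
      by (rule has_sum_reindex[symmetric]) (auto simp: inj_on_def)
    finally show ?thesis .
  qed
  have Dsub: "D \<subseteq> cone" "D \<subseteq> prod.swap ` cone" by (auto simp: D_def cone_def image_iff)
  have S3: "(f has_sum (2 powr (- c) * lattice_sum axis_points 0 (weight_line 0 (a,b,c)))) D"
  proof -
    have s: "f summable_on D" using summable_on_subset[OF has_sum_imp_summable[OF S1] Dsub(1)] .
    have "infsum f D = (\<Sum>\<^sub>\<infinity>m\<in>{1..}. 2 powr (- c) * of_nat m powr (- (a + b + c)))"
    proof (rule infsum_reindex_bij_witness[of _ "\<lambda>m. (m,m)" fst])
      fix p assume "p \<in> D"
      then obtain m where p: "p = (m,m)" "m \<ge> 1" by (auto simp: D_def)
      \<comment> \<open>On the diagonal (2m)^c = 2^c m^c, which is the source of the factor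
        2^(-c).\<close>
      have e: "of_nat (m + m) = of_real (real m) * (of_real 2 :: complex)" by simp
      have "(of_nat (m + m) :: complex) powr c = of_nat m powr c * 2 powr c"
        unfolding e by (subst powr_times_real) auto
      then show "2 powr (- c) * of_nat (fst p) powr (- (a + b + c)) = f p"
        using p by (simp add: f_def powr_minus powr_add powr_diff divide_simps del: of_nat_add)
    qed (auto simp: D_def)
    also have "\<dots> = 2 powr (- c) * lattice_sum axis_points 0 (weight_line 0 (a,b,c))"
      by (simp add: infsum_cmult_right' weight_line_def lattice_sum_axis)
    finally show ?thesis using s by (metis has_sum_infsum)
  qed
  have "(f has_sum (lattice_sum cone 0 (b,a,c) - 2 powr (- c) * lattice_sum axis_points 0 (weight_line 0 (a,b,c)))) (prod.swap ` cone - D)"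
    by (rule has_sum_Diff[OF S2 S3 Dsub(2)])
  moreover have "cone \<inter> (prod.swap ` cone - D) = {}" by (auto simp: cone_def D_def)
  ultimately have "(f has_sum (lattice_sum cone 0 (a,b,c) + (lattice_sum cone 0 (b,a,c) - 2 powr (- c) * lattice_sum axis_points 0 (weight_line 0 (a,b,c))))) (cone \<union> (prod.swap ` cone - D))"
    by (rule has_sum_Un_disjoint[OF S1])
  also have "cone \<union> (prod.swap ` cone - D) = {(m,n). m \<ge> 1 \<and> n \<ge> 1}"
    by (auto simp: cone_def D_def image_iff)
  finally have S: "(f has_sum (lattice_sum cone 0 (a,b,c) + (lattice_sum cone 0 (b,a,c) - 2 powr (- c) * lattice_sum axis_points 0 (weight_line 0 (a,b,c))))) {(m,n). m \<ge> 1 \<and> n \<ge> 1}" .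
  then have I: "MT_series (a,b,c) = lattice_sum cone 0 (a,b,c) + (lattice_sum cone 0 (b,a,c) - 2 powr (- c) * lattice_sum axis_points 0 (weight_line 0 (a,b,c)))"
    by (simp add: MT_series_def zeta_MT2_series_def f_def infsumI)
  then show "MT_series (a,b,c) = lattice_sum cone 0 (a,b,c) + lattice_sum cone 0 (b,a,c) - 2 powr (- c) * lattice_sum axis_points 0 (weight_line 0 (a,b,c))" by simp
  show "((\<lambda>(m,n). 1 / (of_nat m powr a * of_nat n powr b * of_nat (m + n) powr c)) has_sum MT_series (a,b,c)) {(m,n). m \<ge> 1 \<and> n \<ge> 1}"
    using S unfolding I f_def .
qed

definition halfspace_uvw :: "nat \<Rightarrow> (complex \<times> complex \<times> complex) set" where
  "halfspace_uvw k = halfspace_uw k \<inter> swap12 -` halfspace_uw k"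

definition upper_uvw :: "(complex \<times> complex \<times> complex) set" where
  "upper_uvw = {(a,b,c). Im (a + c) > 0 \<and> Im (b + c) > 0 \<and> Im (a + b + c) > 0}"

lemma halfspace_uvw_alt: "halfspace_uvw k = {(a,b,c). Re (a + c) > 1 - real k \<and> Re (b + c) > 1 - real k \<and> Re (a + b + c) > 2 - real k}"
  by (auto simp: halfspace_uvw_def halfspace_uw_def swap12_def)

lemma halfspace_uvw_0: "halfspace_uvw 0 = MT2_conv_region"
  by (auto simp: halfspace_uvw_alt MT2_conv_region_def)

lemma open_halfspace_uvw: "open (halfspace_uvw k)"
  unfolding halfspace_uvw_def
  by (intro open_Int open_halfspace_uw open_vimage) (auto simp: swap12_def[abs_def] intro!: continuous_intros)

lemma mero_cont_MT_series: "mero_cont (halfspace_uvw k) MT2_conv_region upper_uvw MT_series"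
proof -
  have 1: "mero_cont (halfspace_uvw k) MT2_conv_region upper_uvw (lattice_sum cone 0)"
    by (rule mero_cont_subset[OF mero_cont_cone_sum open_halfspace_uvw]) (auto simp: halfspace_uvw_alt halfspace_uw_def MT2_conv_region_def upper_uvw_def upper_uw_def)
  have 2: "mero_cont (halfspace_uvw k) MT2_conv_region upper_uvw (\<lambda>q. lattice_sum cone 0 (swap12 q))"
    by (rule mero_cont_subset[OF mero_cont_swap[OF mero_cont_cone_sum] open_halfspace_uvw]) (auto simp: halfspace_uvw_alt halfspace_uw_def MT2_conv_region_def upper_uvw_def upper_uw_def swap12_def add_ac)
  have 3: "mero_cont (halfspace_uvw k) MT2_conv_region upper_uvw (\<lambda>q. lattice_sum axis_points 0 (weight_line 0 q))"
    by (rule mero_cont_subset[OF mero_cont_zeta_weight_line[of 0] open_halfspace_uvw]) (auto simp: halfspace_uvw_alt halfspace_uw_def MT2_conv_region_def upper_uvw_def upper_uw_def)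
  have "mero_cont (halfspace_uvw k) MT2_conv_region upper_uvw (\<lambda>q. lattice_sum cone 0 q + lattice_sum cone 0 (swap12 q) - 2 powr (- snd (snd q)) * lattice_sum axis_points 0 (weight_line 0 q))"
    by (intro mero_cont_diff mero_cont_add mero_cont_mult 1 2 3 mero_cont_holo holo3_on_powr holo3_on_minus holo3_on_coord open_halfspace_uvw) auto
  then show ?thesis
    by (rule mero_cont_cong) (auto simp: MT_series_has_sum(2) swap12_def)
qed

section \<open>Uniqueness of the continuation\<close>

lemma linear_triple_functional:
  "linear (\<lambda>q::complex \<times> complex \<times> complex. Im (fst q + snd (snd q)))"
  "linear (\<lambda>q::complex \<times> complex \<times> complex. Im (fst (snd q) + snd (snd q)))"
  "linear (\<lambda>q::complex \<times> complex \<times> complex. Im (fst q + fst (snd q) + snd (snd q)))"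
  "linear (\<lambda>q::complex \<times> complex \<times> complex. Re (fst q + snd (snd q)))"
  "linear (\<lambda>q::complex \<times> complex \<times> complex. Re (fst (snd q) + snd (snd q)))"
  "linear (\<lambda>q::complex \<times> complex \<times> complex. Re (fst q + fst (snd q) + snd (snd q)))"
  by (rule linearI; simp add: algebra_simps)+

text \<open>The index 1 is large enough for every (s1, s2, z) with Re s1, Re s2 > 1/2, Im s1, Im s2
  >= 0 and z in the open first quadrant. Convexity makes it one connected neighbourhood of all these
  points.\<close>

definition base_domain :: "(complex \<times> complex \<times> complex) set" where
  "base_domain = upper_uvw \<inter> halfspace_uvw 1"

lemma base_domain_alt:
  "base_domain = ((\<lambda>q. Im (fst q + snd (snd q))) -` {0<..} \<inter> (\<lambda>q. Im (fst (snd q) + snd (snd q))) -` {0<..} \<inter>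
         (\<lambda>q. Im (fst q + fst (snd q) + snd (snd q))) -` {0<..}) \<inter>
        ((\<lambda>q. Re (fst q + snd (snd q))) -` {0<..} \<inter> (\<lambda>q. Re (fst (snd q) + snd (snd q))) -` {0<..} \<inter>
         (\<lambda>q. Re (fst q + fst (snd q) + snd (snd q))) -` {1<..})"
  by (auto simp: base_domain_def upper_uvw_def halfspace_uvw_alt)

lemma convex_base_domain: "convex base_domain"
  unfolding base_domain_alt
  by (intro convex_Int convex_linear_vimage linear_triple_functional convex_real_interval)

lemma open_base_domain: "open base_domain"
  unfolding base_domain_alt by (intro open_Int open_vimage) (auto intro!: continuous_intros)

definition MT_germ :: "complex \<times> complex \<times> complex \<Rightarrow> (complex \<times> complex \<times> complex) set \<Rightarrow>
    (complex \<times> complex \<times> complex \<Rightarrow> complex) \<Rightarrow> bool" where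
  "MT_germ p U f \<longleftrightarrow> open U \<and> connected U \<and> p \<in> U \<and> U \<inter> MT2_conv_region \<noteq> {} \<and> holo3_on U f \<and>
     (\<forall>q \<in> U \<inter> MT2_conv_region. f q = MT_series q)"

text \<open>The threshold \<open>k0\<close> depends on the germ alone and not on \<rho> and \<Phi>.
  Two germs therefore admit a common k, and one pair \<rho>, \<Phi> for this k can be compared with
  both.\<close>

lemma MT_germ_value:
  assumes "MT_germ p U f"
  shows "\<exists>k0. \<forall>k\<ge>k0. \<forall>\<rho> \<Phi>. holo3_on UNIV \<rho> \<longrightarrow> holo3_on (halfspace_uvw k) \<Phi> \<longrightarrow>
    (\<forall>q\<in>MT2_conv_region. \<Phi> q = \<rho> q * MT_series q) \<longrightarrow> \<Phi> p = \<rho> p * f p"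
proof -
  have U: "open U" "connected U" "p \<in> U" "holo3_on U f" "\<And>q. q \<in> U \<Longrightarrow> q \<in> MT2_conv_region \<Longrightarrow> f q = MT_series q"
    using assms by (auto simp: MT_germ_def)
  obtain x where x: "x \<in> U" "x \<in> MT2_conv_region" using assms by (auto simp: MT_germ_def)
  have "path_connected U" using U by (simp add: connected_open_path_connected)
  then obtain g where g: "path g" "path_image g \<subseteq> U" "pathstart g = p" "pathfinish g = x"
    using U x unfolding path_connected_def by blast
  have comp: "compact (path_image g)" using g by (simp add: compact_path_image)
  have lower: "\<exists>k::nat. \<forall>q\<in>path_image g. h q > - real k" if "continuous_on UNIV h" for h :: "complex \<times> complex \<times> complex \<Rightarrow> real"
  proof -
    have "compact (h ` path_image g)"
      by (rule compact_continuous_image[OF continuous_on_subset[OF that] comp]) auto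
    then have "bounded (h ` path_image g)" by (rule compact_imp_bounded)
    then obtain B where B: "\<And>q. q \<in> path_image g \<Longrightarrow> \<bar>h q\<bar> \<le> B" unfolding bounded_iff by auto
    obtain k :: nat where "real k > B" using reals_Archimedean2 by blast
    with B show ?thesis by (intro exI[of _ k] ballI) (smt (verit))
  qed
  have "\<exists>k::nat. \<forall>q\<in>path_image g. Re (fst q + snd (snd q)) > - real k"
    by (rule lower) (intro continuous_intros)
  then obtain k1 :: nat where k1: "\<And>q. q \<in> path_image g \<Longrightarrow> Re (fst q + snd (snd q)) > - real k1" by blast
  have "\<exists>k::nat. \<forall>q\<in>path_image g. Re (fst (snd q) + snd (snd q)) > - real k"
    by (rule lower) (intro continuous_intros)
  then obtain k2 :: nat where k2: "\<And>q. q \<in> path_image g \<Longrightarrow> Re (fst (snd q) + snd (snd q)) > - real k2" by blast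
  have "\<exists>k::nat. \<forall>q\<in>path_image g. Re (fst q + fst (snd q) + snd (snd q)) > - real k"
    by (rule lower) (intro continuous_intros)
  then obtain k3 :: nat where k3: "\<And>q. q \<in> path_image g \<Longrightarrow> Re (fst q + fst (snd q) + snd (snd q)) > - real k3" by blast
  note k = k1 k2 k3
  \<comment> \<open>The additional 2 absorbs the constants 1 and 2 in the definition of the
    half-spaces.\<close>
  define k0 where "k0 = k1 + k2 + k3 + 2"
  show ?thesis
  proof (intro exI[of _ k0] allI impI)
    fix k \<rho> \<Phi> assume kk: "k0 \<le> k" and rho: "holo3_on UNIV \<rho>" and Phi: "holo3_on (halfspace_uvw k) \<Phi>"
      and eq: "\<forall>q\<in>MT2_conv_region. \<Phi> q = \<rho> q * MT_series q"
    have sub: "path_image g \<subseteq> U \<inter> halfspace_uvw k"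
    proof
      fix q assume q: "q \<in> path_image g"
      then show "q \<in> U \<inter> halfspace_uvw k" using g k[OF q] kk by (cases q) (auto simp: halfspace_uvw_alt k0_def)
    qed
    \<comment> \<open>The intersection need not be connected, hence the component that contains the
      path.\<close>
    define V where "V = connected_component_set (U \<inter> halfspace_uvw k) p"
    have Vsub: "V \<subseteq> U \<inter> halfspace_uvw k" unfolding V_def by (rule connected_component_subset)
    have Vo: "open V" unfolding V_def by (intro open_connected_component open_Int U open_halfspace_uvw)
    have Vc: "connected V" unfolding V_def by (rule connected_connected_component)
    have "path_image g \<subseteq> V"
      unfolding V_def using sub g by (intro connected_component_maximal connected_path_image) (auto intro: pathstart_in_path_image)
    then have pV: "p \<in> V" "x \<in> V" using g pathstart_in_path_image[of g] pathfinish_in_path_image[of g] by auto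
    have "\<Phi> p = (\<lambda>q. \<rho> q * f q) p"
    proof (rule holo3_identity[OF _ _ Vc, where V = "V \<inter> halfspace_uvw 0"])
      show "holo3_on V \<Phi>" using Phi Vo Vsub by (auto intro: holo3_on_subset)
      show "holo3_on V (\<lambda>q. \<rho> q * f q)"
        by (intro holo3_on_mult) (use rho U(4) Vo Vsub in \<open>auto intro: holo3_on_subset\<close>)
      show "V \<inter> halfspace_uvw 0 \<noteq> {}" using x pV by (auto simp: halfspace_uvw_0)
      fix q assume "q \<in> V \<inter> halfspace_uvw 0"
      then have "q \<in> U" "q \<in> MT2_conv_region" using Vsub by (auto simp: halfspace_uvw_0)
      then show "\<Phi> q = \<rho> q * f q" using eq U(5) by simp
    qed (use Vo pV open_halfspace_uvw in auto)
    then show "\<Phi> p = \<rho> p * f p" by simp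
  qed
qed

lemma MT_germ_unique:
  assumes "MT_germ p U f" "MT_germ p V g" "p \<in> upper_uvw"
  shows "f p = g p"
proof -
  obtain k where k: "\<forall>\<rho> \<Phi>. holo3_on UNIV \<rho> \<longrightarrow> holo3_on (halfspace_uvw k) \<Phi> \<longrightarrow>
      (\<forall>q\<in>MT2_conv_region. \<Phi> q = \<rho> q * MT_series q) \<longrightarrow> \<Phi> p = \<rho> p * f p"
    "\<forall>\<rho> \<Phi>. holo3_on UNIV \<rho> \<longrightarrow> holo3_on (halfspace_uvw k) \<Phi> \<longrightarrow>
      (\<forall>q\<in>MT2_conv_region. \<Phi> q = \<rho> q * MT_series q) \<longrightarrow> \<Phi> p = \<rho> p * g p"
  proof -
    obtain k1 k2 where A: "\<forall>k\<ge>k1. \<forall>\<rho> \<Phi>. holo3_on UNIV \<rho> \<longrightarrow> holo3_on (halfspace_uvw k) \<Phi> \<longrightarrow>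
      (\<forall>q\<in>MT2_conv_region. \<Phi> q = \<rho> q * MT_series q) \<longrightarrow> \<Phi> p = \<rho> p * f p"
      and B: "\<forall>k\<ge>k2. \<forall>\<rho> \<Phi>. holo3_on UNIV \<rho> \<longrightarrow> holo3_on (halfspace_uvw k) \<Phi> \<longrightarrow>
      (\<forall>q\<in>MT2_conv_region. \<Phi> q = \<rho> q * MT_series q) \<longrightarrow> \<Phi> p = \<rho> p * g p"
      using MT_germ_value[OF assms(1)] MT_germ_value[OF assms(2)] by metis
    show ?thesis
      by (rule that[OF mp[OF spec[OF A] max.cobounded1] mp[OF spec[OF B] max.cobounded2]])
  qed
  obtain \<rho> \<Phi> where r: "holo3_on UNIV \<rho>" "\<And>q. q \<in> upper_uvw \<Longrightarrow> \<rho> q \<noteq> 0" "holo3_on (halfspace_uvw k) \<Phi>"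
    "\<And>q. q \<in> MT2_conv_region \<Longrightarrow> \<Phi> q = \<rho> q * MT_series q"
    using mero_cont_MT_series[of k] by (rule mero_contE) blast
  have "\<rho> p * f p = \<rho> p * g p" using k r by metis
  then show ?thesis using r(2)[OF assms(3)] by simp
qed

lemma zeta_MT2_alt: "zeta_MT2 a b c = (THE v. \<exists>U f. MT_germ (a,b,c) U f \<and> f (a,b,c) = v)"
proof -
  have "(case q of (a,b,c) \<Rightarrow> zeta_MT2_series a b c) = MT_series q" for q by (simp add: MT_series_def case_prod_unfold)
  then show ?thesis unfolding zeta_MT2_def MT_germ_def by (simp add: conj_assoc)
qed

text \<open>Existence only needs the continuation on the convex set \<open>base_domain\<close>, which avoids every singular
  hyperplane because there the imaginary parts are positive; the continuation to all half-spaces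
  is what excludes monodromy.\<close>
lemma zeta_MT2_continuation:
  obtains F where "holo3_on base_domain F" "\<And>q. q \<in> base_domain \<Longrightarrow> q \<in> MT2_conv_region \<Longrightarrow> F q = MT_series q"
    "\<And>a b c. (a,b,c) \<in> base_domain \<Longrightarrow> zeta_MT2 a b c = F (a,b,c)"
proof -
  obtain \<rho> \<Phi> where r: "holo3_on UNIV \<rho>" "\<And>q. q \<in> upper_uvw \<Longrightarrow> \<rho> q \<noteq> 0" "holo3_on (halfspace_uvw 1) \<Phi>"
    "\<And>q. q \<in> MT2_conv_region \<Longrightarrow> \<Phi> q = \<rho> q * MT_series q"
    using mero_cont_MT_series[of 1] by (rule mero_contE) blast
  define F where "F = (\<lambda>q. \<Phi> q / \<rho> q)"
  have nz: "\<rho> q \<noteq> 0" if "q \<in> base_domain" for q using r(2) that by (auto simp: base_domain_def)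
  have F: "holo3_on base_domain F" unfolding F_def
    by (intro holo3_on_divide nz) (use r open_base_domain in \<open>auto simp: base_domain_def intro: holo3_on_subset\<close>)
  have Fs: "F q = MT_series q" if "q \<in> base_domain" "q \<in> MT2_conv_region" for q
    using r(4)[OF that(2)] nz[OF that(1)] by (simp add: F_def)
  have ne: "base_domain \<inter> MT2_conv_region \<noteq> {}"
  proof -
    have "(Complex 3 1, Complex 3 1, Complex 3 1) \<in> base_domain \<inter> MT2_conv_region"
      by (auto simp: base_domain_def upper_uvw_def halfspace_uvw_alt MT2_conv_region_def)
    then show ?thesis by blast
  qed
  have germ: "MT_germ p base_domain F" if "p \<in> base_domain" for p
    using F Fs ne that open_base_domain convex_connected[OF convex_base_domain] by (auto simp: MT_germ_def)
  have "zeta_MT2 a b c = F (a,b,c)" if "(a,b,c) \<in> base_domain" for a b c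
    unfolding zeta_MT2_alt
  proof (rule the_equality)
    show "\<exists>U f. MT_germ (a,b,c) U f \<and> f (a,b,c) = F (a,b,c)" using germ[OF that] by blast
    fix v assume "\<exists>U f. MT_germ (a,b,c) U f \<and> f (a,b,c) = v"
    then obtain U f where "MT_germ (a,b,c) U f" "f (a,b,c) = v" by blast
    with MT_germ_unique[OF _ germ[OF that]] that show "v = F (a,b,c)" by (auto simp: base_domain_def)
  qed
  with F Fs that show ?thesis by blast
qed

section \<open>Tails of the Riemann zeta function\<close>

lemma powr_diff_ge:
  fixes k :: nat assumes "k \<ge> 1" "X > 1"
  shows "(X - 1) * real (Suc k) powr (- X) \<le> real k powr (1 - X) - real (Suc k) powr (1 - X)"
proof -
  have "\<exists>z. real k < z \<and> z < real (Suc k) \<and> real (Suc k) powr (1 - X) - real k powr (1 - X) = (real (Suc k) - real k) * ((1 - X) * z powr (1 - X - 1))"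
    by (rule MVT2) (use assms in \<open>auto intro!: derivative_eq_intros\<close>)
  then obtain z where z: "real k < z" "z < real (Suc k)" "real (Suc k) powr (1 - X) - real k powr (1 - X) = (1 - X) * z powr (- X)"
    by auto
  have "real (Suc k) powr (- X) \<le> z powr (- X)" using z assms by (intro powr_mono2') auto
  then have "(X - 1) * real (Suc k) powr (- X) \<le> (X - 1) * z powr (- X)" using assms by (intro mult_left_mono) auto
  with z(3) show ?thesis by (simp add: algebra_simps)
qed

text \<open>Comparison with the integral of x^(-X). The claim \<open>le\<close> for partial sums
  keeps the negative end term, through which the induction telescopes.\<close>

lemma powr_tail_bound:
  fixes q :: nat assumes "q \<ge> 1" "X > 1"
  shows "(\<Sum>\<^sub>\<infinity>k\<in>{q..}. real k powr (- X)) \<le> real q powr (- X) + real q powr (1 - X) / (X - 1)"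
proof (rule infsum_le_finite_sums)
  show "(\<lambda>k. real k powr (- X)) summable_on {q..}"
    using summable_on_powr_nat[OF assms(2)] by (rule summable_on_subset) auto
  fix F assume F: "finite F" "F \<subseteq> {q..}"
  obtain M where M: "F \<subseteq> {..M}"
    using F(1) finite_nat_iff_bounded_le by blast
  have le: "(\<Sum>k = q..q + M. real k powr (- X)) \<le> real q powr (- X) + (real q powr (1 - X) - real (q + M) powr (1 - X)) / (X - 1)" for M
  proof (induction M)
    case (Suc M)
    have "(X - 1) * real (Suc (q + M)) powr (- X) \<le> real (q + M) powr (1 - X) - real (Suc (q + M)) powr (1 - X)"
      by (rule powr_diff_ge) (use assms in auto)
    then have "real (Suc (q + M)) powr (- X) \<le> (real (q + M) powr (1 - X) - real (Suc (q + M)) powr (1 - X)) / (X - 1)"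
      using assms by (simp add: pos_le_divide_eq mult.commute)
    then have "(\<Sum>k = q..q + Suc M. real k powr (- X)) \<le> real q powr (- X) + (real q powr (1 - X) - real (q + M) powr (1 - X)) / (X - 1)
        + (real (q + M) powr (1 - X) - real (Suc (q + M)) powr (1 - X)) / (X - 1)"
      using Suc.IH by simp
    also have "\<dots> = real q powr (- X) + (real q powr (1 - X) - real (q + Suc M) powr (1 - X)) / (X - 1)"
      by (simp add: diff_divide_distrib)
    finally show ?case .
  qed simp
  have "(\<Sum>k\<in>F. real k powr (- X)) \<le> (\<Sum>k = q..q + M. real k powr (- X))"
    by (intro sum_mono2) (use F M in \<open>auto simp: subset_iff intro: trans_le_add2\<close>)
  also have "\<dots> \<le> real q powr (- X) + (real q powr (1 - X) - real (q + M) powr (1 - X)) / (X - 1)" by (rule le)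
  also have "\<dots> \<le> real q powr (- X) + real q powr (1 - X) / (X - 1)"
    using assms by (intro add_left_mono divide_right_mono) auto
  finally show "(\<Sum>k\<in>F. real k powr (- X)) \<le> real q powr (- X) + real q powr (1 - X) / (X - 1)" .
qed

lemma summable_on_prod_nonneg:
  fixes f g :: "nat \<Rightarrow> real"
  assumes "f summable_on UNIV" "g summable_on UNIV" "\<And>m. f m \<ge> 0" "\<And>n. g n \<ge> 0"
  shows "(\<lambda>(m,n). f m * g n) summable_on A"
proof -
  have "(\<lambda>p. case p of (m,n) \<Rightarrow> f m * g n) summable_on (UNIV \<times> UNIV)"
  proof (rule summable_on_SigmaI)
    fix m :: nat
    show "((\<lambda>n. case (m, n) of (m, n) \<Rightarrow> f m * g n) has_sum f m * (\<Sum>\<^sub>\<infinity>n\<in>UNIV. g n)) UNIV"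
      using assms(2) by (simp add: has_sum_cmult_right)
  qed (use assms in \<open>auto intro: summable_on_cmult_left\<close>)
  then show ?thesis by (rule summable_on_subset) auto
qed

definition zeta_tail :: "nat \<Rightarrow> complex \<Rightarrow> complex" where
  "zeta_tail q s = (\<Sum>\<^sub>\<infinity>k\<in>{q..}. of_nat k powr (- s))"

text \<open>From k^(1-s) - (k+1)^(1-s) = - sum over i >= 1 of binom(1-s, i) k^(1-s-i): this is the
  coefficient of k^(-s-r), and it equals s - 1 for r = 0.\<close>

definition shift_coeff :: "complex \<Rightarrow> nat \<Rightarrow> complex" where
  "shift_coeff s r = - ((1 - s) gchoose (Suc r))"

definition zeta_tail_double :: "nat \<Rightarrow> complex \<Rightarrow> complex" where
  "zeta_tail_double q s = (\<Sum>\<^sub>\<infinity>(r,k)\<in>{1..}\<times>{q..}. shift_coeff s r * of_nat k powr (- s - of_nat r))"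

text \<open>Write Z for the tail from q. Summed over k >= q, the expansion behind
  \<open>shift_coeff\<close> telescopes to q^(1-s) = (s-1) Z(s) + sum over r >= 1 of
  \<open>shift_coeff s r\<close> Z(s+r). Solved for Z(s), it uses only arguments s + r with real
  part above 1 once Re s > 0.\<close>

definition zeta_tail_cont :: "nat \<Rightarrow> complex \<Rightarrow> complex" where
  "zeta_tail_cont q s = (of_nat q powr (1 - s) - zeta_tail_double q s) / (s - 1)"

lemma norm_shift_coeff: "norm (shift_coeff s r) = norm (s - 1) * norm (pochhammer s r) / fact (Suc r)"
proof -
  have "norm (shift_coeff s r) = norm (pochhammer (s - 1) (Suc r)) / fact (Suc r)"
    by (simp add: shift_coeff_def gbinomial_pochhammer norm_mult norm_divide norm_power del: fact_Suc)
  also have "pochhammer (s - 1) (Suc r) = (s - 1) * pochhammer s r" by (simp add: pochhammer_rec)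
  finally show ?thesis by (simp add: norm_mult)
qed

text \<open>The coefficients grow no faster than (R')_r / r!, and k >= 2 supplies a factor of order
  2^(-r). The majorant is a product of a function of r and one of k, uniform for |s| <= R and Re s
  >= e.\<close>

lemma zeta_tail_double_bound:
  assumes "e > 0" "q \<ge> 2"
  obtains B where "B summable_on {1..}\<times>{q..}"
    "\<And>s (r::nat) (k::nat). norm s \<le> R \<Longrightarrow> Re s \<ge> e \<Longrightarrow> (r,k) \<in> {1..}\<times>{q..} \<Longrightarrow> norm (shift_coeff s r * of_nat k powr (- s - of_nat r)) \<le> B (r,k)"
proof -
  define R' where "R' = \<bar>R\<bar> + 1"
  define f where "f = (\<lambda>r. 2 * R' * (pochhammer R' r / fact r * (1/2) ^ r))"
  define B where "B = (\<lambda>(r::nat,k::nat). f r * real k powr (- (1 + e)))"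
  have R': "R' > 0" by (simp add: R'_def)
  have f0: "f r \<ge> 0" for r using R' by (auto simp: f_def pochhammer_nonneg)
  have "summable (\<lambda>j. norm (complex_of_real (pochhammer R' j / fact j * (1/2) ^ j)))"
    using pochhammer_summable_norm[of "1/2" "of_real R'"] by (simp add: pochhammer_of_real norm_mult norm_divide)
  then have "summable (\<lambda>j. norm (pochhammer R' j / fact j * (1/2) ^ j))" unfolding norm_of_real real_norm_def .
  from summable_mult[OF this, of "2 * R'"] have "summable (\<lambda>r. norm (f r))" using R' by (simp add: f_def abs_mult)
  then have fs: "f summable_on UNIV" by (rule norm_summable_imp_summable_on)
  show ?thesis
  proof (rule that[of B])
    show "B summable_on {1..}\<times>{q..}"
      unfolding B_def by (rule summable_on_prod_nonneg[OF fs summable_on_powr_nat]) (use assms f0 in auto)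
    fix s :: complex and r k :: nat assume s: "norm s \<le> R" "Re s \<ge> e" and rk: "(r,k) \<in> {1..}\<times>{q..}"
    have k: "k \<ge> 2" "r \<ge> 1" using rk assms by auto
    have sR: "norm s \<le> R'" "norm (s - 1) \<le> R'"
      using s norm_triangle_ineq4[of s 1] by (auto simp: R'_def)
    have "norm (shift_coeff s r) \<le> R' * pochhammer R' r / fact r"
      unfolding norm_shift_coeff using sR R' norm_pochhammer_le[OF sR(1), of r]
      by (intro frac_le mult_mono mult_nonneg_nonneg) (auto simp: pochhammer_nonneg fact_mono)
    moreover have "norm (of_nat k powr (- s - of_nat r) :: complex) \<le> 2 * (1/2) ^ r * real k powr (- (1 + e))"
    proof -
      have "norm (of_nat k powr (- s - of_nat r) :: complex) = real k powr (- Re s - real r)"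
        using k by (simp add: norm_nat_powr)
      also have "\<dots> \<le> real k powr (- e - real r)" using k s by (intro powr_mono) auto
      \<comment> \<open>Of the r >= 1 available powers of k one is spent on the sum over k, the
        other r - 1 on the sum over r.\<close>
      also have "\<dots> = real k powr (- (real r - 1)) * real k powr (- (1 + e))"
        by (subst powr_add[symmetric]) (rule arg_cong[of _ _ "\<lambda>t. real k powr t"], simp)
      also have "\<dots> \<le> 2 powr (- (real r - 1)) * real k powr (- (1 + e))"
        using k by (intro mult_right_mono powr_mono2') auto
      also have "2 powr (- (real r - 1)) = 2 * (1/2) ^ r"
        by (simp add: powr_diff powr_minus powr_realpow power_one_over field_simps)
      finally show ?thesis .
    qed
    ultimately have "norm (shift_coeff s r) * norm (of_nat k powr (- s - of_nat r) :: complex) \<le> (R' * pochhammer R' r / fact r) * (2 * (1/2) ^ r * real k powr (- (1 + e)))"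
      using R' by (intro mult_mono) (auto simp: pochhammer_nonneg)
    then show "norm (shift_coeff s r * of_nat k powr (- s - of_nat r)) \<le> B (r,k)"
      by (simp add: norm_mult B_def f_def mult_ac)
  qed
qed

lemma zeta_tail_double_summable:
  assumes "Re s > 0" "q \<ge> 2"
  shows "(\<lambda>(r,k). shift_coeff s r * of_nat k powr (- s - of_nat r)) summable_on {1..}\<times>{q..}"
proof -
  obtain B where B: "B summable_on {1..}\<times>{q..}"
    "\<And>s' (r::nat) (k::nat). norm s' \<le> norm s \<Longrightarrow> Re s' \<ge> Re s \<Longrightarrow> (r,k) \<in> {1..}\<times>{q..} \<Longrightarrow> norm (shift_coeff s' r * of_nat k powr (- s' - of_nat r)) \<le> B (r,k)"
    using zeta_tail_double_bound[OF assms, of "norm s"] by blast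
  have "(\<lambda>p. norm (case p of (r,k) \<Rightarrow> shift_coeff s r * of_nat k powr (- s - of_nat r))) summable_on {1..}\<times>{q..}"
    by (rule summable_on_comparison_test[OF B(1)]) (use B(2)[of s] in auto)
  then show ?thesis by (rule abs_summable_summable)
qed

lemma zeta_tail_cont_holomorphic:
  assumes q: "q \<ge> 2"
  shows "zeta_tail_cont q holomorphic_on {s. Re s > 0 \<and> s \<noteq> 1}"
proof -
  have oU: "open {s. Re s > 0}" by (rule open_halfspace_Re_gt)
  have "(\<lambda>s. \<Sum>\<^sub>\<infinity>p\<in>{1..}\<times>{q..}. case p of (r,k) \<Rightarrow> shift_coeff s r * of_nat k powr (- s - of_nat r)) holomorphic_on {s. Re s > 0}"
  proof (rule infsum_holomorphic_on[OF oU])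
    fix p :: "nat \<times> nat" assume "p \<in> {1..} \<times> {q..}"
    then obtain r k where p: "p = (r,k)" "k \<ge> 2" using q by auto
    have "(\<lambda>s. shift_coeff s r) holomorphic_on {s. Re s > 0}"
      unfolding shift_coeff_def gbinomial_pochhammer pochhammer_prod by (intro holomorphic_intros) auto
    then show "(\<lambda>s. case p of (r,k) \<Rightarrow> shift_coeff s r * of_nat k powr (- s - of_nat r)) holomorphic_on {s. Re s > 0}"
      using p by (auto intro!: holomorphic_intros)
  next
    fix a :: complex assume a: "a \<in> {s. Re s > 0}"
    define e where "e = Re a / 2"
    have e: "e > 0" using a by (simp add: e_def)
    obtain B where B: "B summable_on {1..}\<times>{q..}"
      "\<And>s (r::nat) (k::nat). norm s \<le> norm a + e \<Longrightarrow> Re s \<ge> e \<Longrightarrow> (r,k) \<in> {1..}\<times>{q..} \<Longrightarrow> norm (shift_coeff s r * of_nat k powr (- s - of_nat r)) \<le> B (r,k)"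
      using zeta_tail_double_bound[OF e q, of "norm a + e"] by blast
    show "\<exists>e>0. \<exists>B. B summable_on {1..}\<times>{q..} \<and> (\<forall>i\<in>{1..}\<times>{q..}. \<forall>z\<in>ball a e \<inter> {s. Re s > 0}. norm (case i of (r,k) \<Rightarrow> shift_coeff z r * of_nat k powr (- z - of_nat r)) \<le> B i)"
    proof (intro exI[of _ e] conjI e exI[of _ B] B(1) ballI)
      fix i :: "nat \<times> nat" and z assume i: "i \<in> {1..}\<times>{q..}" and z: "z \<in> ball a e \<inter> {s. Re s > 0}"
      have d: "norm (z - a) < e" using z by (simp add: dist_norm norm_minus_commute)
      have "norm z \<le> norm a + e" using norm_triangle_ineq[of "z - a" a] d by simp
      moreover have "Re z \<ge> e" using d abs_Re_le_cmod[of "z - a"] by (simp add: e_def)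
      ultimately show "norm (case i of (r,k) \<Rightarrow> shift_coeff z r * of_nat k powr (- z - of_nat r)) \<le> B i"
        using B(2)[of z] i by auto
    qed
  qed
  then have "zeta_tail_double q holomorphic_on {s. Re s > 0 \<and> s \<noteq> 1}"
    unfolding zeta_tail_double_def[abs_def] by (rule holomorphic_on_subset) auto
  then show ?thesis unfolding zeta_tail_cont_def[abs_def] using q by (auto intro!: holomorphic_intros)
qed

text \<open>The binomial expansion of (k+1)^(1-s) with its first two terms moved to the other
  side.\<close>

lemma binomial_step:
  assumes "k \<ge> 2" "Re s > 0"
  shows "((\<lambda>r. shift_coeff s r * of_nat k powr (- s - of_nat r)) has_sum
     (of_nat k powr (1 - s) - of_nat (Suc k) powr (1 - s) - (s - 1) * of_nat k powr (- s))) {1..}"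
proof -
  have "(\<lambda>n. ((1 - s) gchoose n) * of_real (real k) powr (1 - s - of_nat n) * of_real 1 ^ n) sums
      of_real (real k + 1) powr (1 - s)"
    by (rule gen_binomial_complex'') (use assms in auto)
  then have A: "(\<lambda>n. ((1 - s) gchoose n) * of_nat k powr (1 - s - of_nat n)) sums of_nat (Suc k) powr (1 - s)"
    by (simp add: add.commute)
  have B: "(\<lambda>n. ((1 - s) gchoose (n + 2)) * of_nat k powr (1 - s - of_nat (n + 2))) sums
     (of_nat (Suc k) powr (1 - s) - (of_nat k powr (1 - s) + (1 - s) * of_nat k powr (- s)))"
    using sums_split_initial_segment[OF A, of 2] by (simp add: numeral_2_eq_2)
  have e: "((1 - s) gchoose (n + 2)) * of_nat k powr (1 - s - of_nat (n + 2)) = - (shift_coeff s (Suc n) * of_nat k powr (- s - of_nat (Suc n)))" for n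
  proof -
    have "1 - s - of_nat (n + 2) = - s - of_nat (Suc n)" by simp
    then show ?thesis by (simp only: shift_coeff_def add_2_eq_Suc' minus_mult_left minus_minus)
  qed
  have C: "(\<lambda>n. shift_coeff s (Suc n) * of_nat k powr (- s - of_nat (Suc n))) sums
     (of_nat k powr (1 - s) - of_nat (Suc k) powr (1 - s) - (s - 1) * of_nat k powr (- s))"
    using sums_minus[OF B] unfolding e by (simp add: algebra_simps)
  have "(\<lambda>(r,k). shift_coeff s r * of_nat k powr (- s - of_nat r)) summable_on {1..}\<times>{k..}"
    by (rule zeta_tail_double_summable) (use assms in auto)
  then have "(\<lambda>(r,k). shift_coeff s r * of_nat k powr (- s - of_nat r)) summable_on (\<lambda>r. (r,k)) ` {1..}"
    by (rule summable_on_subset) auto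
  then have "(\<lambda>r. shift_coeff s r * of_nat k powr (- s - of_nat r)) summable_on {1..}"
    by (subst (asm) summable_on_reindex) (auto simp: inj_on_def o_def)
  then obtain S where S: "((\<lambda>r. shift_coeff s r * of_nat k powr (- s - of_nat r)) has_sum S) {1..}" by (auto simp: summable_on_def)
  also have "?this \<longleftrightarrow> ((\<lambda>n. shift_coeff s (Suc n) * of_nat k powr (- s - of_nat (Suc n))) has_sum S) UNIV"
    by (rule has_sum_reindex_bij_witness[of _ Suc "\<lambda>r. r - 1"]) auto
  finally have "(\<lambda>n. shift_coeff s (Suc n) * of_nat k powr (- s - of_nat (Suc n))) sums S" by (rule has_sum_imp_sums)
  with C S show ?thesis by (simp add: sums_iff)
qed

lemma zeta_tail_summable:
  assumes "Re s > 1" shows "(\<lambda>k. norm (of_nat k powr (- s) :: complex)) summable_on {q..}"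
proof -
  have "(\<lambda>k. real k powr (- Re s)) summable_on {q..}"
    using summable_on_powr_nat[OF assms] by (rule summable_on_subset) auto
  then show ?thesis
    by (rule summable_on_comparison_test) (auto simp: norm_powr_real_powr)
qed

lemma zeta_tail_double_iter:
  assumes "Re s > 0" "q \<ge> 2"
  shows "zeta_tail_double q s = (\<Sum>\<^sub>\<infinity>r\<in>{1..}. shift_coeff s r * zeta_tail q (s + of_nat r))"
    and "(\<lambda>r. shift_coeff s r * zeta_tail q (s + of_nat r)) summable_on {1..}"
proof -
  have e: "(\<Sum>\<^sub>\<infinity>k\<in>{q..}. shift_coeff s r * of_nat k powr (- s - of_nat r)) = shift_coeff s r * zeta_tail q (s + of_nat r)" for r
    by (simp add: zeta_tail_def infsum_cmult_right' minus_add_distrib)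
  show "zeta_tail_double q s = (\<Sum>\<^sub>\<infinity>r\<in>{1..}. shift_coeff s r * zeta_tail q (s + of_nat r))"
    unfolding zeta_tail_double_def using infsum_Sigma'_banach[OF zeta_tail_double_summable[OF assms], symmetric] by (simp add: e)
  show "(\<lambda>r. shift_coeff s r * zeta_tail q (s + of_nat r)) summable_on {1..}"
    using summable_on_Sigma_banach[OF zeta_tail_double_summable[OF assms]] by (simp add: e)
qed

text \<open>After reordering, the sum over r collapses by \<open>binomial_step\<close>; adding back
  (s-1) k^(-s) leaves differences that telescope to q^(1-s).\<close>

lemma zeta_tail_cont_eq_tail:
  assumes "Re s > 1" "q \<ge> 2"
  shows "zeta_tail_cont q s = zeta_tail q s"
proof -
  have s0: "Re s > 0" using assms by simp
  define S where "S = (\<Sum>\<^sub>\<infinity>k\<in>{q..}. of_nat k powr (1 - s) - of_nat (Suc k) powr (1 - s) - (s - 1) * of_nat k powr (- s) :: complex)"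
  have sw: "(\<lambda>(k,r). shift_coeff s r * of_nat k powr (- s - of_nat r)) summable_on {q..}\<times>{1..}"
    using zeta_tail_double_summable[OF s0 assms(2)] by (subst (asm) summable_on_swap) (simp add: case_prod_unfold)
  have inner: "(\<Sum>\<^sub>\<infinity>r\<in>{1..}. shift_coeff s r * of_nat k powr (- s - of_nat r)) = of_nat k powr (1 - s) - of_nat (Suc k) powr (1 - s) - (s - 1) * of_nat k powr (- s)"
    if "k \<in> {q..}" for k
    using binomial_step[of k s] that assms by (auto intro!: infsumI)
  have "zeta_tail_double q s = (\<Sum>\<^sub>\<infinity>(k,r)\<in>{q..}\<times>{1..}. shift_coeff s r * of_nat k powr (- s - of_nat r))"
    unfolding zeta_tail_double_def by (rule infsum_reindex_bij_witness[of _ prod.swap prod.swap]) auto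
  also have "\<dots> = (\<Sum>\<^sub>\<infinity>k\<in>{q..}. \<Sum>\<^sub>\<infinity>r\<in>{1..}. shift_coeff s r * of_nat k powr (- s - of_nat r))"
    by (rule infsum_Sigma'_banach[OF sw, symmetric])
  also have "\<dots> = S" unfolding S_def by (intro infsum_cong inner)
  finally have ZS: "zeta_tail_double q s = S" .
  have sS: "(\<lambda>k. of_nat k powr (1 - s) - of_nat (Suc k) powr (1 - s) - (s - 1) * of_nat k powr (- s) :: complex) summable_on {q..}"
    using summable_on_Sigma_banach[OF sw] by (rule summable_on_cong[THEN iffD1, rotated]) (rule inner)
  have zs: "((\<lambda>k. (s - 1) * of_nat k powr (- s)) has_sum ((s - 1) * zeta_tail q s)) {q..}"
    unfolding zeta_tail_def by (rule has_sum_cmult_right[OF has_sum_infsum[OF abs_summable_summable[OF zeta_tail_summable[OF assms(1)]]]])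
  have "((\<lambda>k. (of_nat k powr (1 - s) - of_nat (Suc k) powr (1 - s) - (s - 1) * of_nat k powr (- s)) + (s - 1) * of_nat k powr (- s)) has_sum (S + (s - 1) * zeta_tail q s)) {q..}"
    unfolding S_def by (intro has_sum_add has_sum_infsum sS zs)
  then have "((\<lambda>k. of_nat k powr (1 - s) - of_nat (Suc k) powr (1 - s)) has_sum (S + (s - 1) * zeta_tail q s)) {q..}" by simp
  also have "?this \<longleftrightarrow> ((\<lambda>k. of_nat (k + q) powr (1 - s) - of_nat (Suc k + q) powr (1 - s)) has_sum (S + (s - 1) * zeta_tail q s)) UNIV"
    by (rule has_sum_reindex_bij_witness[of _ "\<lambda>k. k + q" "\<lambda>k. k - q"]) auto
  finally have "(\<lambda>k. of_nat (k + q) powr (1 - s) - of_nat (Suc k + q) powr (1 - s)) sums (S + (s - 1) * zeta_tail q s)" by (rule has_sum_imp_sums)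
  moreover have "(\<lambda>k. of_nat (k + q) powr (1 - s) - of_nat (Suc k + q) powr (1 - s)) sums (of_nat (0 + q) powr (1 - s) - 0 :: complex)"
  proof (rule telescope_sums')
    show "(\<lambda>k. of_nat (k + q) powr (1 - s) :: complex) \<longlonglongrightarrow> 0"
    proof (rule Lim_null_comparison)
      show "\<forall>\<^sub>F k in sequentially. norm (of_nat (k + q) powr (1 - s) :: complex) \<le> real (k + q) powr (- (Re s - 1))"
        using assms by (intro always_eventually allI) (subst norm_nat_powr, auto)
      show "(\<lambda>k. real (k + q) powr (- (Re s - 1))) \<longlonglongrightarrow> 0"
        using assms by (intro tendsto_neg_powr filterlim_compose[OF filterlim_real_sequentially] filterlim_add_const_nat_at_top) auto
    qed
  qed
  ultimately have "S + (s - 1) * zeta_tail q s = of_nat q powr (1 - s)" by (simp add: sums_iff)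
  moreover have "s \<noteq> 1" using assms by auto
  ultimately show ?thesis unfolding zeta_tail_cont_def ZS by (simp add: field_simps)
qed

section \<open>Size of the continued tails\<close>

lemma norm_zeta_tail_le:
  assumes "Re s > 1" "q \<ge> 1"
  shows "norm (zeta_tail q s) \<le> real q powr (- Re s) + real q powr (1 - Re s) / (Re s - 1)"
proof -
  have "norm (zeta_tail q s) \<le> (\<Sum>\<^sub>\<infinity>k\<in>{q..}. norm (of_nat k powr (- s) :: complex))"
    unfolding zeta_tail_def by (rule norm_infsum_bound[OF zeta_tail_summable[OF assms(1)]])
  also have "\<dots> = (\<Sum>\<^sub>\<infinity>k\<in>{q..}. real k powr (- Re s))"
    using assms by (intro infsum_cong) (auto simp: norm_nat_powr)
  also have "\<dots> \<le> real q powr (- Re s) + real q powr (1 - Re s) / (Re s - 1)"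
    by (rule powr_tail_bound) (use assms in auto)
  finally show ?thesis .
qed

text \<open>These terms dominate the weights of the tail recursion when the argument is at most q/2
  in modulus. The sum is 16/9 at q = 4 and tends to sqrt(e), so without its term r = 0 it is at most
  1; the remaining factor 1/(r+1) <= 1/2 then makes the recursion contract.\<close>

lemma pochhammer_sum_half:
  assumes q: "(q::nat) \<ge> 4"
  shows "(\<lambda>r. pochhammer (real q / 2) r / fact r * (1 / real q) ^ r) sums ((1 - 1 / real q) powr (- (real q / 2)))"
    and "(1 - 1 / real q) powr (- (real q / 2)) \<le> 2"
proof -
  have "(\<lambda>r. pochhammer (complex_of_real (real q / 2)) r / fact r * (complex_of_real (1 / real q)) ^ r) sums
      ((1 - complex_of_real (1 / real q)) powr (- complex_of_real (real q / 2)))"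
    by (rule pochhammer_sums) (use q in \<open>simp add: norm_divide\<close>)
  also have "(1 - complex_of_real (1 / real q)) powr (- complex_of_real (real q / 2)) = complex_of_real ((1 - 1 / real q) powr (- (real q / 2)))"
    using powr_of_real[of "1 - 1 / real q" "- (real q / 2)"] q by simp
  also have "(\<lambda>r. pochhammer (complex_of_real (real q / 2)) r / fact r * (complex_of_real (1 / real q)) ^ r)
      = (\<lambda>r. complex_of_real (pochhammer (real q / 2) r / fact r * (1 / real q) ^ r))"
    by (simp add: fun_eq_iff flip: pochhammer_of_real)
  finally show "(\<lambda>r. pochhammer (real q / 2) r / fact r * (1 / real q) ^ r) sums ((1 - 1 / real q) powr (- (real q / 2)))"
    by (simp only: sums_of_real_iff)
  have "- ln (1 - 1 / real q) = ln (1 + 1 / (real q - 1))"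
    using q by (subst ln_inverse[symmetric]) (auto simp: field_simps)
  also have "\<dots> \<le> 1 / (real q - 1)" using q by (intro ln_add_one_self_le_self) auto
  finally have "(real q / 2) * (- ln (1 - 1 / real q)) \<le> (real q / 2) * (1 / (real q - 1))"
    using q by (intro mult_left_mono) auto
  \<comment> \<open>The inequality (q/2)/(q-1) <= 2/3 amounts to q >= 4.\<close>
  also have "\<dots> \<le> 2 / 3" using q by (simp add: field_simps)
  also have "\<dots> \<le> ln 2" by (rule ln2_ge_two_thirds)
  finally have le: "(real q / 2) * (- ln (1 - 1 / real q)) \<le> ln 2" .
  have "exp ((real q / 2) * (- ln (1 - 1 / real q))) \<le> 2"
    by (rule order_trans[OF iffD2[OF exp_le_cancel_iff le]]) simp
  then show "(1 - 1 / real q) powr (- (real q / 2)) \<le> 2" using q by (simp add: powr_def)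
qed

text \<open>The quantities \<open>|Z(s + i)| q\<^sup>\<sigma>\<^sup>+\<^sup>i\<^sup>-\<^sup>1\<close> for all \<open>i \<ge> 0\<close> are bounded together: the binomial
  recursion expresses each through the later ones with total weight at most \<open>1/2\<close>.\<close>
lemma zeta_tail_cont_bound:
  assumes q: "q \<ge> 4" and s: "Re s > 1/2" "Im s > 0" "norm s \<le> real q / 4"
  shows "norm (zeta_tail_cont q s) \<le> 3 * real q powr (1 - Re s) / Im s"
proof -
  define Q where "Q = real q"
  define t where "t = Im s"
  have Q: "Q \<ge> 4" "Q > 0" using q by (auto simp: Q_def)
  have t: "t > 0" "t \<le> Q / 4" using s abs_Im_le_cmod[of s] by (auto simp: t_def Q_def)
  define y where "y = (\<lambda>i. norm (zeta_tail_cont q (s + of_nat i)) * Q powr (Re s + real i - 1))"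
  have y0: "y i \<ge> 0" for i by (simp add: y_def)
  have Zi: "zeta_tail_cont q (s + of_nat i) = zeta_tail q (s + of_nat i)" if "i \<ge> 1" for i
    by (rule zeta_tail_cont_eq_tail) (use that s q in auto)
  have y1: "y i \<le> 1 / Q + 1 / (Re s + real i - 1)" if i: "i \<ge> 1" for i
  proof -
    have "norm (zeta_tail_cont q (s + of_nat i)) \<le> Q powr (- Re (s + of_nat i)) + Q powr (1 - Re (s + of_nat i)) / (Re (s + of_nat i) - 1)"
      unfolding Zi[OF i] Q_def by (rule norm_zeta_tail_le) (use i s q in auto)
    then have "y i \<le> (Q powr (- Re (s + of_nat i)) + Q powr (1 - Re (s + of_nat i)) / (Re (s + of_nat i) - 1)) * Q powr (Re s + real i - 1)"
      unfolding y_def by (intro mult_right_mono) auto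
    also have "\<dots> = Q powr (- Re (s + of_nat i)) * Q powr (Re s + real i - 1) + Q powr (1 - Re (s + of_nat i)) * Q powr (Re s + real i - 1) / (Re (s + of_nat i) - 1)"
      by (simp add: algebra_simps)
    also have "\<dots> = Q powr (-1) + Q powr 0 / (Re s + real i - 1)"
      unfolding powr_add[symmetric] by simp
    also have "\<dots> = 1 / Q + 1 / (Re s + real i - 1)" using Q by (simp add: powr_minus field_simps)
    finally show ?thesis .
  qed
  \<comment> \<open>The supremum must be known to be finite before the contraction can be used. For
    i >= 1 the trivial bound is at most 1 + 2, as Re s > 1/2.\<close>
  have ybd: "y i \<le> max (y 0) 3" for i
  proof (cases "i = 0")
    case False
    then have "1 / (Re s + real i - 1) \<le> 1 / (1/2)" using s by (intro divide_left_mono) auto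
    moreover have "1 / Q \<le> 1" using Q by simp
    ultimately show ?thesis using y1[of i] False by auto
  qed auto
  define X where "X = (SUP i. y i)"
  have bdd: "bdd_above (range y)" using ybd by (auto intro!: bdd_aboveI2)
  have yX: "y i \<le> X" for i unfolding X_def by (rule cSUP_upper[OF _ bdd]) simp
  have X0: "X \<ge> 0" using yX[of 0] y0[of 0] by linarith
  \<comment> \<open>In this range |s + i| <= Q/2, so the Pochhammer symbols are dominated by those
    of Q/2. The leading term divided by s + i - 1 gives 1/t, the recursion gives X/2.\<close>
  have step: "y i \<le> 1 / t + X / 2" if i: "real i \<le> Q / 4" for i
  proof -
    define si where "si = s + of_nat i"
    have si1: "norm (si - 1) \<ge> t" using abs_Im_le_cmod[of "si - 1"] by (simp add: si_def t_def)
    then have sipos: "norm (si - 1) > 0" using t by linarith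
    have nsi: "norm si \<le> Q / 2" using norm_triangle_ineq[of s "of_nat i"] s i by (simp add: si_def Q_def)
    have rsi: "Re si > 0" using s by (simp add: si_def)
    define M where "M = norm (si - 1) * X * Q powr (1 - Re si) / 2"
    define g where "g = (\<lambda>r. pochhammer (Q / 2) r / fact r * (1 / Q) ^ r)"
    have g0: "g r \<ge> 0" for r using Q by (simp add: g_def pochhammer_nonneg)
    have gs: "g sums ((1 - 1 / Q) powr (- (Q / 2)))" unfolding g_def Q_def by (rule pochhammer_sum_half(1)[OF q])
    have ghs: "(g has_sum ((1 - 1 / Q) powr (- (Q / 2)))) UNIV"
      by (rule norm_summable_imp_has_sum) (use gs g0 in \<open>auto simp: sums_iff\<close>)
    have g1: "(g has_sum ((1 - 1 / Q) powr (- (Q / 2)) - 1)) {1..}"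
    proof -
      have "(g has_sum g 0) {0}" by (rule has_sum_finiteI) auto
      from has_sum_Diff[OF ghs this] have "(g has_sum ((1 - 1 / Q) powr (- (Q / 2)) - g 0)) (UNIV - {0})" by simp
      moreover have "UNIV - {0} = {1::nat..}" by auto
      ultimately show ?thesis by (simp add: g_def)
    qed
    have term_le: "norm (shift_coeff si r * zeta_tail q (si + of_nat r)) \<le> M * g r" if r: "r \<in> {1..}" for r
    proof -
      have d: "norm (shift_coeff si r) \<le> norm (si - 1) * (pochhammer (Q / 2) r / fact r / 2)"
      proof -
        have "norm (pochhammer si r) / fact (Suc r) \<le> pochhammer (Q / 2) r / (2 * fact r)"
          using norm_pochhammer_le[OF nsi, of r] r Q by (intro frac_le) (auto intro!: mult_right_mono simp: pochhammer_nonneg)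
        then show ?thesis unfolding norm_shift_coeff times_divide_eq_right[symmetric] by (intro mult_left_mono) (auto simp: mult.commute)
      qed
      have "norm (zeta_tail q (si + of_nat r)) * Q powr (Re s + real (i + r) - 1) \<le> X"
        using yX[of "i + r"] Zi[of "i + r"] r by (simp add: y_def si_def add.assoc)
      then have "norm (zeta_tail q (si + of_nat r)) * Q powr (Re s + real (i + r) - 1) * Q powr (- (Re s + real (i + r) - 1)) \<le> X * Q powr (- (Re s + real (i + r) - 1))"
        by (intro mult_right_mono) auto
      then have "norm (zeta_tail q (si + of_nat r)) \<le> X * Q powr (- (Re s + real (i + r) - 1))"
        using Q by (simp add: mult.assoc flip: powr_add)
      also have "Q powr (- (Re s + real (i + r) - 1)) = Q powr (1 - Re si) * Q powr (- real r)"
        by (subst powr_add[symmetric]) (rule arg_cong[of _ _ "\<lambda>t. Q powr t"], simp add: si_def)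
      also have "Q powr (- real r) = (1 / Q) ^ r" using Q by (simp add: powr_minus powr_realpow power_one_over field_simps)
      finally have z: "norm (zeta_tail q (si + of_nat r)) \<le> X * (Q powr (1 - Re si) * (1 / Q) ^ r)" .
      have "norm (shift_coeff si r * zeta_tail q (si + of_nat r)) \<le> (norm (si - 1) * (pochhammer (Q / 2) r / fact r / 2)) * (X * (Q powr (1 - Re si) * (1 / Q) ^ r))"
        unfolding norm_mult using d z Q by (intro mult_mono) (auto simp: pochhammer_nonneg)
      also have "\<dots> = M * g r" by (simp add: M_def g_def mult_ac)
      finally show ?thesis .
    qed
    have Ms: "((\<lambda>r. M * g r) has_sum (M * ((1 - 1 / Q) powr (- (Q / 2)) - 1))) {1..}" by (rule has_sum_cmult_right[OF g1])
    have q2: "q \<ge> 2" using q by simp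
    have ns: "(\<lambda>r. norm (shift_coeff si r * zeta_tail q (si + of_nat r))) summable_on {1..}"
      by (rule summable_on_comparison_test[OF has_sum_imp_summable[OF Ms]]) (use term_le in auto)
    have "norm (zeta_tail_double q si) \<le> (\<Sum>\<^sub>\<infinity>r\<in>{1..}. norm (shift_coeff si r * zeta_tail q (si + of_nat r)))"
      unfolding zeta_tail_double_iter(1)[OF rsi q2] by (rule norm_infsum_bound[OF ns])
    also have "\<dots> \<le> (\<Sum>\<^sub>\<infinity>r\<in>{1..}. M * g r)"
      by (rule infsum_mono[OF ns has_sum_imp_summable[OF Ms] term_le])
    also have "\<dots> = M * ((1 - 1 / Q) powr (- (Q / 2)) - 1)" by (rule infsumI[OF Ms])
    also have "\<dots> \<le> M * 1"
      using pochhammer_sum_half(2)[OF q] X0 Q by (intro mult_left_mono) (auto simp: Q_def M_def)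
    finally have Zp: "norm (zeta_tail_double q si) \<le> M" by simp
    have "norm (zeta_tail_cont q si) = norm (of_nat q powr (1 - si) - zeta_tail_double q si) / norm (si - 1)"
      by (simp add: zeta_tail_cont_def norm_divide)
    also have "\<dots> \<le> (Q powr (1 - Re si) + M) / norm (si - 1)"
      using Zp norm_triangle_ineq4[of "of_nat q powr (1 - si)" "zeta_tail_double q si"] norm_nat_powr[of q "1 - si"] q
      by (intro divide_right_mono) (auto simp: Q_def)
    also have "\<dots> = Q powr (1 - Re si) / norm (si - 1) + X * Q powr (1 - Re si) / 2"
      using sipos by (simp add: M_def add_divide_distrib)
    also have "\<dots> \<le> Q powr (1 - Re si) / t + X * Q powr (1 - Re si) / 2"
      using si1 t by (intro add_right_mono divide_left_mono mult_pos_pos) auto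
    also have "\<dots> = (1 / t + X / 2) * Q powr (1 - Re si)" by (simp add: algebra_simps)
    finally have "norm (zeta_tail_cont q si) \<le> (1 / t + X / 2) * Q powr (1 - Re si)" .
    then have "norm (zeta_tail_cont q si) * Q powr (Re s + real i - 1) \<le> (1 / t + X / 2) * Q powr (1 - Re si) * Q powr (Re s + real i - 1)"
      by (intro mult_right_mono) auto
    also have "\<dots> = 1 / t + X / 2" using Q by (simp add: mult.assoc si_def flip: powr_add)
    finally show ?thesis by (simp add: y_def si_def)
  qed
  \<comment> \<open>Beyond Q/4 the trivial bound is already 9/Q, and t <= Q/4.\<close>
  have big: "y i \<le> 3 / t" if i: "real i > Q / 4" for i
  proof -
    have i1: "i \<ge> 1" using i Q by (cases i) auto
    have "1 / (Re s + real i - 1) \<le> 1 / (Q / 8)"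
      using s i Q by (intro divide_left_mono mult_pos_pos) auto
    then have "y i \<le> 1 / Q + 1 / (Q / 8)" using y1[OF i1] by linarith
    also have "\<dots> = 9 / Q" by simp
    also have "\<dots> \<le> 3 / t" using t Q by (simp add: field_simps)
    finally show ?thesis .
  qed
  have "X \<le> max (3 / t) (1 / t + X / 2)"
    unfolding X_def
  proof (rule cSUP_least)
    fix i show "y i \<le> max (3 / t) (1 / t + (SUP i. y i) / 2)"
      using step[of i] big[of i] unfolding X_def by (cases "real i \<le> Q / 4") auto
  qed simp
  moreover have "1 / t + X / 2 \<le> 3 / t" if "X \<le> 1 / t + X / 2"
  proof -
    have "3 / t = 1 / t + 1 / t + 1 / t" by (simp add: field_simps)
    moreover have "1 / t > 0" using t by simp
    ultimately show ?thesis using that by linarith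
  qed
  ultimately have "X \<le> 3 / t" by linarith
  then have "y 0 \<le> 3 / t" using yX[of 0] by linarith
  then have "norm (zeta_tail_cont q s) * Q powr (Re s - 1) * Q powr (1 - Re s) \<le> 3 / t * Q powr (1 - Re s)"
    unfolding y_def by (intro mult_right_mono) auto
  then show ?thesis using Q by (simp add: mult.assoc Q_def t_def flip: powr_add)
qed

section \<open>Convolutions of powers\<close>

text \<open>The coefficients of (1-x)^(s-1). They imitate m^(-s) up to the constant Gamma(1-s) and,
  unlike the powers, they convolve exactly.\<close>

definition binseq :: "complex \<Rightarrow> nat \<Rightarrow> complex" where
  "binseq s m = pochhammer (1 - s) m / fact m"

lemma binseq_Suc: "binseq s (Suc m) = binseq s m * (of_nat (Suc m) - s) / of_nat (Suc m)"
  by (simp add: binseq_def pochhammer_Suc field_simps del: of_nat_Suc)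
     (simp add: algebra_simps)

text \<open>Coefficient comparison in (1-x)^(s-1) (1-x)^(s'-1) = (1-x)^(s+s'-2). Taking out the sign
  (-1)^m turns rising factorials into binomial coefficients, to which Vandermonde's identity
  applies.\<close>

lemma binseq_conv: "(\<Sum>m\<le>k. binseq s m * binseq s' (k - m)) = binseq (s + s' - 1) k"
proof -
  have e: "binseq s m = (-1) ^ m * ((s - 1) gchoose m)" for s m
    by (simp add: binseq_def gbinomial_pochhammer mult.assoc[symmetric] flip: power_mult_distrib)
  have "(\<Sum>m\<le>k. binseq s m * binseq s' (k - m)) = (\<Sum>m=0..k. (-1) ^ k * (((s - 1) gchoose m) * ((s' - 1) gchoose (k - m))))"
  proof (intro sum.cong)
    fix m assume "m \<in> {0..k}"
    then have "(-1) ^ k = (-1) ^ m * (-1 :: complex) ^ (k - m)" by (simp flip: power_add)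
    then show "binseq s m * binseq s' (k - m) = (-1) ^ k * (((s - 1) gchoose m) * ((s' - 1) gchoose (k - m)))"
      by (simp add: e mult_ac)
  qed auto
  also have "\<dots> = binseq (s + s' - 1) k"
    unfolding sum_distrib_left[symmetric] gbinomial_Vandermonde by (simp add: e algebra_simps)
  finally show ?thesis .
qed

text \<open>For x = 1/(n+1) the product is the quotient of consecutive values of
  \<open>binseq s n\<close> times n^s. As a function of z it has derivative s (1-s) z (1-z)^(-s-1),
  which vanishes at 0; so the deviation from 1 is quadratic.\<close>

lemma ratio_bound:
  fixes s :: complex
  shows "\<exists>K\<ge>0. \<forall>x. 0 \<le> x \<longrightarrow> x \<le> 1/2 \<longrightarrow> norm ((1 - s * of_real x) * (1 - of_real x) powr (- s) - 1) \<le> K * x\<^sup>2"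
proof (intro exI[of _ "norm (s * (1 - s)) * 2 powr \<bar>Re s + 1\<bar>"] conjI allI impI)
  fix x :: real assume x: "0 \<le> x" "x \<le> 1/2"
  define f where "f = (\<lambda>z::complex. (1 - s * z) * (1 - z) powr (- s))"
  define S where "S = complex_of_real ` {0..x}"
  have Sconv: "convex S" unfolding S_def by (intro convex_linear_image linear_of_real) auto
  have der: "(f has_field_derivative (s * (1 - s) * z * (1 - z) powr (- s - 1))) (at z within S)" if zS: "z \<in> S" for z
  proof -
    obtain y where y: "z = of_real y" "0 \<le> y" "y \<le> x" using zS by (auto simp: S_def)
    have nz: "1 - z \<notin> \<real>\<^sub>\<le>\<^sub>0" "1 - z \<noteq> 0" using y x by (auto simp: complex_nonpos_Reals_iff complex_eq_iff)
    have "(f has_field_derivative (- s * (1 - z) powr (- s) + (1 - s * z) * (s * (1 - z) powr (- s - 1)))) (at z within S)"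
      unfolding f_def using nz by (auto intro!: derivative_eq_intros)
    moreover have "(1 - z) powr (- s) = (1 - z) * (1 - z) powr (- s - 1)"
      using nz by (simp add: powr_diff)
    ultimately show ?thesis by (simp add: algebra_simps)
  qed
  have bnd: "norm (s * (1 - s) * z * (1 - z) powr (- s - 1)) \<le> norm (s * (1 - s)) * 2 powr \<bar>Re s + 1\<bar> * x" if zS: "z \<in> S" for z
  proof -
    obtain y where y: "z = of_real y" "0 \<le> y" "y \<le> x" using zS by (auto simp: S_def)
    have "norm ((1 - z) powr (- s - 1)) = (1 - y) powr (- (Re s + 1))"
      using y x norm_powr_real_powr[of "1 - z" "- s - 1"] by simp
    also have "\<dots> \<le> 2 powr \<bar>Re s + 1\<bar>"
    proof (cases "Re s + 1 \<ge> 0")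
      case True
      have "(1 - y) powr (- (Re s + 1)) \<le> (1/2) powr (- (Re s + 1))"
        using True y x by (intro powr_mono2') auto
      also have "(1/2::real) powr (- e) = 2 powr e" for e by (simp add: powr_divide powr_minus_divide)
      also have "2 powr (Re s + 1) = 2 powr \<bar>Re s + 1\<bar>" using True by simp
      finally show ?thesis .
    next
      case False
      have "(1 - y) powr (- (Re s + 1)) \<le> 1" using False y x by (intro powr_le1) auto
      also have "\<dots> \<le> 2 powr \<bar>Re s + 1\<bar>" by (intro ge_one_powr_ge_zero) auto
      finally show ?thesis .
    qed
    finally have "norm (s * (1 - s)) * norm z * norm ((1 - z) powr (- s - 1)) \<le> norm (s * (1 - s)) * x * 2 powr \<bar>Re s + 1\<bar>"
      using y by (intro mult_mono mult_nonneg_nonneg) auto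
    then show ?thesis by (simp add: norm_mult mult_ac)
  qed
  have "norm (f (of_real x) - f (of_real 0)) \<le> (norm (s * (1 - s)) * 2 powr \<bar>Re s + 1\<bar> * x) * norm (of_real x - of_real 0 :: complex)"
    by (rule field_differentiable_bound[OF Sconv der bnd]) (use x in \<open>auto simp: S_def\<close>)
  then show "norm ((1 - s * of_real x) * (1 - of_real x) powr (- s) - 1) \<le> norm (s * (1 - s)) * 2 powr \<bar>Re s + 1\<bar> * x\<^sup>2"
    using x by (simp add: f_def power2_eq_square mult.assoc)
qed auto

text \<open>The constant is 1/Gamma(1-s), nonzero for Re s < 1. Convergence of
  \<open>binseq s n\<close> times n^s gives boundedness first; then its increments are O(1/n^2) by
  \<open>ratio_bound\<close> and add up to the rate 1/n.\<close>

lemma binseq_asymp: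
  assumes s: "Re s < 1"
  obtains r C where "r \<noteq> 0" "C \<ge> 0" "\<And>n. n \<ge> 1 \<Longrightarrow> norm (binseq s n - r * of_nat n powr (- s)) \<le> C * real n powr (- Re s - 1)"
proof -
  define R where "R = (\<lambda>n. binseq s n * of_nat n powr s)"
  define r where "r = rGamma (1 - s)"
  have r0: "r \<noteq> 0"
  proof -
    have "1 - s \<notin> \<int>\<^sub>\<le>\<^sub>0"
    proof
      assume "1 - s \<in> \<int>\<^sub>\<le>\<^sub>0"
      then obtain n where n: "1 - s = of_int n" "n \<le> 0" by (auto elim!: nonpos_Ints_cases)
      then have "Re (1 - s) = of_int n" by simp
      with s n(2) show False by simp
    qed
    then show ?thesis by (simp add: r_def rGamma_eq_zero_iff)
  qed
  have "R \<longlonglongrightarrow> r"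
  proof -
    \<comment> \<open>The approximants to 1/Gamma(1-s) carry one more factor of the Pochhammer
      symbol; the divisor 1 + (1-s)/n removes it.\<close>
    have "(\<lambda>n. rGamma_series (1 - s) n / (1 + (1 - s) / of_nat n)) \<longlonglongrightarrow> r / (1 + 0)"
      unfolding r_def by (intro tendsto_intros rGamma_series_LIMSEQ lim_const_over_n) auto
    moreover have "\<forall>\<^sub>F n in sequentially. rGamma_series (1 - s) n / (1 + (1 - s) / of_nat n) = R n"
      using eventually_gt_at_top[of 0]
    proof eventually_elim
      fix n :: nat assume n: "n > 0"
      have nz: "of_nat n + 1 - s \<noteq> 0" using n s by (auto simp: complex_eq_iff)
      have "exp ((1 - s) * of_real (ln (real n))) = of_nat n powr (1 - s)"
        using n by (simp add: powr_def Ln_of_nat)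
      also have "\<dots> = of_nat n / of_nat n powr s" using n by (simp add: powr_diff)
      finally have e: "exp ((1 - s) * of_real (ln (real n))) = of_nat n / of_nat n powr s" .
      have "rGamma_series (1 - s) n = pochhammer (1 - s) n * (1 - s + of_nat n) / (fact n * (of_nat n / of_nat n powr s))"
        by (simp add: rGamma_series_def e pochhammer_Suc)
      also have "\<dots> = R n * ((of_nat n + 1 - s) / of_nat n)" using n by (simp add: R_def binseq_def field_simps)
      also have "(of_nat n + 1 - s) / of_nat n = 1 + (1 - s) / of_nat n" using n by (simp add: field_simps)
      moreover have "1 + (1 - s) / of_nat n \<noteq> 0" using nz n by (simp add: field_simps)
      ultimately show "rGamma_series (1 - s) n / (1 + (1 - s) / of_nat n) = R n" by simp
    qed
    ultimately show ?thesis by (simp add: tendsto_cong)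
  qed
  then have "Bseq R" by (intro convergent_imp_Bseq) (auto simp: convergent_def)
  then obtain B where B: "B > 0" "\<And>n. norm (R n) \<le> B" by (auto simp: Bseq_def)
  obtain K where K: "K \<ge> 0" "\<And>x. 0 \<le> x \<Longrightarrow> x \<le> 1/2 \<Longrightarrow> norm ((1 - s * of_real x) * (1 - of_real x) powr (- s) - 1) \<le> K * x\<^sup>2"
    using ratio_bound[of s] by blast
  have step: "norm (R (Suc n) - R n) \<le> B * K * (1 / real n - 1 / real (Suc n))" if n: "n \<ge> 1" for n
  proof -
    define x where "x = 1 / real (Suc n)"
    have x: "0 \<le> x" "x \<le> 1/2" using n by (auto simp: x_def divide_simps)
    have "1 - x = real n / real (Suc n)" by (simp add: x_def field_simps)
    then have "1 - complex_of_real x = of_real (real n / real (Suc n))" by (metis of_real_1 of_real_diff)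
    then have x1: "1 - complex_of_real x = of_real (real n / real (Suc n))" .
    have "of_nat n powr s = (of_real (real n / real (Suc n)) * of_real (real (Suc n)) :: complex) powr s"
      unfolding of_real_mult[symmetric] by simp
    also have "\<dots> = (1 - of_real x) powr s * of_nat (Suc n) powr s"
      unfolding x1 by (subst powr_times_real) auto
    finally have nS: "of_nat n powr s = (1 - complex_of_real x) powr s * of_nat (Suc n) powr s" .
    have nz: "(of_nat (Suc n) powr s :: complex) \<noteq> 0" by (simp del: of_nat_Suc)
    have p: "(1 - of_real x) powr (- s) = of_nat (Suc n) powr s / (of_nat n powr s :: complex)"
      unfolding nS powr_minus using nz by (simp add: divide_simps del: of_nat_Suc)
    have e2: "1 - s * of_real x = (of_nat (Suc n) - s) / of_nat (Suc n)"
      by (simp add: x_def field_simps del: of_nat_Suc)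
    have nzn: "(of_nat n powr s :: complex) \<noteq> 0" using n by simp
    have "R (Suc n) = R n * ((1 - s * of_real x) * (1 - of_real x) powr (- s))"
      unfolding R_def binseq_Suc p e2 using nzn by (simp add: field_simps del: of_nat_Suc)
    then have "R (Suc n) - R n = R n * ((1 - s * of_real x) * (1 - of_real x) powr (- s) - 1)"
      by (simp add: algebra_simps)
    then have "norm (R (Suc n) - R n) \<le> B * (K * x\<^sup>2)"
      using B K(2)[OF x] by (simp add: norm_mult mult_mono)
    also have "\<dots> \<le> B * (K * (1 / real n - 1 / real (Suc n)))"
    proof -
      have "x\<^sup>2 = 1 / (real (Suc n) * real (Suc n))" by (simp add: x_def power2_eq_square)
      also have "\<dots> \<le> 1 / (real n * real (Suc n))"
        using n by (intro divide_left_mono mult_right_mono mult_pos_pos) auto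
      also have "\<dots> = 1 / real n - 1 / real (Suc n)" using n by (simp add: field_simps)
      finally show ?thesis using B(1) K(1) by (intro mult_left_mono) auto
    qed
    finally show ?thesis by simp
  qed
  have far: "norm (R (n + j) - R n) \<le> B * K * (1 / real n - 1 / real (n + j))" if n: "n \<ge> 1" for n j
  proof (induction j)
    case (Suc j)
    have "norm (R (n + Suc j) - R n) \<le> norm (R (Suc (n + j)) - R (n + j)) + norm (R (n + j) - R n)"
      using norm_triangle_ineq[of "R (Suc (n + j)) - R (n + j)" "R (n + j) - R n"] by simp
    also have "\<dots> \<le> B * K * (1 / real (n + j) - 1 / real (Suc (n + j))) + B * K * (1 / real n - 1 / real (n + j))"
      using n by (intro add_mono step Suc.IH) auto
    finally show ?case by (simp add: algebra_simps)
  qed simp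
  have lim: "norm (r - R n) \<le> B * K / real n" if n: "n \<ge> 1" for n
  proof (rule tendsto_upperbound)
    show "(\<lambda>j. norm (R (n + j) - R n)) \<longlonglongrightarrow> norm (r - R n)"
      using LIMSEQ_ignore_initial_segment[OF \<open>R \<longlonglongrightarrow> r\<close>, of n]
      by (intro tendsto_norm tendsto_diff tendsto_const) (simp add: add.commute)
    have "norm (R (n + j) - R n) \<le> B * K / real n" for j
    proof -
      have "B * K * (1 / real n - 1 / real (n + j)) \<le> B * K * (1 / real n)"
        using B K by (intro mult_left_mono) auto
      with far[OF n, of j] show ?thesis by simp
    qed
    then show "\<forall>\<^sub>F j in sequentially. norm (R (n + j) - R n) \<le> B * K / real n" by simp
  qed simp
  show ?thesis
  proof (rule that[OF r0, of "B * K"])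
    fix n :: nat assume n: "n \<ge> 1"
    have "binseq s n = R n * of_nat n powr (- s)" using n by (simp add: R_def powr_minus)
    then have "norm (binseq s n - r * of_nat n powr (- s)) = norm (r - R n) * real n powr (- Re s)"
      using n norm_nat_powr[of n "- s"] by (simp add: norm_minus_commute flip: left_diff_distrib norm_mult) (simp add: norm_mult norm_minus_commute)
    also have "\<dots> \<le> B * K / real n * real n powr (- Re s)" using lim[OF n] by (intro mult_right_mono) auto
    also have "\<dots> = B * K * real n powr (- Re s - 1)" using n by (simp add: powr_diff)
    finally show "norm (binseq s n - r * of_nat n powr (- s)) \<le> B * K * real n powr (- Re s - 1)" .
  qed (use B K in auto)
qed

section \<open>Convolution of a summable sequence with a slowly varying one\<close>

lemma sum_powr_le:
  assumes "0 < p" "p < 1"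
  shows "(\<Sum>n<N. real (Suc n) powr (- p)) \<le> real N powr (1 - p) / (1 - p)"
proof (induction N)
  case (Suc N)
  have "(1 - p) * real (Suc N) powr (- p) \<le> real (Suc N) powr (1 - p) - real N powr (1 - p)"
  proof (cases "N = 0")
    case True then show ?thesis using assms by simp
  next
    case False
    have "\<exists>z. real N < z \<and> z < real (Suc N) \<and> real (Suc N) powr (1 - p) - real N powr (1 - p) = (real (Suc N) - real N) * ((1 - p) * z powr (1 - p - 1))"
      by (rule MVT2) (use assms False in \<open>auto intro!: derivative_eq_intros\<close>)
    then obtain z where z: "real N < z" "z < real (Suc N)" "real (Suc N) powr (1 - p) - real N powr (1 - p) = (1 - p) * z powr (- p)"
      by auto
    have "real (Suc N) powr (- p) \<le> z powr (- p)" using z assms by (intro powr_mono2') auto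
    then show ?thesis unfolding z(3) using assms by (intro mult_left_mono) auto
  qed
  then have "real (Suc N) powr (- p) \<le> (real (Suc N) powr (1 - p) - real N powr (1 - p)) / (1 - p)"
    using assms by (simp add: pos_le_divide_eq mult.commute)
  then show ?case using Suc.IH by (simp add: diff_divide_distrib)
qed simp

lemma half_powr_le:
  fixes x K e :: real
  assumes "x \<ge> K / 2" "K > 0" "0 \<le> e" "e \<le> 2"
  shows "x powr (- e) \<le> 4 * K powr (- e)"
proof -
  have "x powr (- e) \<le> (K / 2) powr (- e)" using assms by (intro powr_mono2') auto
  also have "\<dots> = K powr (- e) * 2 powr e" using assms by (simp add: powr_divide powr_minus_divide)
  also have "\<dots> \<le> K powr (- e) * 2 powr 2" using assms by (intro mult_left_mono powr_mono) auto
  finally show ?thesis by simp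
qed

text \<open>\<open>d\<close> is absolutely summable with sum \<open>E\<close>, and \<open>a\<close>
  varies slowly. For n <= k/2, replacing a(k-n) by a(k) costs n k^(-t-1); for n > k/2, d(n) is
  O(k^(-p-1)) while the sum of \<open>a\<close> is O(k^(1-t)); the missing part of \<open>E\<close>
  is O(k^(-p)) and meets a(k) = O(k^(-t)). Each of the three is O(k^(-p-t)) in total.\<close>

lemma conv_asymp:
  fixes d a :: "nat \<Rightarrow> complex"
  assumes p: "0 < p" "p < 1" and t: "0 < t" "t < 1" and DA: "D \<ge> 0" "A \<ge> 0"
    and d: "\<And>n. norm (d n) \<le> D * real (Suc n) powr (- (p + 1))"
    and a: "\<And>n. norm (a n) \<le> A * real (Suc n) powr (- t)"
    and a': "\<And>n. norm (a (Suc n) - a n) \<le> A * real (Suc n) powr (- (t + 1))"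
  obtains C E where "C \<ge> 0" "\<And>k. norm ((\<Sum>n\<le>k. d n * a (k - n)) - E * a k) \<le> C * real (Suc k) powr (- (p + t))"
proof -
  have ds: "(\<lambda>n. norm (d n)) summable_on UNIV"
  proof -
    have "(\<lambda>n. real n powr (- (p + 1))) summable_on (Suc ` UNIV)"
      using summable_on_powr_nat[of "p + 1"] p by (intro summable_on_subset[OF summable_on_powr_nat]) auto
    then have "(\<lambda>n. D * real (Suc n) powr (- (p + 1))) summable_on UNIV"
      by (subst (asm) summable_on_reindex) (auto simp: o_def intro: summable_on_cmult_right)
    then show ?thesis by (rule summable_on_comparison_test) (use d in auto)
  qed
  define E where "E = (\<Sum>\<^sub>\<infinity>n. d n)"
  \<comment> \<open>The three summands are the constants of \<open>p1\<close>, \<open>p2\<close> and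
    \<open>p3\<close>; each 4 comes from \<open>half_powr_le\<close>.\<close>
  define C where "C = 4 * D * A / (1 - p) + 4 * D * A / (1 - t) + 4 * D * A * (1 + 1 / p)"
  have main: "norm ((\<Sum>n\<le>k. d n * a (k - n)) - E * a k) \<le> C * real (Suc k) powr (- (p + t))" for k
  proof -
    define L where "L = k div 2"
    define K where "K = real (Suc k)"
    have K: "K > 0" by (simp add: K_def)
    have Lk: "L \<le> k" "real L \<le> real k / 2" "real (Suc L) \<ge> K / 2" by (auto simp: L_def K_def)
    have tail: "norm (E - (\<Sum>n\<le>L. d n)) \<le> D * (4 * (1 + 1 / p) * K powr (- p))"
    proof -
      have "E = (\<Sum>\<^sub>\<infinity>n\<in>{..L} \<union> {Suc L..}. d n)"
        unfolding E_def by (rule infsum_cong_neutral) auto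
      also have "\<dots> = (\<Sum>n\<le>L. d n) + (\<Sum>\<^sub>\<infinity>n\<in>{Suc L..}. d n)"
        by (subst infsum_Un_disjoint) (auto intro: summable_on_subset[OF abs_summable_summable[OF ds]])
      finally have "norm (E - (\<Sum>n\<le>L. d n)) = norm (\<Sum>\<^sub>\<infinity>n\<in>{Suc L..}. d n)" by simp
      also have "\<dots> \<le> (\<Sum>\<^sub>\<infinity>n\<in>{Suc L..}. norm (d n))"
        by (rule norm_infsum_bound) (rule summable_on_subset[OF ds], auto)
      also have "\<dots> \<le> (\<Sum>\<^sub>\<infinity>n\<in>{Suc L..}. D * real n powr (- (p + 1)))"
      proof (rule infsum_mono)
        show "(\<lambda>n. norm (d n)) summable_on {Suc L..}" by (rule summable_on_subset[OF ds]) auto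
        show "(\<lambda>n. D * real n powr (- (p + 1))) summable_on {Suc L..}"
          using p by (intro summable_on_cmult_right summable_on_subset[OF summable_on_powr_nat]) auto
        fix n assume "n \<in> {Suc L..}"
        then have "real (Suc n) powr (- (p + 1)) \<le> real n powr (- (p + 1))" using p by (intro powr_mono2') auto
        then show "norm (d n) \<le> D * real n powr (- (p + 1))"
          using d[of n] DA by (meson mult_left_mono order_trans)
      qed
      also have "\<dots> = D * (\<Sum>\<^sub>\<infinity>n\<in>{Suc L..}. real n powr (- (p + 1)))" by (rule infsum_cmult_right')
      also have "\<dots> \<le> D * (real (Suc L) powr (- (p + 1)) + real (Suc L) powr (1 - (p + 1)) / (p + 1 - 1))"
        using p DA by (intro mult_left_mono powr_tail_bound) auto
      also have "\<dots> \<le> D * (real (Suc L) powr (- p) + real (Suc L) powr (- p) / p)"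
        using p DA by (intro mult_left_mono add_mono powr_mono) auto
      also have "\<dots> = D * ((1 + 1 / p) * real (Suc L) powr (- p))" by (simp add: algebra_simps)
      also have "\<dots> \<le> D * ((1 + 1 / p) * (4 * K powr (- p)))"
        using p DA Lk K by (intro mult_left_mono half_powr_le) auto
      finally show ?thesis by (simp only: mult_ac)
    qed
    have p1: "norm (\<Sum>n\<le>L. d n * (a (k - n) - a k)) \<le> 4 * D * A / (1 - p) * K powr (- (p + t))"
    proof -
      have diff: "norm (a (k - n) - a k) \<le> real n * (A * (4 * K powr (- (t + 1))))" if n: "n \<le> L" for n
      proof -
        have nk: "n \<le> k" using n Lk by simp
        \<comment> \<open>The path from k - n to k is walked in single steps, each at an index of
          order k because n <= k/2.\<close>
        have "norm (a (k - n + j) - a (k - n)) \<le> real j * (A * (4 * K powr (- (t + 1))))" for j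
        proof (induction j)
          case (Suc j)
          have "norm (a (k - n + Suc j) - a (k - n)) \<le> norm (a (Suc (k - n + j)) - a (k - n + j)) + norm (a (k - n + j) - a (k - n))"
            using norm_triangle_ineq[of "a (Suc (k - n + j)) - a (k - n + j)" "a (k - n + j) - a (k - n)"] by simp
          also have "norm (a (Suc (k - n + j)) - a (k - n + j)) \<le> A * real (Suc (k - n + j)) powr (- (t + 1))" by (rule a')
          also have "\<dots> \<le> A * (4 * K powr (- (t + 1)))"
            using n nk Lk DA t K by (intro mult_left_mono half_powr_le) (auto simp: K_def of_nat_diff)
          finally show ?case using Suc.IH by (simp add: algebra_simps)
        qed simp
        from this[of n] nk show ?thesis by (simp add: norm_minus_commute)
      qed
      have "norm (\<Sum>n\<le>L. d n * (a (k - n) - a k)) \<le> (\<Sum>n\<le>L. norm (d n * (a (k - n) - a k)))" by (rule norm_sum)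
      also have "\<dots> \<le> (\<Sum>n\<le>L. 4 * D * A * K powr (- (t + 1)) * real (Suc n) powr (- p))"
      proof (rule sum_mono)
        fix n assume n: "n \<in> {..L}"
        have "norm (d n * (a (k - n) - a k)) \<le> (D * real (Suc n) powr (- (p + 1))) * (real (Suc n) * (A * (4 * K powr (- (t + 1)))))"
          unfolding norm_mult
        proof (intro mult_mono d)
          have "norm (a (k - n) - a k) \<le> real n * (A * (4 * K powr (- (t + 1))))" using n by (intro diff) auto
          also have "\<dots> \<le> real (Suc n) * (A * (4 * K powr (- (t + 1))))" using DA by (intro mult_right_mono) auto
          finally show "norm (a (k - n) - a k) \<le> real (Suc n) * (A * (4 * K powr (- (t + 1))))" .
        qed (use DA in auto)
        also have "\<dots> = 4 * D * A * K powr (- (t + 1)) * (real (Suc n) powr (- (p + 1)) * real (Suc n) powr 1)" by simp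
        also have "real (Suc n) powr (- (p + 1)) * real (Suc n) powr 1 = real (Suc n) powr (- p)"
          unfolding powr_add[symmetric] by simp
        finally show "norm (d n * (a (k - n) - a k)) \<le> 4 * D * A * K powr (- (t + 1)) * real (Suc n) powr (- p)" .
      qed
      also have "\<dots> \<le> (\<Sum>n<Suc k. 4 * D * A * K powr (- (t + 1)) * real (Suc n) powr (- p))"
        using Lk DA by (intro sum_mono2) auto
      also have "\<dots> \<le> 4 * D * A * K powr (- (t + 1)) * (K powr (1 - p) / (1 - p))"
        unfolding sum_distrib_left[symmetric] K_def using DA p
        by (intro mult_left_mono sum_powr_le) auto
      also have "\<dots> = 4 * D * A / (1 - p) * (K powr (- (t + 1)) * K powr (1 - p))" by simp
      also have "K powr (- (t + 1)) * K powr (1 - p) = K powr (- (p + t))" unfolding powr_add[symmetric] by (rule arg_cong[of _ _ "\<lambda>e. K powr e"]) simp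
      finally show ?thesis .
    qed
    have p2: "norm (\<Sum>n=Suc L..k. d n * a (k - n)) \<le> 4 * D * A / (1 - t) * K powr (- (p + t))"
    proof -
      have "norm (\<Sum>n=Suc L..k. d n * a (k - n)) \<le> (\<Sum>n=Suc L..k. norm (d n * a (k - n)))" by (rule norm_sum)
      also have "\<dots> \<le> (\<Sum>n=Suc L..k. (D * (4 * K powr (- (p + 1)))) * (A * real (Suc (k - n)) powr (- t)))"
      proof (rule sum_mono)
        fix n assume n: "n \<in> {Suc L..k}"
        have "norm (d n) \<le> D * real (Suc n) powr (- (p + 1))" by (rule d)
        also have "\<dots> \<le> D * (4 * K powr (- (p + 1)))"
          using n Lk DA p K by (intro mult_left_mono half_powr_le) auto
        finally show "norm (d n * a (k - n)) \<le> (D * (4 * K powr (- (p + 1)))) * (A * real (Suc (k - n)) powr (- t))"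
          unfolding norm_mult using a DA by (intro mult_mono) auto
      qed
      also have "\<dots> \<le> (\<Sum>n\<le>k. (D * (4 * K powr (- (p + 1)))) * (A * real (Suc (k - n)) powr (- t)))"
        using DA by (intro sum_mono2) auto
      also have "\<dots> = (\<Sum>n\<le>k. (D * (4 * K powr (- (p + 1)))) * (A * real (Suc n) powr (- t)))"
        by (rule sum.reindex_bij_witness[of _ "\<lambda>n. k - n" "\<lambda>n. k - n"]) auto
      also have "\<dots> = 4 * D * A * K powr (- (p + 1)) * (\<Sum>n<Suc k. real (Suc n) powr (- t))"
        unfolding lessThan_Suc_atMost sum_distrib_left by (intro sum.cong) auto
      also have "\<dots> \<le> 4 * D * A * K powr (- (p + 1)) * (K powr (1 - t) / (1 - t))"
        unfolding K_def using DA t by (intro mult_left_mono sum_powr_le) auto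
      also have "\<dots> = 4 * D * A / (1 - t) * (K powr (- (p + 1)) * K powr (1 - t))" by simp
      also have "K powr (- (p + 1)) * K powr (1 - t) = K powr (- (p + t))" unfolding powr_add[symmetric] by (rule arg_cong[of _ _ "\<lambda>e. K powr e"]) simp
      finally show ?thesis .
    qed
    have p3: "norm ((E - (\<Sum>n\<le>L. d n)) * a k) \<le> 4 * D * A * (1 + 1 / p) * K powr (- (p + t))"
    proof -
      have "norm ((E - (\<Sum>n\<le>L. d n)) * a k) \<le> (D * (4 * (1 + 1 / p) * K powr (- p))) * (A * K powr (- t))"
        unfolding norm_mult using tail a[of k] DA p by (intro mult_mono) (auto simp: K_def)
      also have "\<dots> = 4 * D * A * (1 + 1 / p) * (K powr (- p) * K powr (- t))" by simp
      also have "K powr (- p) * K powr (- t) = K powr (- (p + t))" unfolding powr_add[symmetric] by (rule arg_cong[of _ _ "\<lambda>e. K powr e"]) simp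
      finally show ?thesis .
    qed
    have split: "{..k} = {..L} \<union> {Suc L..k}" "{..L} \<inter> {Suc L..k} = {}" using Lk by auto
    have "(\<Sum>n\<le>k. d n * a (k - n)) = (\<Sum>n\<le>L. d n * a (k - n)) + (\<Sum>n=Suc L..k. d n * a (k - n))"
      unfolding split(1) by (rule sum.union_disjoint) (use split(2) in auto)
    also have "(\<Sum>n\<le>L. d n * a (k - n)) = (\<Sum>n\<le>L. d n * (a (k - n) - a k)) + (\<Sum>n\<le>L. d n) * a k"
      by (simp add: right_diff_distrib sum_subtractf sum_distrib_right)
    finally have "(\<Sum>n\<le>k. d n * a (k - n)) - E * a k =
       (\<Sum>n\<le>L. d n * (a (k - n) - a k)) + (\<Sum>n=Suc L..k. d n * a (k - n)) - (E - (\<Sum>n\<le>L. d n)) * a k"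
      by (simp add: algebra_simps)
    also have "norm \<dots> \<le> norm (\<Sum>n\<le>L. d n * (a (k - n) - a k)) + norm (\<Sum>n=Suc L..k. d n * a (k - n)) + norm ((E - (\<Sum>n\<le>L. d n)) * a k)"
      by (intro order_trans[OF norm_triangle_ineq4] add_right_mono norm_triangle_ineq)
    also have "\<dots> \<le> C * K powr (- (p + t))"
      using p1 p2 p3 by (simp add: C_def distrib_right)
    finally show ?thesis by (simp add: K_def)
  qed
  show ?thesis by (rule that[OF _ main]) (use DA p t in \<open>auto simp: C_def\<close>)
qed

lemma Suc_powr_ge:
  assumes "n \<ge> 1" "0 \<le> e" "e \<le> 2"
  shows "real n powr (- e) \<le> 4 * real (Suc n) powr (- e)"
  by (rule half_powr_le) (use assms in auto)

text \<open>Splits the powers into an exactly convolvable sequence and an absolutely summable error,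
  with the bounds that \<open>conv_asymp\<close> asks for. They are stated in \<open>Suc n\<close>
  so that n = 0 is included.\<close>

lemma powr_decompose:
  assumes s: "0 < Re s" "Re s < 1"
  obtains r e C A where "r \<noteq> 0" "C \<ge> 0" "A \<ge> 0"
    "\<And>n. of_nat n powr (- s) = binseq s n / r + e n"
    "\<And>n. norm (e n) \<le> C * real (Suc n) powr (- (Re s + 1))"
    "\<And>n. norm (binseq s n) \<le> A * real (Suc n) powr (- Re s)"
    "\<And>n. norm (binseq s (Suc n) - binseq s n) \<le> A * real (Suc n) powr (- (Re s + 1))"
proof -
  obtain r K where r: "r \<noteq> 0" "K \<ge> 0" "\<And>n. n \<ge> 1 \<Longrightarrow> norm (binseq s n - r * of_nat n powr (- s)) \<le> K * real n powr (- Re s - 1)"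
    using binseq_asymp[OF s(2)] by blast
  define e where "e = (\<lambda>n. of_nat n powr (- s) - binseq s n / r)"
  \<comment> \<open>The summand 1 / norm r is for n = 0, where \<open>0 powr (- s)\<close> is 0 but
    \<open>binseq s 0\<close> is 1.\<close>
  define C where "C = 4 * K / norm r + 1 / norm r"
  have C0: "C \<ge> 0" using r by (simp add: C_def)
  have eb: "norm (e n) \<le> C * real (Suc n) powr (- (Re s + 1))" for n
  proof (cases "n = 0")
    case True
    then show ?thesis using r by (simp add: e_def binseq_def C_def norm_divide)
  next
    case False
    then have n: "n \<ge> 1" by simp
    have "e n = - (binseq s n - r * of_nat n powr (- s)) / r" using r by (simp add: e_def field_simps)
    then have "norm (e n) = norm (binseq s n - r * of_nat n powr (- s)) / norm r" by (simp add: norm_divide norm_minus_commute)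
    also have "\<dots> \<le> K * real n powr (- (Re s + 1)) / norm r" using r(3)[OF n] by (intro divide_right_mono) auto
    also have "\<dots> \<le> K * (4 * real (Suc n) powr (- (Re s + 1))) / norm r"
      using n s r(2) by (intro divide_right_mono mult_left_mono Suc_powr_ge) auto
    also have "\<dots> = 4 * K / norm r * real (Suc n) powr (- (Re s + 1))" by simp
    also have "\<dots> \<le> C * real (Suc n) powr (- (Re s + 1))" using r by (intro mult_right_mono) (auto simp: C_def)
    finally show ?thesis .
  qed
  define A0 where "A0 = 4 * (norm r + K) + 1"
  have A0: "A0 \<ge> 0" using r by (simp add: A0_def)
  have bb: "norm (binseq s n) \<le> A0 * real (Suc n) powr (- Re s)" for n
  proof (cases "n = 0")
    case True
    then show ?thesis using r by (simp add: binseq_def A0_def)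
  next
    case False
    then have n: "n \<ge> 1" by simp
    have "norm (binseq s n) \<le> norm (binseq s n - r * of_nat n powr (- s)) + norm (r * of_nat n powr (- s))"
      using norm_triangle_ineq[of "binseq s n - r * of_nat n powr (- s)" "r * of_nat n powr (- s)"] by simp
    also have "\<dots> \<le> K * real n powr (- Re s - 1) + norm r * real n powr (- Re s)"
      using r(3)[OF n] norm_nat_powr[OF n, of "- s"] by (simp add: norm_mult)
    also have "\<dots> \<le> K * real n powr (- Re s) + norm r * real n powr (- Re s)"
      using n r by (intro add_right_mono mult_left_mono powr_mono) auto
    also have "\<dots> = (norm r + K) * real n powr (- Re s)" by (simp add: algebra_simps)
    also have "\<dots> \<le> (norm r + K) * (4 * real (Suc n) powr (- Re s))"
      using n s r by (intro mult_left_mono Suc_powr_ge) auto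
    also have "\<dots> \<le> A0 * real (Suc n) powr (- Re s)" by (simp add: A0_def algebra_simps)
    finally show ?thesis .
  qed
  define A where "A = A0 * (1 + norm s)"
  have A: "A \<ge> 0" "A0 \<le> A" using A0 by (auto simp: A_def algebra_simps)
  have bd: "norm (binseq s (Suc n) - binseq s n) \<le> A * real (Suc n) powr (- (Re s + 1))" for n
  proof -
    have "binseq s (Suc n) - binseq s n = - s * binseq s n / of_nat (Suc n)"
      unfolding binseq_Suc by (simp add: field_simps del: of_nat_Suc)
    then have "norm (binseq s (Suc n) - binseq s n) = norm s * norm (binseq s n) / real (Suc n)"
      by (simp add: norm_mult norm_divide del: of_nat_Suc)
    also have "\<dots> \<le> norm s * (A0 * real (Suc n) powr (- Re s)) / real (Suc n)"
      by (intro divide_right_mono mult_left_mono bb) auto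
    also have "\<dots> = norm s * A0 * real (Suc n) powr (- (Re s + 1))"
      by (simp add: powr_diff powr_add powr_minus field_simps)
    also have "\<dots> \<le> A * real (Suc n) powr (- (Re s + 1))"
      using A0 by (intro mult_right_mono) (auto simp: A_def algebra_simps)
    finally show ?thesis .
  qed
  have bA: "norm (binseq s n) \<le> A * real (Suc n) powr (- Re s)" for n
    by (rule order_trans[OF bb mult_right_mono]) (use A in auto)
  show ?thesis
    by (rule that[OF r(1) C0 A(1) _ eb bA bd]) (simp add: e_def)
qed

section \<open>Expansion of the Dirichlet coefficients\<close>

definition conv_coeff :: "complex \<Rightarrow> complex \<Rightarrow> nat \<Rightarrow> complex" where
  "conv_coeff s1 s2 k = (\<Sum>m = 1..k - 1. 1 / (of_nat m powr s1 * of_nat (k - m) powr s2))"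

text \<open>Since 0 powr z is 0, the endpoints m = 0 and m = k contribute nothing; the full range is
  the one in \<open>binseq_conv\<close> and \<open>conv_asymp\<close>.\<close>

lemma conv_coeff_alt:
  assumes "k \<ge> 1"
  shows "conv_coeff s1 s2 k = (\<Sum>m\<le>k. of_nat m powr (- s1) * of_nat (k - m) powr (- s2))"
proof -
  have "conv_coeff s1 s2 k = (\<Sum>m=1..k-1. of_nat m powr (- s1) * of_nat (k - m) powr (- s2))"
    unfolding conv_coeff_def by (intro sum.cong) (auto simp: powr_minus divide_simps)
  also have "\<dots> = (\<Sum>m\<le>k. of_nat m powr (- s1) * of_nat (k - m) powr (- s2))"
  proof (rule sum.mono_neutral_left)
    show "\<forall>i\<in>{..k} - {1..k - 1}. of_nat i powr (- s1) * of_nat (k - i) powr (- s2) = (0::complex)"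
    proof
      fix i assume "i \<in> {..k} - {1..k - 1}"
      then have "i = 0 \<or> i = k" by auto
      then show "of_nat i powr (- s1) * of_nat (k - i) powr (- s2) = (0::complex)" by auto
    qed
  qed auto
  finally show ?thesis .
qed

text \<open>Both factors are split by \<open>powr_decompose\<close>. The product of the main parts
  is summed exactly and yields k^(1-s1-s2). By \<open>conv_asymp\<close> each mixed product yields a
  multiple of k^(-s1) or k^(-s2), and the product of the two errors is no larger than the error
  term.\<close>

lemma conv_coeff_expansion:
  assumes s1: "0 < Re s1" "Re s1 < 1" and s2: "0 < Re s2" "Re s2 < 1"
  obtains c0 c1 c2 C where "C \<ge> 0"
    "\<And>k. k \<ge> 1 \<Longrightarrow> norm (conv_coeff s1 s2 k - (c0 * of_nat k powr (- (s1 + s2 - 1)) + c1 * of_nat k powr (- s1) + c2 * of_nat k powr (- s2)))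
        \<le> C * real k powr (- (Re s1 + Re s2))"
proof -
  obtain r1 e1 C1 A1 where 1: "r1 \<noteq> 0" "C1 \<ge> 0" "A1 \<ge> 0"
    "\<And>n. of_nat n powr (- s1) = binseq s1 n / r1 + e1 n"
    "\<And>n. norm (e1 n) \<le> C1 * real (Suc n) powr (- (Re s1 + 1))"
    "\<And>n. norm (binseq s1 n) \<le> A1 * real (Suc n) powr (- Re s1)"
    "\<And>n. norm (binseq s1 (Suc n) - binseq s1 n) \<le> A1 * real (Suc n) powr (- (Re s1 + 1))"
    by (rule powr_decompose[OF s1]) (rule that; assumption)
  obtain r2 e2 C2 A2 where 2: "r2 \<noteq> 0" "C2 \<ge> 0" "A2 \<ge> 0"
    "\<And>n. of_nat n powr (- s2) = binseq s2 n / r2 + e2 n"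
    "\<And>n. norm (e2 n) \<le> C2 * real (Suc n) powr (- (Re s2 + 1))"
    "\<And>n. norm (binseq s2 n) \<le> A2 * real (Suc n) powr (- Re s2)"
    "\<And>n. norm (binseq s2 (Suc n) - binseq s2 n) \<le> A2 * real (Suc n) powr (- (Re s2 + 1))"
    by (rule powr_decompose[OF s2]) (rule that; assumption)
  obtain D21 E21 where X21: "D21 \<ge> 0" "\<And>k. norm ((\<Sum>n\<le>k. e2 n * binseq s1 (k - n)) - E21 * binseq s1 k) \<le> D21 * real (Suc k) powr (- (Re s2 + Re s1))"
    by (rule conv_asymp[OF s2 s1 2(2) 1(3) 2(5) 1(6) 1(7)]) (rule that; assumption)
  obtain D12 E12 where X12: "D12 \<ge> 0" "\<And>k. norm ((\<Sum>n\<le>k. e1 n * binseq s2 (k - n)) - E12 * binseq s2 k) \<le> D12 * real (Suc k) powr (- (Re s1 + Re s2))"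
    by (rule conv_asymp[OF s1 s2 1(2) 2(3) 1(5) 2(6) 2(7)]) (rule that; assumption)
  \<comment> \<open>In the convolution of the two errors \<open>e2\<close> takes the role of the
    slowly varying sequence. Its own size bounds its differences, at the price of a factor
    2.\<close>
  have e2d: "norm (e2 (Suc n) - e2 n) \<le> 2 * C2 * real (Suc n) powr (- (Re s2 + 1))" for n
  proof -
    have "real (Suc (Suc n)) powr (- (Re s2 + 1)) \<le> real (Suc n) powr (- (Re s2 + 1))" using s2 by (intro powr_mono2') auto
    then have "norm (e2 (Suc n)) \<le> C2 * real (Suc n) powr (- (Re s2 + 1))"
      using 2(5)[of "Suc n"] 2(2) by (meson mult_left_mono order_trans)
    then show ?thesis using 2(5)[of n] norm_triangle_ineq4[of "e2 (Suc n)" "e2 n"] by linarith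
  qed
  have e2b: "norm (e2 n) \<le> 2 * C2 * real (Suc n) powr (- Re s2)" for n
  proof -
    have "real (Suc n) powr (- (Re s2 + 1)) \<le> real (Suc n) powr (- Re s2)" by (intro powr_mono) auto
    then have "C2 * real (Suc n) powr (- (Re s2 + 1)) \<le> 2 * C2 * real (Suc n) powr (- Re s2)"
      using 2(2) by (intro mult_mono) auto
    then show ?thesis using 2(5)[of n] by linarith
  qed
  obtain DE EE where XE: "DE \<ge> 0" "\<And>k. norm ((\<Sum>n\<le>k. e1 n * e2 (k - n)) - EE * e2 k) \<le> DE * real (Suc k) powr (- (Re s1 + Re s2))"
    by (rule conv_asymp[OF s1 s2 1(2) mult_nonneg_nonneg[OF _ 2(2), of 2] 1(5) e2b e2d], simp) (rule that; assumption)
  have re12: "Re (s1 + s2 - 1) < 1" using s1 s2 by simp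
  obtain r K where rK: "r \<noteq> 0" "K \<ge> 0" "\<And>n. n \<ge> 1 \<Longrightarrow> norm (binseq (s1 + s2 - 1) n - r * of_nat n powr (- (s1 + s2 - 1))) \<le> K * real n powr (- Re (s1 + s2 - 1) - 1)"
    by (rule binseq_asymp[OF re12]) (rule that; assumption)
  define c0 where "c0 = r / (r1 * r2)"
  define C where "C = K / norm (r1 * r2) + D21 / norm r1 + norm E21 * C1 + D12 / norm r2 + norm E12 * C2 + DE + norm EE * C2"
  show ?thesis
  proof (rule that[of C c0 E21 E12])
    show "C \<ge> 0" using rK 1 2 X21 X12 XE by (auto simp: C_def intro!: add_nonneg_nonneg)
    fix k :: nat assume k: "k \<ge> 1"
    define P where "P = real k powr (- (Re s1 + Re s2))"
    have P: "real (Suc k) powr (- (Re s1 + Re s2)) \<le> P" "real (Suc k) powr (- (Re s2 + Re s1)) \<le> P"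
      unfolding P_def using k s1 s2 by (auto simp: add.commute[of "Re s2"] intro!: powr_mono2')
    have P1: "real (Suc k) powr (- (Re s1 + 1)) \<le> P" "real (Suc k) powr (- (Re s2 + 1)) \<le> P"
    proof -
      have "real (Suc k) powr (- (Re s1 + 1)) \<le> real k powr (- (Re s1 + 1))" "real (Suc k) powr (- (Re s2 + 1)) \<le> real k powr (- (Re s2 + 1))"
        using k s1 s2 by (auto intro!: powr_mono2')
      moreover have "real k powr (- (Re s1 + 1)) \<le> P" "real k powr (- (Re s2 + 1)) \<le> P"
        unfolding P_def using k s1 s2 by (auto intro!: powr_mono)
      ultimately show "real (Suc k) powr (- (Re s1 + 1)) \<le> P" "real (Suc k) powr (- (Re s2 + 1)) \<le> P" by auto
    qed
    have rev: "(\<Sum>m\<le>k. binseq s1 m * e2 (k - m)) = (\<Sum>n\<le>k. e2 n * binseq s1 (k - n))"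
      by (rule sum.reindex_bij_witness[of _ "\<lambda>n. k - n" "\<lambda>n. k - n"]) auto
    have "conv_coeff s1 s2 k = (\<Sum>m\<le>k. (binseq s1 m / r1 + e1 m) * (binseq s2 (k - m) / r2 + e2 (k - m)))"
      unfolding conv_coeff_alt[OF k] 1(4) 2(4) ..
    also have "\<dots> = (\<Sum>m\<le>k. binseq s1 m * binseq s2 (k - m)) / (r1 * r2) + (\<Sum>m\<le>k. binseq s1 m * e2 (k - m)) / r1
        + (\<Sum>m\<le>k. e1 m * binseq s2 (k - m)) / r2 + (\<Sum>m\<le>k. e1 m * e2 (k - m))"
      by (simp add: sum_divide_distrib sum.distrib[symmetric] algebra_simps add_divide_distrib)
    also have "\<dots> = binseq (s1 + s2 - 1) k / (r1 * r2) + (\<Sum>n\<le>k. e2 n * binseq s1 (k - n)) / r1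
        + (\<Sum>m\<le>k. e1 m * binseq s2 (k - m)) / r2 + (\<Sum>m\<le>k. e1 m * e2 (k - m))"
      unfolding binseq_conv rev ..
    finally have conv_coeff: "conv_coeff s1 s2 k = binseq (s1 + s2 - 1) k / (r1 * r2) + (\<Sum>n\<le>k. e2 n * binseq s1 (k - n)) / r1
        + (\<Sum>m\<le>k. e1 m * binseq s2 (k - m)) / r2 + (\<Sum>m\<le>k. e1 m * e2 (k - m))" .
    define x1 where "x1 = (binseq (s1 + s2 - 1) k - r * of_nat k powr (- (s1 + s2 - 1))) / (r1 * r2)"
    define x2 where "x2 = ((\<Sum>n\<le>k. e2 n * binseq s1 (k - n)) - E21 * binseq s1 k) / r1"
    define x3 where "x3 = ((\<Sum>m\<le>k. e1 m * binseq s2 (k - m)) - E12 * binseq s2 k) / r2"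
    define x4 where "x4 = (\<Sum>m\<le>k. e1 m * e2 (k - m)) - EE * e2 k"
    \<comment> \<open>The way back from \<open>binseq\<close> to powers: r1 and r2 cancel, so the
      coefficients of k^(-s1) and k^(-s2) are just \<open>E21\<close> and
      \<open>E12\<close>.\<close>
    have b1: "binseq s1 k / r1 = of_nat k powr (- s1) - e1 k" and b2: "binseq s2 k / r2 = of_nat k powr (- s2) - e2 k"
      using 1(4)[of k] 2(4)[of k] by auto
    have E: "conv_coeff s1 s2 k - (c0 * of_nat k powr (- (s1 + s2 - 1)) + E21 * of_nat k powr (- s1) + E12 * of_nat k powr (- s2))
        = x1 + (x2 - E21 * e1 k) + (x3 - E12 * e2 k) + (x4 + EE * e2 k)"
      unfolding conv_coeff x1_def x2_def x3_def x4_def diff_divide_distrib times_divide_eq_right[symmetric] b1 b2 c0_def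
      by (simp add: algebra_simps)
    have n1: "norm x1 \<le> K / norm (r1 * r2) * P"
    proof -
      have "norm x1 \<le> (K * real k powr (- Re (s1 + s2 - 1) - 1)) / norm (r1 * r2)"
        unfolding x1_def norm_divide by (intro divide_right_mono rK k) auto
      then show ?thesis by (simp add: P_def)
    qed
    have n2: "norm (x2 - E21 * e1 k) \<le> (D21 / norm r1 + norm E21 * C1) * P"
    proof -
      have "norm x2 \<le> (D21 * real (Suc k) powr (- (Re s2 + Re s1))) / norm r1"
        unfolding x2_def norm_divide by (intro divide_right_mono X21) auto
      also have "\<dots> \<le> (D21 * P) / norm r1" using P X21 by (intro divide_right_mono mult_left_mono) auto
      finally have a: "norm x2 \<le> D21 / norm r1 * P" by simp
      have "norm (E21 * e1 k) \<le> norm E21 * (C1 * P)"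
        unfolding norm_mult using 1(5)[of k] P1 1(2) by (intro mult_left_mono) (auto intro: order_trans[OF _ mult_left_mono])
      with a norm_triangle_ineq4[of x2 "E21 * e1 k"] show ?thesis by (simp add: algebra_simps)
    qed
    have n3: "norm (x3 - E12 * e2 k) \<le> (D12 / norm r2 + norm E12 * C2) * P"
    proof -
      have "norm x3 \<le> (D12 * real (Suc k) powr (- (Re s1 + Re s2))) / norm r2"
        unfolding x3_def norm_divide by (intro divide_right_mono X12) auto
      also have "\<dots> \<le> (D12 * P) / norm r2" using P X12 by (intro divide_right_mono mult_left_mono) auto
      finally have a: "norm x3 \<le> D12 / norm r2 * P" by simp
      have "norm (E12 * e2 k) \<le> norm E12 * (C2 * P)"
        unfolding norm_mult using 2(5)[of k] P1 2(2) by (intro mult_left_mono) (auto intro: order_trans[OF _ mult_left_mono])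
      with a norm_triangle_ineq4[of x3 "E12 * e2 k"] show ?thesis by (simp add: algebra_simps)
    qed
    have n4: "norm (x4 + EE * e2 k) \<le> (DE + norm EE * C2) * P"
    proof -
      have "norm x4 \<le> DE * real (Suc k) powr (- (Re s1 + Re s2))"
        unfolding x4_def by (rule XE)
      also have "\<dots> \<le> DE * P" using P XE by (intro mult_left_mono) auto
      finally have a: "norm x4 \<le> DE * P" .
      have "norm (EE * e2 k) \<le> norm EE * (C2 * P)"
        unfolding norm_mult using 2(5)[of k] P1 2(2) by (intro mult_left_mono) (auto intro: order_trans[OF _ mult_left_mono])
      with a norm_triangle_ineq[of x4 "EE * e2 k"] show ?thesis by (simp add: algebra_simps)
    qed
    have "norm (conv_coeff s1 s2 k - (c0 * of_nat k powr (- (s1 + s2 - 1)) + E21 * of_nat k powr (- s1) + E12 * of_nat k powr (- s2)))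
        \<le> K / norm (r1 * r2) * P + (D21 / norm r1 + norm E21 * C1) * P + (D12 / norm r2 + norm E12 * C2) * P + (DE + norm EE * C2) * P"
      unfolding E by (rule norm_triangle_mono[OF norm_triangle_mono[OF norm_triangle_mono[OF n1 n2] n3] n4])
    then show "norm (conv_coeff s1 s2 k - (c0 * of_nat k powr (- (s1 + s2 - 1)) + E21 * of_nat k powr (- s1) + E12 * of_nat k powr (- s2)))
        \<le> C * real k powr (- (Re s1 + Re s2))"
      unfolding P_def[symmetric] by (simp add: C_def algebra_simps)
  qed
qed

section \<open>Approximation by Dirichlet polynomials\<close>

text \<open>Collects the pairs with m + n = k; the inner sum for k = 1 is empty.\<close>

lemma MT_series_dirichlet:
  assumes "(s1,s2,z) \<in> MT2_conv_region"
  shows "((\<lambda>k. conv_coeff s1 s2 k * of_nat k powr (- z)) has_sum MT_series (s1,s2,z)) {1..}"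
proof -
  define f where "f = (\<lambda>(m::nat,n::nat). 1 / (of_nat m powr s1 * of_nat n powr s2 * of_nat (m + n) powr z :: complex))"
  define g where "g = (\<lambda>(k::nat) (m::nat). 1 / (of_nat m powr s1 * of_nat (k - m) powr s2 :: complex) * of_nat k powr (- z))"
  have "(f has_sum MT_series (s1,s2,z)) {(m,n). m \<ge> 1 \<and> n \<ge> 1}"
    unfolding f_def by (rule MT_series_has_sum(1)[OF assms])
  also have "?this \<longleftrightarrow> ((\<lambda>(k,m). g k m) has_sum MT_series (s1,s2,z)) (Sigma {1..} (\<lambda>k. {1..k - 1}))"
    by (rule has_sum_reindex_bij_witness[of _ "\<lambda>(k,m). (m, k - m)" "\<lambda>(m,n). (m + n, m)"])
       (auto simp: f_def g_def powr_minus divide_simps)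
  finally have S: "((\<lambda>(k,m). g k m) has_sum MT_series (s1,s2,z)) (Sigma {1..} (\<lambda>k. {1..k - 1}))" .
  have inner: "(\<Sum>\<^sub>\<infinity>m\<in>{1..k - 1}. g k m) = conv_coeff s1 s2 k * of_nat k powr (- z)" for k
    unfolding g_def conv_coeff_def sum_distrib_right by (rule infsum_finite) simp
  have "(\<lambda>k. conv_coeff s1 s2 k * of_nat k powr (- z)) summable_on {1..}"
    using summable_on_Sigma_banach[OF has_sum_imp_summable[OF S]] unfolding inner .
  moreover have "(\<Sum>\<^sub>\<infinity>k\<in>{1..}. conv_coeff s1 s2 k * of_nat k powr (- z)) = MT_series (s1,s2,z)"
    using infsum_Sigma'_banach[OF has_sum_imp_summable[OF S]] infsumI[OF S] unfolding inner by simp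
  ultimately show ?thesis by (metis has_sum_infsum)
qed

lemma finite_dirichlet_holomorphic:
  assumes "\<And>k. k \<in> I \<Longrightarrow> k \<ge> (1::nat)"
  shows "(\<lambda>z. \<Sum>k\<in>I. a k * of_nat k powr (- z)) holomorphic_on S"
  using assms by (intro holomorphic_intros) force

lemma tail_dirichlet:
  assumes b: "\<And>k. k \<ge> 1 \<Longrightarrow> norm (b k) \<le> C * real k powr (- x)" and x: "x > 1" and C: "C \<ge> 0" and q: "q \<ge> 1"
  shows "(\<lambda>z. \<Sum>\<^sub>\<infinity>k\<in>{q..}. b k * of_nat k powr (- z)) holomorphic_on {z. Re z > 0}"
    and "\<And>z. Re z \<ge> 0 \<Longrightarrow> (\<lambda>k. norm (b k * of_nat k powr (- z))) summable_on {q..}"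
    and "\<And>z. Re z \<ge> 0 \<Longrightarrow> norm (\<Sum>\<^sub>\<infinity>k\<in>{q..}. b k * of_nat k powr (- z)) \<le> C * (real q powr (- (x + Re z)) + real q powr (1 - (x + Re z)) / (x + Re z - 1))"
proof -
  have le: "norm (b k * of_nat k powr (- z)) \<le> C * real k powr (- (x + Re z))" if "k \<in> {q..}" for k z
  proof -
    have k: "k \<ge> 1" using that q by auto
    have "norm (b k * of_nat k powr (- z)) \<le> (C * real k powr (- x)) * real k powr (- Re z)"
      unfolding norm_mult using b[OF k] norm_nat_powr[OF k, of "- z"] by (simp add: mult_right_mono)
    also have "\<dots> = C * (real k powr (- x) * real k powr (- Re z))" by simp
    also have "real k powr (- x) * real k powr (- Re z) = real k powr (- (x + Re z))"
      unfolding powr_add[symmetric] by simp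
    finally show ?thesis .
  qed
  have sB: "(\<lambda>k. C * real k powr (- (x + r))) summable_on {q..}" if "r \<ge> 0" for r
    using x that by (intro summable_on_cmult_right summable_on_subset[OF summable_on_powr_nat]) auto
  show abs: "(\<lambda>k. norm (b k * of_nat k powr (- z))) summable_on {q..}" if "Re z \<ge> 0" for z
    by (rule summable_on_comparison_test[OF sB[OF that] le]) auto
  show "norm (\<Sum>\<^sub>\<infinity>k\<in>{q..}. b k * of_nat k powr (- z)) \<le> C * (real q powr (- (x + Re z)) + real q powr (1 - (x + Re z)) / (x + Re z - 1))" if z: "Re z \<ge> 0" for z
  proof -
    have "norm (\<Sum>\<^sub>\<infinity>k\<in>{q..}. b k * of_nat k powr (- z)) \<le> (\<Sum>\<^sub>\<infinity>k\<in>{q..}. norm (b k * of_nat k powr (- z)))"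
      by (rule norm_infsum_bound[OF abs[OF z]])
    also have "\<dots> \<le> (\<Sum>\<^sub>\<infinity>k\<in>{q..}. C * real k powr (- (x + Re z)))" by (rule infsum_mono[OF abs[OF z] sB[OF z] le])
    also have "\<dots> = C * (\<Sum>\<^sub>\<infinity>k\<in>{q..}. real k powr (- (x + Re z)))" by (rule infsum_cmult_right')
    also have "\<dots> \<le> C * (real q powr (- (x + Re z)) + real q powr (1 - (x + Re z)) / (x + Re z - 1))"
      using x z q C by (intro mult_left_mono powr_tail_bound) auto
    finally show ?thesis .
  qed
  show "(\<lambda>z. \<Sum>\<^sub>\<infinity>k\<in>{q..}. b k * of_nat k powr (- z)) holomorphic_on {z. Re z > 0}"
  proof (rule infsum_holomorphic_on[OF open_halfspace_Re_gt])
    fix k assume "k \<in> {q..}"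
    then have "k \<ge> 1" using q by auto
    then show "(\<lambda>z. b k * of_nat k powr (- z)) holomorphic_on {z. Re z > 0}" by (intro holomorphic_intros) auto
  next
    fix a :: complex assume "a \<in> {z. Re z > 0}"
    show "\<exists>e>0. \<exists>B. B summable_on {q..} \<and> (\<forall>i\<in>{q..}. \<forall>z\<in>ball a e \<inter> {z. Re z > 0}. norm (b i * of_nat i powr (- z)) \<le> B i)"
    proof (intro exI[of _ 1] conjI exI[of _ "\<lambda>k. C * real k powr (- (x + 0))"] sB ballI)
      fix i z assume i: "i \<in> {q..}" and z: "z \<in> ball a 1 \<inter> {z. Re z > 0}"
      have "norm (b i * of_nat i powr (- z)) \<le> C * real i powr (- (x + Re z))" by (rule le[OF i])
      also have "\<dots> \<le> C * real i powr (- (x + 0))" using z i q C by (intro mult_left_mono powr_mono) auto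
      finally show "norm (b i * of_nat i powr (- z)) \<le> C * real i powr (- (x + 0))" .
    qed auto
  qed
qed

lemma in_base_domain:
  assumes "Re s1 > 1/2" "Re s2 > 1/2" "Im s1 \<ge> 0" "Im s2 \<ge> 0" "Re z > 0" "Im z > 0"
  shows "(s1,s2,z) \<in> base_domain"
  using assms by (auto simp: base_domain_def upper_uvw_def halfspace_uvw_alt)

lemma zeta_MT2_slice_holomorphic:
  assumes s: "Re s1 > 1/2" "Re s2 > 1/2" "Im s1 \<ge> 0" "Im s2 \<ge> 0"
  shows "zeta_MT2 s1 s2 holomorphic_on {z. Re z > 0 \<and> Im z > 0}"
proof -
  obtain F where F: "holo3_on base_domain F" "\<And>q. q \<in> base_domain \<Longrightarrow> q \<in> MT2_conv_region \<Longrightarrow> F q = MT_series q"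
    "\<And>a b c. (a,b,c) \<in> base_domain \<Longrightarrow> zeta_MT2 a b c = F (a,b,c)"
    by (rule zeta_MT2_continuation) (rule that; assumption)
  have "open {z. Re z > 0 \<and> Im z > 0}"
    by (intro open_Collect_conj open_halfspace_Re_gt open_halfspace_Im_gt)
  then have "(\<lambda>z. F (s1,s2,z)) holomorphic_on {z. Re z > 0 \<and> Im z > 0}"
    by (rule holo3_on_slice(3)[OF F(1)]) (use s in_base_domain in auto)
  then show ?thesis
    by (rule holomorphic_transform) (use s in_base_domain F(3) in auto)
qed

lemma zeta_MT2_eq_MT_series:
  assumes s: "Re s1 > 1/2" "Re s2 > 1/2" "Im s1 \<ge> 0" "Im s2 \<ge> 0" and z: "Re z > 2" "Im z > 0"
  shows "zeta_MT2 s1 s2 z = MT_series (s1,s2,z)" "(s1,s2,z) \<in> MT2_conv_region"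
proof -
  obtain F where F: "holo3_on base_domain F" "\<And>q. q \<in> base_domain \<Longrightarrow> q \<in> MT2_conv_region \<Longrightarrow> F q = MT_series q"
    "\<And>a b c. (a,b,c) \<in> base_domain \<Longrightarrow> zeta_MT2 a b c = F (a,b,c)"
    by (rule zeta_MT2_continuation) (rule that; assumption)
  show c: "(s1,s2,z) \<in> MT2_conv_region" using s z by (auto simp: MT2_conv_region_def)
  have "(s1,s2,z) \<in> base_domain" using in_base_domain s z by auto
  then show "zeta_MT2 s1 s2 z = MT_series (s1,s2,z)" using F(2,3) c by auto
qed

text \<open>Both sides are holomorphic in z on the open first quadrant, which is connected and, as
  the shifts have nonnegative imaginary part, keeps the tails off their pole at 1. They agree for Re
  z > 2, where all the series converge absolutely.\<close>

lemma zeta_MT2_decomp: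
  assumes s: "Re s1 > 1/2" "Re s2 > 1/2" "Re s1 < 1" "Re s2 < 1" "Im s1 \<ge> 0" "Im s2 \<ge> 0"
    and z: "Re z > 0" "Im z > 0" and q: "q \<ge> 2" and C: "C \<ge> 0"
    and b: "\<And>k. k \<ge> 1 \<Longrightarrow> norm (conv_coeff s1 s2 k - (c0 * of_nat k powr (- (s1 + s2 - 1)) + c1 * of_nat k powr (- s1) + c2 * of_nat k powr (- s2)))
        \<le> C * real k powr (- (Re s1 + Re s2))"
  defines "B \<equiv> \<lambda>k. conv_coeff s1 s2 k - (c0 * of_nat k powr (- (s1 + s2 - 1)) + c1 * of_nat k powr (- s1) + c2 * of_nat k powr (- s2))"
  shows "zeta_MT2 s1 s2 z = (\<Sum>k=1..<q. conv_coeff s1 s2 k * of_nat k powr (- z)) + (c0 * zeta_tail_cont q (z + (s1 + s2 - 1))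
      + c1 * zeta_tail_cont q (z + s1) + c2 * zeta_tail_cont q (z + s2) + (\<Sum>\<^sub>\<infinity>k\<in>{q..}. B k * of_nat k powr (- z)))"
proof -
  define V where "V = {z. Re z > 0 \<and> Im z > 0}"
  define W where "W = {z. Re z > 2 \<and> Im z > 0}"
  define G where "G = (\<lambda>z. (\<Sum>k=1..<q. conv_coeff s1 s2 k * of_nat k powr (- z)) + (c0 * zeta_tail_cont q (z + (s1 + s2 - 1))
      + c1 * zeta_tail_cont q (z + s1) + c2 * zeta_tail_cont q (z + s2) + (\<Sum>\<^sub>\<infinity>k\<in>{q..}. B k * of_nat k powr (- z))))"
  have Vo: "open V" "open W" unfolding V_def W_def
    by (intro open_Collect_conj open_halfspace_Re_gt open_halfspace_Im_gt)+
  have q1: "q \<ge> 1" using q by simp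
  have x1: "Re s1 + Re s2 > 1" using s by simp
  have b': "norm (B k) \<le> C * real k powr (- (Re s1 + Re s2))" if "k \<ge> 1" for k unfolding B_def by (rule b[OF that])
  note T = tail_dirichlet[where b = B, OF b' x1 C q1]
  have Zh: "(\<lambda>z. zeta_tail_cont q (z + d)) holomorphic_on V" if "Re d \<ge> 0" "Im d \<ge> 0" for d
  proof -
    have "zeta_tail_cont q \<circ> (\<lambda>z. z + d) holomorphic_on V"
      by (rule holomorphic_on_compose_gen[OF _ zeta_tail_cont_holomorphic[OF q]])
         (use that in \<open>auto intro!: holomorphic_intros simp: V_def complex_eq_iff\<close>)
    then show ?thesis by (simp add: o_def)
  qed
  have Gh: "G holomorphic_on V"
    unfolding G_def
    by (intro holomorphic_on_add holomorphic_on_mult holomorphic_on_const Zh finite_dirichlet_holomorphic holomorphic_on_subset[OF T(1)])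
       (use s in \<open>auto simp: V_def\<close>)
  have "zeta_MT2 s1 s2 z = G z"
  proof (rule analytic_continuation_open[where g = G and f = "zeta_MT2 s1 s2" and s = W and s' = V])
    show "zeta_MT2 s1 s2 holomorphic_on V" unfolding V_def by (rule zeta_MT2_slice_holomorphic) (use s in auto)
    show "W \<noteq> {}" by (auto simp: W_def intro!: exI[of _ "Complex 3 1"])
    have "convex V" unfolding V_def Collect_conj_eq by (intro convex_Int convex_halfspace_Re_gt convex_halfspace_Im_gt)
    then show "connected V" by (rule convex_connected)
    fix w assume w: "w \<in> W"
    have wz: "Re w > 2" "Im w > 0" using w by (auto simp: W_def)
    note M = zeta_MT2_eq_MT_series[OF s(1,2,5,6) wz]
    have Zd: "((\<lambda>k. c * of_nat k powr (- d) * of_nat k powr (- w)) has_sum c * zeta_tail_cont q (w + d)) {q..}" if "Re d > -1" for c d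
    proof -
      have r: "Re (w + d) > 1" using that wz by simp
      have "((\<lambda>k. c * of_nat k powr (- (w + d))) has_sum c * zeta_tail q (w + d)) {q..}"
        unfolding zeta_tail_def by (rule has_sum_cmult_right[OF has_sum_infsum[OF abs_summable_summable[OF zeta_tail_summable[OF r]]]])
      also have "(\<lambda>k::nat. c * of_nat k powr (- (w + d))) = (\<lambda>k. c * of_nat k powr (- d) * of_nat k powr (- w))"
        by (auto simp: fun_eq_iff minus_add_distrib add.commute simp flip: powr_add)
      finally show ?thesis using zeta_tail_cont_eq_tail[OF r q] by simp
    qed
    have w0: "Re w \<ge> 0" using wz by simp
    have bs: "((\<lambda>k. B k * of_nat k powr (- w)) has_sum (\<Sum>\<^sub>\<infinity>k\<in>{q..}. B k * of_nat k powr (- w))) {q..}"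
      by (rule has_sum_infsum[OF abs_summable_summable[OF T(2)[OF _ w0]]])
    have "((\<lambda>k. c0 * of_nat k powr (- (s1 + s2 - 1)) * of_nat k powr (- w) + c1 * of_nat k powr (- s1) * of_nat k powr (- w)
        + c2 * of_nat k powr (- s2) * of_nat k powr (- w) + B k * of_nat k powr (- w)) has_sum
        (c0 * zeta_tail_cont q (w + (s1 + s2 - 1)) + c1 * zeta_tail_cont q (w + s1) + c2 * zeta_tail_cont q (w + s2) + (\<Sum>\<^sub>\<infinity>k\<in>{q..}. B k * of_nat k powr (- w)))) {q..}"
      by (intro has_sum_add Zd bs) (use s in auto)
    also have "(\<lambda>k. c0 * of_nat k powr (- (s1 + s2 - 1)) * of_nat k powr (- w) + c1 * of_nat k powr (- s1) * of_nat k powr (- w)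
        + c2 * of_nat k powr (- s2) * of_nat k powr (- w) + B k * of_nat k powr (- w)) = (\<lambda>k. conv_coeff s1 s2 k * of_nat k powr (- w))"
      unfolding B_def by (simp add: fun_eq_iff ring_distribs)
    finally have t: "((\<lambda>k. conv_coeff s1 s2 k * of_nat k powr (- w)) has_sum
        (c0 * zeta_tail_cont q (w + (s1 + s2 - 1)) + c1 * zeta_tail_cont q (w + s1) + c2 * zeta_tail_cont q (w + s2) + (\<Sum>\<^sub>\<infinity>k\<in>{q..}. B k * of_nat k powr (- w)))) {q..}" .
    have h: "((\<lambda>k. conv_coeff s1 s2 k * of_nat k powr (- w)) has_sum (\<Sum>k=1..<q. conv_coeff s1 s2 k * of_nat k powr (- w))) {1..<q}"
      by (rule has_sum_finiteI) auto
    have un: "{1..<q} \<union> {q..} = {1..}" using q by auto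
    have "((\<lambda>k. conv_coeff s1 s2 k * of_nat k powr (- w)) has_sum G w) ({1..<q} \<union> {q..})"
      unfolding G_def by (rule has_sum_Un_disjoint[OF h t]) auto
    then have "((\<lambda>k. conv_coeff s1 s2 k * of_nat k powr (- w)) has_sum G w) {1..}" unfolding un .
    with MT_series_dirichlet[OF M(2)] have "MT_series (s1,s2,w) = G w" by (rule has_sum_unique)
    then show "zeta_MT2 s1 s2 w = G w" using M(1) by simp
  qed (use Vo Gh z in \<open>auto simp: V_def W_def\<close>)
  then show ?thesis by (simp add: G_def)
qed

text \<open>The lower bound for q puts z + s1 + s2 - 1, z + s1 and z + s2 within q/4, as
  \<open>zeta_tail_cont_bound\<close> demands.\<close>

lemma zeta_MT2_approx:
  assumes s: "Re s1 > 1/2" "Re s2 > 1/2" "Re s1 < 1" "Re s2 < 1" "Im s1 \<ge> 0" "Im s2 \<ge> 0"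
    and x: "x > 0" and sg: "Re s1 + Re s2 + x > 3/2"
  obtains C A where "C \<ge> 0" "A \<ge> 0" "\<And>k. k \<ge> 1 \<Longrightarrow> norm (conv_coeff s1 s2 k) \<le> A * real k powr (1 - (Re s1 + Re s2))"
    "\<And>t q. t > 0 \<Longrightarrow> real q \<ge> 4 * (norm s1 + norm s2 + 1 + x + t) \<Longrightarrow>
      norm (zeta_MT2 s1 s2 (Complex x t) - (\<Sum>k=1..<q. conv_coeff s1 s2 k * of_nat k powr (- Complex x t)))
        \<le> C * real q powr (2 - (Re s1 + Re s2 + x)) / t"
proof -
  have s0: "0 < Re s1" "0 < Re s2" using s by auto
  obtain c0 c1 c2 C where C: "C \<ge> 0"
    "\<And>k. k \<ge> 1 \<Longrightarrow> norm (conv_coeff s1 s2 k - (c0 * of_nat k powr (- (s1 + s2 - 1)) + c1 * of_nat k powr (- s1) + c2 * of_nat k powr (- s2)))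
        \<le> C * real k powr (- (Re s1 + Re s2))"
    by (rule conv_coeff_expansion[OF s0(1) s(3) s0(2) s(4)]) (rule that; assumption)
  define sg where "sg = Re s1 + Re s2 + x"
  define A where "A = norm c0 + norm c1 + norm c2 + C"
  define D where "D = 3 * norm c0 + 3 * norm c1 + 3 * norm c2 + 3 * C"
  show ?thesis
  proof (rule that[of D A])
    show "D \<ge> 0" "A \<ge> 0" using C by (auto simp: D_def A_def)
  next
    fix k :: nat assume k: "k \<ge> 1"
    define P where "P = real k powr (1 - (Re s1 + Re s2))"
    define m where "m = c0 * of_nat k powr (- (s1 + s2 - 1)) + c1 * of_nat k powr (- s1) + c2 * of_nat k powr (- s2)"
    have "norm (conv_coeff s1 s2 k) \<le> norm (conv_coeff s1 s2 k - m) + norm m" using norm_triangle_ineq[of "conv_coeff s1 s2 k - m" m] by simp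
    also have "norm (conv_coeff s1 s2 k - m) \<le> C * real k powr (- (Re s1 + Re s2))" unfolding m_def by (rule C(2)[OF k])
    also have "\<dots> \<le> C * P" unfolding P_def using k C by (intro mult_left_mono powr_mono) auto
    also have "norm m \<le> norm c0 * P + norm c1 * P + norm c2 * P"
      unfolding m_def
    proof (intro norm_triangle_mono)
      show "norm (c0 * of_nat k powr (- (s1 + s2 - 1))) \<le> norm c0 * P"
        using norm_nat_powr[OF k, of "- (s1 + s2 - 1)"] by (simp add: norm_mult P_def)
      have "real k powr (- Re s1) \<le> P" "real k powr (- Re s2) \<le> P" unfolding P_def using k s by (auto intro!: powr_mono)
      then show "norm (c1 * of_nat k powr (- s1)) \<le> norm c1 * P" "norm (c2 * of_nat k powr (- s2)) \<le> norm c2 * P"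
        using norm_nat_powr[OF k, of "- s1"] norm_nat_powr[OF k, of "- s2"] by (auto simp: norm_mult intro!: mult_left_mono)
    qed
    finally show "norm (conv_coeff s1 s2 k) \<le> A * real k powr (1 - (Re s1 + Re s2))"
      unfolding P_def[symmetric] by (simp add: A_def algebra_simps)
  next
    fix t :: real and q :: nat
    assume t: "t > 0" and q: "real q \<ge> 4 * (norm s1 + norm s2 + 1 + x + t)"
    define z where "z = Complex x t"
    have z: "Re z = x" "Im z = t" by (simp_all add: z_def)
    have nz: "norm z \<le> x + t" using cmod_le[of z] z x t by auto
    have q': "real q \<ge> 4 * norm s1 + 4 * norm s2 + 4 + 4 * x + 4 * t" using q by (simp add: algebra_simps)
    have "real q > 4" using q' x t norm_ge_zero[of s1] norm_ge_zero[of s2] by linarith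
    then have q4: "q \<ge> 4" by simp
    have qt: "real q \<ge> t" "real q > 0" using q' x t norm_ge_zero[of s1] norm_ge_zero[of s2] by linarith+
    have q2: "q \<ge> 2" "q \<ge> 1" using q4 by auto
    have n1: "norm (z + (s1 + s2 - 1)) \<le> real q / 4"
    proof -
      have "norm (z + (s1 + s2 - 1)) \<le> norm z + (norm s1 + norm s2 + norm (1::complex))"
        by (intro norm_triangle_mono order_refl order_trans[OF norm_triangle_ineq4] add_right_mono norm_triangle_ineq)
      then show ?thesis using q' nz by simp
    qed
    have n2: "norm (z + s1) \<le> real q / 4" "norm (z + s2) \<le> real q / 4"
      using q' nz norm_triangle_ineq[of z s1] norm_triangle_ineq[of z s2] norm_ge_zero[of s1] norm_ge_zero[of s2] by linarith+
    define P where "P = real q powr (2 - sg) / t"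
    have P0: "P \<ge> 0" using t by (simp add: P_def)
    \<comment> \<open>One bound fits all three tails: Re d + x is exactly sg - 1 for d = s1 + s2 -
      1, and larger for d = s1 and d = s2 because the other real part is below 1.\<close>
    have Zb: "norm (zeta_tail_cont q (z + d)) \<le> 3 * P" if d: "norm (z + d) \<le> real q / 4" "Re d + x > 1/2" "Im d \<ge> 0" "Re d + x \<ge> sg - 1" for d
    proof -
      have "norm (zeta_tail_cont q (z + d)) \<le> 3 * real q powr (1 - Re (z + d)) / Im (z + d)"
        by (rule zeta_tail_cont_bound[OF q4]) (use d t z in auto)
      also have "\<dots> \<le> 3 * real q powr (1 - Re (z + d)) / t"
        using d t z by (intro divide_left_mono mult_pos_pos) auto
      also have "\<dots> \<le> 3 * real q powr (2 - sg) / t"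
        using d t z q2 by (intro divide_right_mono mult_left_mono powr_mono) auto
      finally show ?thesis by (simp add: P_def)
    qed
    define B where "B = (\<lambda>k. conv_coeff s1 s2 k - (c0 * of_nat k powr (- (s1 + s2 - 1)) + c1 * of_nat k powr (- s1) + c2 * of_nat k powr (- s2)))"
    have b': "norm (B k) \<le> C * real k powr (- (Re s1 + Re s2))" if "k \<ge> 1" for k unfolding B_def by (rule C(2)[OF that])
    have x1: "Re s1 + Re s2 > 1" using s by simp
    have z0: "Re z \<ge> 0" "Re z > 0" "Im z > 0" using z x t by auto
    have Bt: "norm (\<Sum>\<^sub>\<infinity>k\<in>{q..}. B k * of_nat k powr (- z)) \<le> 3 * C * P"
    proof -
      have "norm (\<Sum>\<^sub>\<infinity>k\<in>{q..}. B k * of_nat k powr (- z)) \<le> C * (real q powr (- (Re s1 + Re s2 + Re z)) + real q powr (1 - (Re s1 + Re s2 + Re z)) / (Re s1 + Re s2 + Re z - 1))"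
        by (rule tail_dirichlet(3)[where b = B, OF b' x1 C(1) q2(2) z0(1)])
      also have "\<dots> \<le> C * (real q powr (1 - sg) + real q powr (1 - sg) / (1/2))"
      proof -
        have e: "Re s1 + Re s2 + Re z = sg" by (simp add: z sg_def)
        show ?thesis unfolding e
          using q2 C assms(8) by (intro mult_left_mono add_mono powr_mono divide_left_mono) (auto simp: sg_def)
      qed
      also have "\<dots> = 3 * C * real q powr (1 - sg)" by (simp add: algebra_simps)
      \<comment> \<open>One power of q is exchanged for 1/t, since t <= q.\<close>
      also have "real q powr (1 - sg) = real q powr (2 - sg) / real q"
        using qt powr_diff[of "real q" "2 - sg" 1] by simp
      also have "3 * C * (real q powr (2 - sg) / real q) \<le> 3 * C * P"
        unfolding P_def using qt t C by (intro mult_left_mono divide_left_mono mult_pos_pos) auto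
      finally show ?thesis .
    qed
    have dec: "zeta_MT2 s1 s2 z = (\<Sum>k=1..<q. conv_coeff s1 s2 k * of_nat k powr (- z)) + (c0 * zeta_tail_cont q (z + (s1 + s2 - 1))
      + c1 * zeta_tail_cont q (z + s1) + c2 * zeta_tail_cont q (z + s2) + (\<Sum>\<^sub>\<infinity>k\<in>{q..}. B k * of_nat k powr (- z)))"
      unfolding B_def by (rule zeta_MT2_decomp[OF s z0(2,3) q2(1) C])
    have "norm (zeta_MT2 s1 s2 z - (\<Sum>k=1..<q. conv_coeff s1 s2 k * of_nat k powr (- z))) =
      norm (c0 * zeta_tail_cont q (z + (s1 + s2 - 1)) + c1 * zeta_tail_cont q (z + s1) + c2 * zeta_tail_cont q (z + s2) + (\<Sum>\<^sub>\<infinity>k\<in>{q..}. B k * of_nat k powr (- z)))"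
      unfolding dec by simp
    also have "\<dots> \<le> norm c0 * (3 * P) + norm c1 * (3 * P) + norm c2 * (3 * P) + 3 * C * P"
    proof (intro norm_triangle_mono Bt)
      show "norm (c0 * zeta_tail_cont q (z + (s1 + s2 - 1))) \<le> norm c0 * (3 * P)"
        unfolding norm_mult by (intro mult_left_mono Zb n1) (use s assms(8) in \<open>auto simp: sg_def\<close>)
      show "norm (c1 * zeta_tail_cont q (z + s1)) \<le> norm c1 * (3 * P)"
        unfolding norm_mult by (intro mult_left_mono Zb n2) (use s x in \<open>auto simp: sg_def\<close>)
      show "norm (c2 * zeta_tail_cont q (z + s2)) \<le> norm c2 * (3 * P)"
        unfolding norm_mult by (intro mult_left_mono Zb n2) (use s x in \<open>auto simp: sg_def\<close>)
    qed
    also have "\<dots> = D * real q powr (2 - (Re s1 + Re s2 + x)) / t" by (simp add: D_def P_def sg_def algebra_simps add_divide_distrib)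
    finally show "norm (zeta_MT2 s1 s2 (Complex x t) - (\<Sum>k=1..<q. conv_coeff s1 s2 k * of_nat k powr (- Complex x t)))
        \<le> D * real q powr (2 - (Re s1 + Re s2 + x)) / t" unfolding z_def .
  qed
qed

section \<open>Mean squares\<close>

lemma integral_cis_bound:
  assumes "u \<noteq> 0" "a \<le> b"
  obtains J where "((\<lambda>t. cis (t * u)) has_integral J) {a..b}" "norm J \<le> 2 / \<bar>u\<bar>"
proof -
  define F where "F = (\<lambda>t. cis (t * u) / (\<i> * of_real u))"
  have "((\<lambda>t. cis (t * u)) has_integral (F b - F a)) {a..b}"
  proof (rule fundamental_theorem_of_calculus[OF assms(2)])
    fix t assume "t \<in> {a..b}"
    have "((\<lambda>t. exp (\<i> * of_real u * t) / (\<i> * of_real u)) has_field_derivative exp (\<i> * of_real u * of_real t)) (at (of_real t))"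
      using assms by (auto intro!: derivative_eq_intros)
    from has_vector_derivative_real_field[OF this]
    show "(F has_vector_derivative cis (t * u)) (at t within {a..b})"
      by (simp add: F_def cis_conv_exp mult_ac)
  qed
  moreover have "norm (F b - F a) \<le> 2 / \<bar>u\<bar>"
  proof -
    have "norm (F b - F a) \<le> norm (F b) + norm (F a)" by (rule norm_triangle_ineq4)
    also have "\<dots> = 2 / \<bar>u\<bar>" by (simp add: F_def norm_divide norm_mult)
    finally show ?thesis .
  qed
  ultimately show ?thesis using that by blast
qed

text \<open>Off the diagonal of the squared sum the frequencies are ln l - ln k, and an oscillation
  of frequency u integrates to at most 2/|u| over any interval.\<close>

lemma mean_square_dirichlet:
  fixes b :: "nat \<Rightarrow> complex"
  assumes I: "finite I" "\<And>k. k \<in> I \<Longrightarrow> k \<ge> 1" and T: "a \<le> T"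
  defines "P \<equiv> \<lambda>t. \<Sum>k\<in>I. b k * cis (- (t * ln (real k)))"
  shows "\<bar>integral {a..T} (\<lambda>t. (norm (P t))\<^sup>2) - (T - a) * (\<Sum>k\<in>I. (norm (b k))\<^sup>2)\<bar>
    \<le> (\<Sum>k\<in>I. \<Sum>l\<in>I - {k}. norm (b k) * norm (b l) * (2 / \<bar>ln (real l) - ln (real k)\<bar>))"
proof -
  define J where "J = (\<lambda>k l. integral {a..T} (\<lambda>t. cis (t * (ln (real l) - ln (real k)))))"
  have J: "((\<lambda>t. cis (t * (ln (real l) - ln (real k)))) has_integral J k l) {a..T}" for k l
    unfolding J_def by (intro integrable_integral integrable_continuous_real continuous_intros)
  have Jn: "norm (J k l) \<le> 2 / \<bar>ln (real l) - ln (real k)\<bar>" if "k \<in> I" "l \<in> I - {k}" for k l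
  proof -
    have "ln (real l) - ln (real k) \<noteq> 0" using I(2)[of k] I(2)[of l] that by auto
    from integral_cis_bound[OF this T] obtain J' where
      "((\<lambda>t. cis (t * (ln (real l) - ln (real k)))) has_integral J') {a..T}" "norm J' \<le> 2 / \<bar>ln (real l) - ln (real k)\<bar>" by metis
    with J[of l k] show ?thesis using has_integral_unique[OF J] by metis
  qed
  have Jd: "J k k = of_real (T - a)" for k unfolding J_def using T by (simp add: scaleR_conv_of_real)
  have dterm: "b k * cnj (b k) * J k k = of_real ((T - a) * (norm (b k))\<^sup>2)" for k
    unfolding Jd complex_norm_square[symmetric] by (simp add: mult.commute)
  have eq: "complex_of_real ((norm (P t))\<^sup>2) = (\<Sum>k\<in>I. \<Sum>l\<in>I. b k * cnj (b l) * cis (t * (ln (real l) - ln (real k))))" for t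
  proof -
    have "complex_of_real ((norm (P t))\<^sup>2) = P t * cnj (P t)" by (rule complex_norm_square)
    also have "\<dots> = (\<Sum>k\<in>I. \<Sum>l\<in>I. b k * cis (- (t * ln (real k))) * cnj (b l * cis (- (t * ln (real l)))))"
      unfolding P_def cnj_sum by (rule sum_product)
    also have "\<dots> = (\<Sum>k\<in>I. \<Sum>l\<in>I. b k * cnj (b l) * cis (t * (ln (real l) - ln (real k))))"
    proof (intro sum.cong refl)
      fix k l
      have "cis (- (t * ln (real k))) * cis (t * ln (real l)) = cis (t * (ln (real l) - ln (real k)))"
        by (simp add: cis_mult algebra_simps)
      then show "b k * cis (- (t * ln (real k))) * cnj (b l * cis (- (t * ln (real l)))) = b k * cnj (b l) * cis (t * (ln (real l) - ln (real k)))"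
        by (simp add: cis_cnj mult_ac)
    qed
    finally show ?thesis .
  qed
  have Pc: "continuous_on {a..T} P" unfolding P_def by (intro continuous_intros)
  have "((\<lambda>t. complex_of_real ((norm (P t))\<^sup>2)) has_integral (\<Sum>k\<in>I. \<Sum>l\<in>I. b k * cnj (b l) * J k l)) {a..T}"
    unfolding eq by (intro has_integral_sum I has_integral_mult_right J)
  moreover have "((\<lambda>t. complex_of_real ((norm (P t))\<^sup>2)) has_integral complex_of_real (integral {a..T} (\<lambda>t. (norm (P t))\<^sup>2))) {a..T}"
    using has_integral_linear[OF integrable_integral bounded_linear_of_real[where 'a = complex], of "\<lambda>t. (norm (P t))\<^sup>2" "{a..T}"]
    by (simp add: o_def integrable_continuous_real continuous_intros Pc)
  ultimately have "complex_of_real (integral {a..T} (\<lambda>t. (norm (P t))\<^sup>2)) = (\<Sum>k\<in>I. \<Sum>l\<in>I. b k * cnj (b l) * J k l)"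
    by (rule has_integral_unique[symmetric])
  also have "\<dots> = (\<Sum>k\<in>I. b k * cnj (b k) * J k k + (\<Sum>l\<in>I - {k}. b k * cnj (b l) * J k l))"
    using I by (intro sum.cong refl sum.remove) auto
  also have "\<dots> = of_real ((T - a) * (\<Sum>k\<in>I. (norm (b k))\<^sup>2)) + (\<Sum>k\<in>I. \<Sum>l\<in>I - {k}. b k * cnj (b l) * J k l)"
    by (simp only: sum.distrib dterm sum_distrib_left of_real_sum)
  finally have E: "complex_of_real (integral {a..T} (\<lambda>t. (norm (P t))\<^sup>2) - (T - a) * (\<Sum>k\<in>I. (norm (b k))\<^sup>2)) = (\<Sum>k\<in>I. \<Sum>l\<in>I - {k}. b k * cnj (b l) * J k l)"
    by simp
  have "\<bar>integral {a..T} (\<lambda>t. (norm (P t))\<^sup>2) - (T - a) * (\<Sum>k\<in>I. (norm (b k))\<^sup>2)\<bar> = norm (\<Sum>k\<in>I. \<Sum>l\<in>I - {k}. b k * cnj (b l) * J k l)"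
    unfolding E[symmetric] norm_of_real ..
  also have "\<dots> \<le> (\<Sum>k\<in>I. \<Sum>l\<in>I - {k}. norm (b k * cnj (b l) * J k l))"
    by (intro order_trans[OF norm_sum] sum_mono norm_sum)
  also have "\<dots> \<le> (\<Sum>k\<in>I. \<Sum>l\<in>I - {k}. norm (b k) * norm (b l) * (2 / \<bar>ln (real l) - ln (real k)\<bar>))"
    unfolding norm_mult complex_mod_cnj by (intro sum_mono mult_left_mono Jn) auto
  finally show ?thesis .
qed

lemma ln_diff_lower:
  assumes "1 \<le> k" "k < (l::nat)"
  shows "real (l - k) / real l \<le> ln (real l) - ln (real k)"
proof -
  have "ln (real k / real l) \<le> real k / real l - 1" using assms by (intro ln_le_minus_one) auto
  then show ?thesis using assms by (simp add: ln_div of_nat_diff field_simps)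
qed

lemma sum_inverse_dist:
  assumes k: "k \<in> {1..<q}"
  shows "(\<Sum>l\<in>{1..<q} - {k}. 1 / \<bar>real l - real k\<bar>) \<le> 2 * (\<Sum>j=1..<q. 1 / real j)"
proof -
  have "{1..<q} - {k} = {1..<k} \<union> {Suc k..<q}" using k by auto
  then have "(\<Sum>l\<in>{1..<q} - {k}. 1 / \<bar>real l - real k\<bar>) = (\<Sum>l=1..<k. 1 / \<bar>real l - real k\<bar>) + (\<Sum>l=Suc k..<q. 1 / \<bar>real l - real k\<bar>)"
    by (simp add: sum.union_disjoint disjoint_iff)
  also have "(\<Sum>l=1..<k. 1 / \<bar>real l - real k\<bar>) = (\<Sum>j=1..<k. 1 / real j)"
    by (rule sum.reindex_bij_witness[of _ "\<lambda>j. k - j" "\<lambda>l. k - l"]) (auto simp: of_nat_diff)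
  also have "\<dots> \<le> (\<Sum>j=1..<q. 1 / real j)" using k by (intro sum_mono2) auto
  also have "(\<Sum>l=Suc k..<q. 1 / \<bar>real l - real k\<bar>) = (\<Sum>j=1..<q - k. 1 / real j)"
    by (rule sum.reindex_bij_witness[of _ "\<lambda>j. k + j" "\<lambda>l. l - k"]) (auto simp: of_nat_diff)
  also have "\<dots> \<le> (\<Sum>j=1..<q. 1 / real j)" by (intro sum_mono2) auto
  finally show ?thesis by simp
qed

text \<open>For k < l, 1/ln(l/k) <= l/(l-k), and the factor l joins l^(-e) to give at most q^(1-e)
  because e <= 1. There remains k^(-e)/|l-k|, whose sum over l is harmonic. Only the smaller index
  keeps its weight, so the bound is symmetrised as \<open>h k l + h l k\<close>. The 8 collects the
  2 of the oscillatory integral, the two sides of k and this symmetrisation.\<close>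

lemma off_diagonal_bound:
  fixes b :: "nat \<Rightarrow> complex"
  assumes b: "\<And>k. k \<ge> 1 \<Longrightarrow> norm (b k) \<le> A * real k powr (- e)" and A: "A \<ge> 0" and e: "0 < e" "e \<le> 1"
  shows "(\<Sum>k\<in>{1..<q}. \<Sum>l\<in>{1..<q} - {k}. norm (b k) * norm (b l) * (2 / \<bar>ln (real l) - ln (real k)\<bar>))
    \<le> 8 * A\<^sup>2 * real q powr (1 - e) * (\<Sum>k=1..<q. real k powr (- e)) * (\<Sum>j=1..<q. 1 / real j)"
proof -
  define Q where "Q = real q powr (1 - e)"
  define H where "H = (\<Sum>j=1..<q. 1 / real j)"
  define S where "S = (\<Sum>k=1..<q. real k powr (- e))"
  define h where "h = (\<lambda>k l. 2 * A\<^sup>2 * Q * (real k powr (- e) * (1 / \<bar>real l - real k\<bar>)))"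
  have key: "norm (b k) * norm (b l) * (2 / \<bar>ln (real l) - ln (real k)\<bar>) \<le> 2 * A\<^sup>2 * Q * (real k powr (- e) * (1 / \<bar>real l - real k\<bar>))"
    if kl: "1 \<le> k" "k < l" "l < q" for k l
  proof -
    have pos: "0 < real (l - k) / real l" using kl by simp
    have a1: "real (l - k) / real l \<le> \<bar>ln (real l) - ln (real k)\<bar>" using ln_diff_lower[OF kl(1,2)] by linarith
    have a2: "\<bar>ln (real l) - ln (real k)\<bar> > 0" using a1 pos by linarith
    have "2 / \<bar>ln (real l) - ln (real k)\<bar> \<le> 2 / (real (l - k) / real l)"
      by (rule divide_left_mono[OF a1 _ mult_pos_pos[OF a2 pos]]) simp
    also have "\<dots> = 2 * real l * (1 / \<bar>real l - real k\<bar>)" using kl by (simp add: of_nat_diff)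
    finally have 1: "2 / \<bar>ln (real l) - ln (real k)\<bar> \<le> 2 * real l * (1 / \<bar>real l - real k\<bar>)" .
    have "norm (b k) * norm (b l) * (2 / \<bar>ln (real l) - ln (real k)\<bar>)
        \<le> (A * real k powr (- e)) * (A * real l powr (- e)) * (2 * real l * (1 / \<bar>real l - real k\<bar>))"
      using kl A b[of k] b[of l] by (intro mult_mono 1 mult_nonneg_nonneg) auto
    also have "\<dots> = 2 * A\<^sup>2 * (real l powr (- e) * real l powr 1) * (real k powr (- e) * (1 / \<bar>real l - real k\<bar>))"
      by (simp add: power2_eq_square)
    also have "real l powr (- e) * real l powr 1 = real l powr (1 - e)" unfolding powr_add[symmetric] by simp
    also have "2 * A\<^sup>2 * real l powr (1 - e) * (real k powr (- e) * (1 / \<bar>real l - real k\<bar>)) \<le> 2 * A\<^sup>2 * Q * (real k powr (- e) * (1 / \<bar>real l - real k\<bar>))"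
      unfolding Q_def using kl e by (intro mult_right_mono mult_left_mono powr_mono2) auto
    finally show ?thesis .
  qed
  have h0: "h k l \<ge> 0" for k l by (simp add: h_def Q_def)
  have le: "norm (b k) * norm (b l) * (2 / \<bar>ln (real l) - ln (real k)\<bar>) \<le> h k l + h l k" if "k \<in> {1..<q}" "l \<in> {1..<q} - {k}" for k l
  proof (cases "k < l")
    case True
    have "norm (b k) * norm (b l) * (2 / \<bar>ln (real l) - ln (real k)\<bar>) \<le> h k l" unfolding h_def by (rule key) (use that True in auto)
    with h0[of l k] show ?thesis by linarith
  next
    case False
    have "norm (b l) * norm (b k) * (2 / \<bar>ln (real k) - ln (real l)\<bar>) \<le> h l k" unfolding h_def by (rule key) (use that False in auto)
    with h0[of k l] show ?thesis by (simp add: mult.commute abs_minus_commute)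
  qed
  have row: "(\<Sum>l\<in>{1..<q} - {k}. h k l) \<le> 2 * A\<^sup>2 * Q * (real k powr (- e) * (2 * H))" if "k \<in> {1..<q}" for k
    unfolding h_def sum_distrib_left[symmetric] H_def
    by (intro mult_left_mono sum_inverse_dist that) (auto simp: Q_def)
  have tot: "(\<Sum>k\<in>{1..<q}. \<Sum>l\<in>{1..<q} - {k}. h k l) \<le> 4 * A\<^sup>2 * Q * S * H"
  proof -
    have "(\<Sum>k\<in>{1..<q}. \<Sum>l\<in>{1..<q} - {k}. h k l) \<le> (\<Sum>k\<in>{1..<q}. 2 * A\<^sup>2 * Q * (real k powr (- e) * (2 * H)))"
      by (intro sum_mono row)
    also have "\<dots> = 4 * A\<^sup>2 * Q * S * H" by (simp add: S_def sum_distrib_left sum_distrib_right mult_ac)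
    finally show ?thesis .
  qed
  have sw: "(\<Sum>k\<in>{1..<q}. \<Sum>l\<in>{1..<q} - {k}. h l k) = (\<Sum>k\<in>{1..<q}. \<Sum>l\<in>{1..<q} - {k}. h k l)"
  proof -
    have "(\<Sum>k\<in>{1..<q}. \<Sum>l\<in>{l \<in> {1..<q}. l \<noteq> k}. h l k) = (\<Sum>l\<in>{1..<q}. \<Sum>k\<in>{k \<in> {1..<q}. l \<noteq> k}. h l k)"
      by (rule sum.swap_restrict) auto
    moreover have e1: "{l \<in> {1..<q}. l \<noteq> k} = {1..<q} - {k}" and e2: "{l \<in> {1..<q}. k \<noteq> l} = {1..<q} - {k}" for k by auto
    ultimately show ?thesis by (simp only: e1 e2)
  qed
  have "(\<Sum>k\<in>{1..<q}. \<Sum>l\<in>{1..<q} - {k}. norm (b k) * norm (b l) * (2 / \<bar>ln (real l) - ln (real k)\<bar>))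
      \<le> (\<Sum>k\<in>{1..<q}. \<Sum>l\<in>{1..<q} - {k}. h k l + h l k)"
    by (intro sum_mono le)
  also have "\<dots> = 2 * (\<Sum>k\<in>{1..<q}. \<Sum>l\<in>{1..<q} - {k}. h k l)"
    unfolding sum.distrib sw by simp
  also have "\<dots> \<le> 8 * A\<^sup>2 * Q * S * H" using tot by linarith
  finally show ?thesis by (simp add: Q_def S_def H_def)
qed

lemma harmonic_sum_le:
  assumes "q \<ge> 1" shows "(\<Sum>j=1..<q. 1 / real j) \<le> 1 + ln (real q)"
proof -
  have "(\<Sum>j=1..<Suc q. 1 / real j) \<le> 1 + ln (real q)" using assms
  proof (induction q rule: nat_induct_at_least)
    case (Suc q)
    have "1 / real (Suc q) \<le> ln (real (Suc q)) - ln (real q)"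
      using ln_diff_lower[of q "Suc q"] Suc.hyps by simp
    then show ?case using Suc by simp
  qed simp
  moreover have "(\<Sum>j=1..<q. 1 / real j) \<le> (\<Sum>j=1..<Suc q. 1 / real j)" by (intro sum_mono2) auto
  ultimately show ?thesis by linarith
qed

text \<open>With D = |f - g|, the difference of the squares is at most 2 |g| D + D^2, and 2 |g| D <=
  r |g|^2 + D^2 / r. The parameter r is left free for balancing; the decay M/t keeps the integral of
  D^2 below M^2 uniformly in T.\<close>

lemma mean_square_compare:
  fixes f g :: "real \<Rightarrow> complex"
  assumes f: "continuous_on {2..T} f" and g: "continuous_on {2..T} g" and T: "T \<ge> 2" and r: "r > 0" and M: "M \<ge> 0"
    and d: "\<And>t. t \<in> {2..T} \<Longrightarrow> norm (f t - g t) \<le> M / t"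
  shows "\<bar>integral {2..T} (\<lambda>t. (norm (f t))\<^sup>2) - integral {2..T} (\<lambda>t. (norm (g t))\<^sup>2)\<bar>
     \<le> r * integral {2..T} (\<lambda>t. (norm (g t))\<^sup>2) + (1 / r + 1) * M\<^sup>2"
proof -
  have fi: "(\<lambda>t. (norm (f t))\<^sup>2) integrable_on {2..T}" and gi: "(\<lambda>t. (norm (g t))\<^sup>2) integrable_on {2..T}"
    using f g by (auto intro!: integrable_continuous_real continuous_intros)
  have "((\<lambda>t. M\<^sup>2 / t\<^sup>2) has_integral (- (M\<^sup>2) / T - (- (M\<^sup>2) / 2))) {2..T}"
    by (rule fundamental_theorem_of_calculus[OF T])
       (auto intro!: derivative_eq_intros simp: power2_eq_square simp flip: has_real_derivative_iff_has_vector_derivative)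
  then have hi: "(\<lambda>t. M\<^sup>2 / t\<^sup>2) integrable_on {2..T}" and "integral {2..T} (\<lambda>t. M\<^sup>2 / t\<^sup>2) = - (M\<^sup>2) / T - (- (M\<^sup>2) / 2)"
    unfolding has_integral_iff by auto
  moreover have "M\<^sup>2 / T \<ge> 0" using T by simp
  ultimately have hv: "integral {2..T} (\<lambda>t. M\<^sup>2 / t\<^sup>2) \<le> M\<^sup>2"
    using zero_le_power2[of M] by linarith
  have pt: "\<bar>(norm (f t))\<^sup>2 - (norm (g t))\<^sup>2\<bar> \<le> r * (norm (g t))\<^sup>2 + (1 / r + 1) * (M\<^sup>2 / t\<^sup>2)" if t: "t \<in> {2..T}" for t
  proof -
    define D where "D = norm (f t - g t)"
    define G where "G = norm (g t)"
    have fD: "\<bar>norm (f t) - G\<bar> \<le> D" unfolding D_def G_def by (rule norm_triangle_ineq3)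
    have D0: "D \<ge> 0" "G \<ge> 0" by (auto simp: D_def G_def)
    have "\<bar>(norm (f t))\<^sup>2 - G\<^sup>2\<bar> = \<bar>norm (f t) - G\<bar> * \<bar>norm (f t) + G\<bar>"
      by (simp add: power2_eq_square square_diff_square_factored abs_mult mult.commute)
    also have "\<dots> \<le> D * (2 * G + D)" using fD D0 by (intro mult_mono) auto
    also have "\<dots> = 2 * (D * G) + D\<^sup>2" by (simp add: power2_eq_square algebra_simps)
    also have "2 * (D * G) \<le> r * G\<^sup>2 + D\<^sup>2 / r"
    proof -
      have "0 \<le> (r * G - D)\<^sup>2 / r" using r by simp
      also have "\<dots> = r * G\<^sup>2 + D\<^sup>2 / r - 2 * (D * G)" using r by (simp add: power2_eq_square field_simps)
      finally show ?thesis by simp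
    qed
    also have "r * G\<^sup>2 + D\<^sup>2 / r + D\<^sup>2 = r * G\<^sup>2 + (1 / r + 1) * D\<^sup>2" by (simp add: algebra_simps)
    also have "\<dots> \<le> r * G\<^sup>2 + (1 / r + 1) * (M\<^sup>2 / t\<^sup>2)"
    proof -
      have "D\<^sup>2 \<le> (M / t)\<^sup>2" unfolding D_def by (intro power_mono d t) auto
      then show ?thesis using r by (intro add_left_mono mult_left_mono) (auto simp: power_divide)
    qed
    finally show ?thesis by (simp add: G_def)
  qed
  have "\<bar>integral {2..T} (\<lambda>t. (norm (f t))\<^sup>2) - integral {2..T} (\<lambda>t. (norm (g t))\<^sup>2)\<bar>
      = norm (integral {2..T} (\<lambda>t. (norm (f t))\<^sup>2 - (norm (g t))\<^sup>2))"
    using fi gi by (simp add: integral_diff)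
  also have "\<dots> \<le> integral {2..T} (\<lambda>t. r * (norm (g t))\<^sup>2 + (1 / r + 1) * (M\<^sup>2 / t\<^sup>2))"
    using pt fi gi hi by (intro integral_norm_bound_integral integrable_diff integrable_add integrable_on_mult_right) auto
  also have "\<dots> = r * integral {2..T} (\<lambda>t. (norm (g t))\<^sup>2) + (1 / r + 1) * integral {2..T} (\<lambda>t. M\<^sup>2 / t\<^sup>2)"
    unfolding integral_add[OF integrable_on_mult_right[OF gi] integrable_on_mult_right[OF hi]] integral_mult_right ..
  also have "\<dots> \<le> r * integral {2..T} (\<lambda>t. (norm (g t))\<^sup>2) + (1 / r + 1) * M\<^sup>2"
    using hv r by (intro add_left_mono mult_left_mono) auto
  finally show ?thesis .
qed

text \<open>The error keeps q and the sum of k^(-e) explicit, because that sum is a power of q for e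
  < 1 and a logarithm for e = 1; in this form one estimate serves both cases.\<close>

lemma mean_square_estimate:
  assumes s: "Re s1 > 1/2" "Re s2 > 1/2" "Re s1 < 1" "Re s2 < 1" "Im s1 \<ge> 0" "Im s2 \<ge> 0"
    and x: "x > 0" and sg: "Re s1 + Re s2 + x > 3/2" "Re s1 + Re s2 + x \<le> 2"
  defines "e \<equiv> Re s1 + Re s2 + x - 1"
  obtains K where "K \<ge> 0" "\<forall>\<^sub>F T in at_top. \<exists>q. real q \<le> 9 * T \<and> real q \<ge> T \<and>
     cmod (complex_of_real (integral {2..T} (\<lambda>t. (cmod (zeta_MT2 s1 s2 (Complex x t)))\<^sup>2))
                       - zeta_MT2_sq s1 s2 (complex_of_real (2 * x)) * complex_of_real T)
     \<le> K * (T powr (3/2 - e) + real q powr (1 - e) * (\<Sum>k=1..<q. real k powr (- e)) * (1 + ln (real q)))"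
proof -
  have e: "1/2 < e" "e \<le> 1" using sg by (auto simp: e_def)
  obtain C A where C: "C \<ge> 0" and A: "A \<ge> 0"
    and ab: "\<And>k. k \<ge> 1 \<Longrightarrow> norm (conv_coeff s1 s2 k) \<le> A * real k powr (1 - (Re s1 + Re s2))"
    and approx: "\<And>t q. t > 0 \<Longrightarrow> real q \<ge> 4 * (norm s1 + norm s2 + 1 + x + t) \<Longrightarrow>
      norm (zeta_MT2 s1 s2 (Complex x t) - (\<Sum>k=1..<q. conv_coeff s1 s2 k * of_nat k powr (- Complex x t)))
        \<le> C * real q powr (2 - (Re s1 + Re s2 + x)) / t"
    by (rule zeta_MT2_approx[OF s x sg(1)]) (rule that; assumption)
  \<comment> \<open>The real part x of the third variable is absorbed into the coefficients, which
    leaves pure oscillations in t.\<close>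
  define b where "b = (\<lambda>k. conv_coeff s1 s2 k * of_nat k powr (- of_real x))"
  have bb: "norm (b k) \<le> A * real k powr (- e)" if k: "k \<ge> 1" for k
  proof -
    have "norm (b k) \<le> (A * real k powr (1 - (Re s1 + Re s2))) * real k powr (- x)"
      unfolding b_def norm_mult using ab[OF k] norm_nat_powr[OF k, of "- of_real x"] by (simp add: mult_right_mono)
    also have "\<dots> = A * (real k powr (1 - (Re s1 + Re s2)) * real k powr (- x))" by simp
    also have "real k powr (1 - (Re s1 + Re s2)) * real k powr (- x) = real k powr (- e)"
      unfolding powr_add[symmetric] by (rule arg_cong[of _ _ "\<lambda>t. real k powr t"]) (simp add: e_def)
    finally show ?thesis .
  qed
  have bt: "conv_coeff s1 s2 k * of_nat k powr (- Complex x t) = b k * cis (- (t * ln (real k)))" if k: "k \<ge> 1" for k t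
  proof -
    have "- Complex x t = - of_real x + \<i> * of_real (- t)" by (simp add: complex_eq_iff)
    then have "(of_nat k :: complex) powr (- Complex x t) = of_nat k powr (- of_real x) * of_nat k powr (\<i> * of_real (- t))"
      by (simp only: powr_add)
    also have "(of_nat k :: complex) powr (\<i> * of_real (- t)) = cis (- (t * ln (real k)))"
      using k by (simp add: powr_def cis_conv_exp Ln_of_nat mult_ac)
    finally show ?thesis by (simp add: b_def)
  qed
  define S2 where "S2 = (\<Sum>\<^sub>\<infinity>k\<in>{1..}. (norm (b k))\<^sup>2)"
  have bsq: "(norm (b k))\<^sup>2 \<le> A\<^sup>2 * real k powr (- (2 * e))" if k: "k \<ge> 1" for k
  proof -
    have "(norm (b k))\<^sup>2 \<le> (A * real k powr (- e))\<^sup>2" using bb[OF k] by (intro power_mono) auto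
    also have "\<dots> = A\<^sup>2 * (real k powr (- e) * real k powr (- e))" by (simp add: power2_eq_square)
    also have "real k powr (- e) * real k powr (- e) = real k powr (- (2 * e))" unfolding powr_add[symmetric] by simp
    finally show ?thesis .
  qed
  have ssum: "(\<lambda>k. A\<^sup>2 * real k powr (- (2 * e))) summable_on {1..}"
    using e by (intro summable_on_cmult_right summable_on_subset[OF summable_on_powr_nat]) auto
  have bsum: "(\<lambda>k. (norm (b k))\<^sup>2) summable_on {1..}"
    by (rule summable_on_comparison_test[OF ssum]) (use bsq in auto)
  have sq: "zeta_MT2_sq s1 s2 (complex_of_real (2 * x)) = of_real S2"
  proof -
    \<comment> \<open>Starting at 1 instead of 2 changes nothing, as the coefficient of k = 1 is an
      empty sum.\<close>
    have "zeta_MT2_sq s1 s2 (complex_of_real (2 * x)) = (\<Sum>\<^sub>\<infinity>k\<in>{1..}. complex_of_real ((norm (b k))\<^sup>2))"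
      unfolding zeta_MT2_sq_def
    proof (rule infsum_cong_neutral)
      fix k :: nat assume "k \<in> {2..} \<inter> {1..}"
      then have k: "k \<ge> 1" by auto
      have "(norm (b k))\<^sup>2 = (norm (conv_coeff s1 s2 k))\<^sup>2 * (real k powr (- x))\<^sup>2"
        using norm_nat_powr[OF k, of "- of_real x"] by (simp add: b_def norm_mult power_mult_distrib)
      also have "(real k powr (- x))\<^sup>2 = 1 / real k powr (2 * x)"
        using k by (simp add: power2_eq_square powr_minus powr_add[symmetric] divide_simps)
      finally have "(norm (b k))\<^sup>2 = (norm (conv_coeff s1 s2 k))\<^sup>2 / real k powr (2 * x)" by simp
      moreover have "(of_nat k :: complex) powr (complex_of_real (2 * x)) = of_real (real k powr (2 * x))"
        using powr_of_real[of "real k" "2 * x"] by simp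
      ultimately show "complex_of_real ((cmod (\<Sum>m = 1..k - 1. 1 / (of_nat m powr s1 * of_nat (k - m) powr s2)))\<^sup>2) / of_nat k powr complex_of_real (2 * x)
          = complex_of_real ((norm (b k))\<^sup>2)"
        unfolding conv_coeff_def by simp
    next
      fix k :: nat assume "k \<in> {1..} - {2..}"
      then have "k = 1" by auto
      then show "complex_of_real ((norm (b k))\<^sup>2) = 0" by (simp add: b_def conv_coeff_def)
    qed auto
    also have "\<dots> = of_real S2"
      unfolding S2_def by (rule infsumI[OF has_sum_of_real[OF has_sum_infsum[OF bsum]]])
    finally show ?thesis .
  qed
  have S20: "S2 \<ge> 0" unfolding S2_def by (intro infsum_nonneg) auto
  define m0 where "m0 = norm s1 + norm s2 + 1 + x"
  have m0: "m0 \<ge> 1" using x by (simp add: m0_def)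
  define K1 where "K1 = A\<^sup>2 * (1 + 1 / (2 * e - 1))"
  have K1: "K1 \<ge> 0" using e by (simp add: K1_def)
  define c where "c = 8 * A\<^sup>2"
  define K where "K = 2 * S2 + K1 + S2 + 18 * C\<^sup>2 + 2 * c"
  have main: "\<exists>q. real q \<le> 9 * T \<and> real q \<ge> T \<and>
     cmod (complex_of_real (integral {2..T} (\<lambda>t. (cmod (zeta_MT2 s1 s2 (Complex x t)))\<^sup>2))
                       - zeta_MT2_sq s1 s2 (complex_of_real (2 * x)) * complex_of_real T)
     \<le> K * (T powr (3/2 - e) + real q powr (1 - e) * (\<Sum>k=1..<q. real k powr (- e)) * (1 + ln (real q)))"
    if T: "T \<ge> m0 + 2" for T
  proof -
    \<comment> \<open>For T >= m0 + 2 and t <= T one has 4 (m0 + t) <= 8 T, so a single q serves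
      every t in [2, T].\<close>
    define q where "q = nat \<lceil>8 * T\<rceil>"
    have T2: "T \<ge> 2" "T \<ge> 1" "T > 0" using T m0 by auto
    have qT: "real q \<ge> 8 * T" "real q \<le> 9 * T" using T2 unfolding q_def by linarith+
    have q1: "q \<ge> 1" "real q \<ge> T" using qT T2 by auto
    define Z where "Z = (\<lambda>t. zeta_MT2 s1 s2 (Complex x t))"
    define P where "P = (\<lambda>t. \<Sum>k\<in>{1..<q}. b k * cis (- (t * ln (real k))))"
    define W where "W = real q powr (1 - e) * (\<Sum>k=1..<q. real k powr (- e)) * (1 + ln (real q))"
    define X where "X = T powr (3/2 - e)"
    have W0: "W \<ge> 0" unfolding W_def using q1 T2 by (intro mult_nonneg_nonneg sum_nonneg) auto
    have X1: "X \<ge> 1" unfolding X_def using T2 e by (intro ge_one_powr_ge_zero) auto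
    have Z_cont: "continuous_on {2..T} Z"
    proof -
      have "continuous_on {z. Re z > 0 \<and> Im z > 0} (zeta_MT2 s1 s2)"
        by (rule holomorphic_on_imp_continuous_on[OF zeta_MT2_slice_holomorphic]) (use s in auto)
      then show ?thesis
        unfolding Z_def by (rule continuous_on_compose2) (use x in \<open>auto intro!: continuous_intros\<close>)
    qed
    have Pc: "continuous_on {2..T} P" unfolding P_def by (intro continuous_intros)
    have dZP: "norm (Z t - P t) \<le> C * real q powr (1 - e) / t" if t: "t \<in> {2..T}" for t
    proof -
      have p1: "P t = (\<Sum>k=1..<q. conv_coeff s1 s2 k * of_nat k powr (- Complex x t))"
        unfolding P_def by (intro sum.cong refl bt[symmetric]) auto
      have p2: "4 * (norm s1 + norm s2 + 1 + x + t) \<le> real q"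
      proof -
        have "4 * (norm s1 + norm s2 + 1 + x + t) = 4 * m0 + 4 * t" by (simp add: m0_def)
        also have "\<dots> \<le> 8 * T" using t T by simp
        finally show ?thesis using qT by linarith
      qed
      have p3: "2 - (Re s1 + Re s2 + x) = 1 - e" by (simp add: e_def)
      show ?thesis unfolding Z_def p1 p3[symmetric] by (rule approx[OF _ p2]) (use t in auto)
    qed
    define D where "D = (\<Sum>k\<in>{1..<q}. (norm (b k))\<^sup>2)"
    define IP where "IP = integral {2..T} (\<lambda>t. (norm (P t))\<^sup>2)"
    define IZ where "IZ = integral {2..T} (\<lambda>t. (norm (Z t))\<^sup>2)"
    have off: "\<bar>IP - (T - 2) * D\<bar> \<le> c * W"
    proof -
      have "\<bar>IP - (T - 2) * D\<bar> \<le> (\<Sum>k\<in>{1..<q}. \<Sum>l\<in>{1..<q} - {k}. norm (b k) * norm (b l) * (2 / \<bar>ln (real l) - ln (real k)\<bar>))"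
        unfolding IP_def D_def P_def by (rule mean_square_dirichlet) (use T2 in auto)
      also have "\<dots> \<le> 8 * A\<^sup>2 * real q powr (1 - e) * (\<Sum>k=1..<q. real k powr (- e)) * (\<Sum>j=1..<q. 1 / real j)"
        by (rule off_diagonal_bound[OF bb A]) (use e in auto)
      also have "\<dots> \<le> 8 * A\<^sup>2 * real q powr (1 - e) * (\<Sum>k=1..<q. real k powr (- e)) * (1 + ln (real q))"
        by (intro mult_left_mono harmonic_sum_le q1 mult_nonneg_nonneg sum_nonneg) auto
      also have "\<dots> = c * W" by (simp add: W_def c_def)
      finally show ?thesis .
    qed
    have DS: "D \<le> S2" "S2 - D \<le> K1 * real q powr (1 - 2 * e)"
    proof -
      have un: "{1..} = {1..<q} \<union> {q..}" using q1 by auto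
      have tail: "(\<lambda>k. (norm (b k))\<^sup>2) summable_on {q..}" by (rule summable_on_subset[OF bsum]) (use q1 in auto)
      have S2D: "S2 = D + (\<Sum>\<^sub>\<infinity>k\<in>{q..}. (norm (b k))\<^sup>2)"
        unfolding S2_def D_def un by (subst infsum_Un_disjoint) (use tail in auto)
      have "(\<Sum>\<^sub>\<infinity>k\<in>{q..}. (norm (b k))\<^sup>2) \<ge> 0" by (intro infsum_nonneg) auto
      then show "D \<le> S2" using S2D by simp
      have "(\<Sum>\<^sub>\<infinity>k\<in>{q..}. (norm (b k))\<^sup>2) \<le> (\<Sum>\<^sub>\<infinity>k\<in>{q..}. A\<^sup>2 * real k powr (- (2 * e)))"
        by (rule infsum_mono[OF tail]) (rule summable_on_subset[OF ssum], use q1 bsq in auto)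
      also have "\<dots> = A\<^sup>2 * (\<Sum>\<^sub>\<infinity>k\<in>{q..}. real k powr (- (2 * e)))" by (rule infsum_cmult_right')
      also have "\<dots> \<le> A\<^sup>2 * (real q powr (- (2 * e)) + real q powr (1 - 2 * e) / (2 * e - 1))"
        by (intro mult_left_mono powr_tail_bound) (use q1 e in auto)
      also have "\<dots> \<le> A\<^sup>2 * (real q powr (1 - 2 * e) + real q powr (1 - 2 * e) / (2 * e - 1))"
        by (intro mult_left_mono add_right_mono powr_mono) (use q1 in auto)
      also have "\<dots> = K1 * real q powr (1 - 2 * e)" by (simp add: K1_def algebra_simps)
      finally show "S2 - D \<le> K1 * real q powr (1 - 2 * e)" using S2D by simp
    qed
    \<comment> \<open>Two losses: T - 2 in place of T costs a constant, and the tail of the series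
      costs T times T^(1-2e), which is at most T^(3/2-e) since e > 1/2.\<close>
    have diag: "\<bar>(T - 2) * D - S2 * T\<bar> \<le> (2 * S2 + K1) * X"
    proof -
      have "T * (S2 - D) \<le> T * (K1 * T powr (1 - 2 * e))"
      proof -
        have "real q powr (1 - 2 * e) \<le> T powr (1 - 2 * e)" using q1 T2 e by (intro powr_mono2') auto
        then have "S2 - D \<le> K1 * T powr (1 - 2 * e)" using DS(2) K1 by (meson mult_left_mono order_trans)
        then show ?thesis using T2 by (intro mult_left_mono) auto
      qed
      also have "\<dots> = K1 * (T powr 1 * T powr (1 - 2 * e))" using T2 by simp
      also have "T powr 1 * T powr (1 - 2 * e) = T powr (2 - 2 * e)" unfolding powr_add[symmetric] by simp
      also have "K1 * T powr (2 - 2 * e) \<le> K1 * X" unfolding X_def using T2 e K1 by (intro mult_left_mono powr_mono) auto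
      finally have 1: "T * (S2 - D) \<le> K1 * X" .
      have "D \<ge> 0" by (auto simp: D_def intro: sum_nonneg)
      have "\<bar>(T - 2) * D - S2 * T\<bar> = T * (S2 - D) + 2 * D"
      proof -
        have "(T - 2) * D - S2 * T = - (T * (S2 - D) + 2 * D)" by (simp add: algebra_simps)
        moreover have "T * (S2 - D) + 2 * D \<ge> 0" using T2 DS \<open>D \<ge> 0\<close> by (intro add_nonneg_nonneg mult_nonneg_nonneg) auto
        ultimately show ?thesis by (simp only: abs_minus_cancel abs_of_nonneg)
      qed
      also have "\<dots> \<le> K1 * X + 2 * S2 * 1" using 1 DS by simp
      also have "\<dots> \<le> K1 * X + 2 * S2 * X" using X1 S20 by (intro add_left_mono mult_left_mono) auto
      finally show ?thesis by (simp add: algebra_simps)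
    qed
    \<comment> \<open>Balances the two terms of \<open>mean_square_compare\<close>: r T and
      T^(2-2e)/r are both T^(3/2-e).\<close>
    define r where "r = T powr (1/2 - e)"
    have "T powr (1/2 - e) \<le> T powr 0" using T2 e by (intro powr_mono) auto
    then have r: "r > 0" "r \<le> 1" using T2 by (auto simp: r_def)
    have IPle: "IP \<le> T * S2 + c * W"
    proof -
      have "D \<ge> 0" by (auto simp: D_def intro: sum_nonneg)
      have "(T - 2) * D \<le> T * S2" using T2 DS \<open>D \<ge> 0\<close> by (intro mult_mono) auto
      then show ?thesis using off by linarith
    qed
    have IP0: "IP \<ge> 0" unfolding IP_def by (rule integral_nonneg) (auto intro!: integrable_continuous_real continuous_intros Pc)
    have cmp: "\<bar>IZ - IP\<bar> \<le> r * IP + (1 / r + 1) * (C * real q powr (1 - e))\<^sup>2"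
      unfolding IZ_def IP_def
      by (rule mean_square_compare[OF Z_cont Pc T2(1) r(1) _ dZP]) (use C in auto)
    also have "\<dots> \<le> (S2 * X + c * W) + 18 * C\<^sup>2 * X"
    proof (rule add_mono)
      have "r * IP \<le> r * (T * S2 + c * W)" using IPle r by (intro mult_left_mono) auto
      also have "\<dots> = S2 * (r * T powr 1) + r * (c * W)" using T2 by (simp add: algebra_simps)
      also have "r * T powr 1 = X" unfolding r_def X_def powr_add[symmetric] by simp
      also have "r * (c * W) \<le> 1 * (c * W)" using r W0 by (intro mult_right_mono) (auto simp: c_def)
      finally show "r * IP \<le> S2 * X + c * W" by simp
      have "(C * real q powr (1 - e))\<^sup>2 = C\<^sup>2 * (real q powr (1 - e) * real q powr (1 - e))" by (simp add: power2_eq_square)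
      also have "real q powr (1 - e) * real q powr (1 - e) = real q powr (2 - 2 * e)" unfolding powr_add[symmetric] by simp
      also have "real q powr (2 - 2 * e) \<le> (9 * T) powr (2 - 2 * e)" using qT e by (intro powr_mono2) auto
      also have "(9 * T) powr (2 - 2 * e) = 9 powr (2 - 2 * e) * T powr (2 - 2 * e)" using T2 by (simp add: powr_mult)
      also have "9 powr (2 - 2 * e) \<le> (9::real) powr 1" using e by (intro powr_mono) auto
      finally have M: "(C * real q powr (1 - e))\<^sup>2 \<le> C\<^sup>2 * (9 * T powr (2 - 2 * e))" by (simp add: mult_left_mono mult_right_mono)
      have "(1 / r + 1) * (C * real q powr (1 - e))\<^sup>2 \<le> (2 / r) * (C\<^sup>2 * (9 * T powr (2 - 2 * e)))"
        using r M by (intro mult_mono) (auto simp: field_simps)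
      also have "\<dots> = 18 * C\<^sup>2 * (T powr (2 - 2 * e) / r)" by simp
      also have "T powr (2 - 2 * e) / r = X" unfolding r_def X_def powr_diff[symmetric] by simp
      finally show "(1 / r + 1) * (C * real q powr (1 - e))\<^sup>2 \<le> 18 * C\<^sup>2 * X" .
    qed
    finally have cmp': "\<bar>IZ - IP\<bar> \<le> S2 * X + c * W + 18 * C\<^sup>2 * X" by simp
    have c0: "c \<ge> 0" by (simp add: c_def)
    have "\<bar>IZ - S2 * T\<bar> \<le> (2 * S2 + K1) * X + S2 * X + 18 * C\<^sup>2 * X + 2 * (c * W)"
      using cmp' off diag by linarith
    also have "\<dots> \<le> K * (X + W)"
    proof -
      have k: "2 * S2 + K1 + S2 + 18 * C\<^sup>2 \<le> K" "2 * c \<le> K" using c0 K1 S20 by (auto simp: K_def)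
      have "(2 * S2 + K1 + S2 + 18 * C\<^sup>2) * X + (2 * c) * W \<le> K * X + K * W"
        using k X1 W0 by (intro add_mono mult_right_mono) auto
      then show ?thesis by (simp add: algebra_simps)
    qed
    finally have fin: "\<bar>IZ - S2 * T\<bar> \<le> K * (X + W)" .
    have "cmod (complex_of_real IZ - zeta_MT2_sq s1 s2 (complex_of_real (2 * x)) * complex_of_real T) = \<bar>IZ - S2 * T\<bar>"
      unfolding sq of_real_mult[symmetric] of_real_diff[symmetric] norm_of_real ..
    with fin qT q1 show ?thesis
      by (intro exI[of _ q]) (simp add: IZ_def Z_def X_def W_def)
  qed
  show ?thesis
  proof (rule that[of K])
    show "K \<ge> 0" using K1 S20 by (simp add: K_def c_def)
  qed (rule eventually_mono[OF eventually_ge_at_top[of "m0 + 2"] main])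
qed

text \<open>It remains to remove q from \<open>mean_square_estimate\<close>. In both cases the
  off-diagonal terms turn out smaller than the error already caused by the cross term.\<close>

theorem theorem1p4:
  fixes s1 s2 :: complex and \<sigma>3 :: real
  assumes "Re s1 \<ge> 0" and "Re s2 \<ge> 0" and "\<sigma>3 > 0"
    and "Im s1 \<ge> 0" and "Im s2 \<ge> 0"
    and "Re s1 + \<sigma>3 \<le> 1" and "Re s2 + \<sigma>3 \<le> 1"
    and "Re s1 + Re s2 + \<sigma>3 > 3/2"
    and "\<forall>t::real. t \<ge> 2 \<longrightarrow>
           (let s3 = Complex \<sigma>3 t in s1 + s3 \<noteq> 1 \<and> s2 + s3 \<noteq> 1 \<and> s1 + s2 + s3 \<noteq> 2)"
  shows "(Re s1 + Re s2 + \<sigma>3 < 2 \<longrightarrow>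
           (\<lambda>T. cmod (complex_of_real (integral {2..T} (\<lambda>t. (cmod (zeta_MT2 s1 s2 (Complex \<sigma>3 t)))\<^sup>2))
                       - zeta_MT2_sq s1 s2 (complex_of_real (2 * \<sigma>3)) * complex_of_real T))
           \<in> O[at_top](\<lambda>T. T powr (5/2 - (Re s1 + Re s2 + \<sigma>3)))) \<and>
         (Re s1 + Re s2 + \<sigma>3 = 2 \<longrightarrow>
           (\<lambda>T. cmod (complex_of_real (integral {2..T} (\<lambda>t. (cmod (zeta_MT2 s1 s2 (Complex \<sigma>3 t)))\<^sup>2))
                       - zeta_MT2_sq s1 s2 (complex_of_real (2 * \<sigma>3)) * complex_of_real T))
           \<in> O[at_top](\<lambda>T. sqrt (T * ln T)))"
proof -
  define e where "e = Re s1 + Re s2 + \<sigma>3 - 1"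
  define f where "f = (\<lambda>T. cmod (complex_of_real (integral {2..T} (\<lambda>t. (cmod (zeta_MT2 s1 s2 (Complex \<sigma>3 t)))\<^sup>2))
                       - zeta_MT2_sq s1 s2 (complex_of_real (2 * \<sigma>3)) * complex_of_real T))"
  \<comment> \<open>Each real part exceeds 1/2 since the weight is above 3/2 while the other two
    summands add up to at most 1; it is below 1 since \<open>\<sigma>3\<close> is positive.\<close>
  have s: "Re s1 > 1/2" "Re s2 > 1/2" "Re s1 < 1" "Re s2 < 1" using assms by linarith+
  show ?thesis
  \<comment> \<open>For a weight above 2 both implications are vacuous.\<close>
  proof (cases "Re s1 + Re s2 + \<sigma>3 \<le> 2")
    case le: True
    have e: "1/2 < e" "e \<le> 1" using assms le by (auto simp: e_def)
    obtain K where K: "K \<ge> 0" "\<forall>\<^sub>F T in at_top. \<exists>q. real q \<le> 9 * T \<and> real q \<ge> T \<and>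
       f T \<le> K * (T powr (3/2 - e) + real q powr (1 - e) * (\<Sum>k=1..<q. real k powr (- e)) * (1 + ln (real q)))"
      unfolding f_def e_def by (rule mean_square_estimate[OF s assms(4,5,3,8) le])
    \<comment> \<open>The off-diagonal part is O(T^(2-2e) log T), which falls below T^(3/2-e) by the
      factor T^(1/2-e) log T. The two factors 9 in \<open>c\<close> come from q <= 9 T.\<close>
    have lt: "f \<in> O[at_top](\<lambda>T. T powr (3/2 - e))" if "e < 1"
    proof -
      define c where "c = 9 * 9 / (1 - e)"
      have c0: "c \<ge> 0" using that by (simp add: c_def)
      have "\<forall>\<^sub>F T in at_top. norm (f T) \<le> K * norm (T powr (3/2 - e) + c * (T powr (2 - 2 * e) * (1 + ln (9 * T))))"
        using K(2) eventually_ge_at_top[of 1]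
      proof eventually_elim
        case (elim T)
        then obtain q where q: "real q \<le> 9 * T" "real q \<ge> T"
          "f T \<le> K * (T powr (3/2 - e) + real q powr (1 - e) * (\<Sum>k=1..<q. real k powr (- e)) * (1 + ln (real q)))" by blast
        have q1: "q \<ge> 1" using q elim by (cases q) auto
        have p: "real q powr (1 - e) \<le> 9 * T powr (1 - e)"
        proof -
          have "real q powr (1 - e) \<le> (9 * T) powr (1 - e)" using q e by (intro powr_mono2) auto
          also have "\<dots> = 9 powr (1 - e) * T powr (1 - e)" using elim by (simp add: powr_mult)
          also have "\<dots> \<le> 9 powr 1 * T powr (1 - e)" using e by (intro mult_right_mono powr_mono) auto
          finally show ?thesis by simp
        qed
        have "(\<Sum>k=1..<q. real k powr (- e)) = (\<Sum>n<q - 1. real (Suc n) powr (- e))"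
          by (rule sum.reindex_bij_witness[of _ Suc "\<lambda>k. k - 1"]) auto
        also have "\<dots> \<le> real (q - 1) powr (1 - e) / (1 - e)" by (rule sum_powr_le) (use e that in auto)
        also have "\<dots> \<le> real q powr (1 - e) / (1 - e)" using that by (intro divide_right_mono powr_mono2) auto
        also have "\<dots> \<le> 9 * T powr (1 - e) / (1 - e)" using that p by (intro divide_right_mono) auto
        finally have S: "(\<Sum>k=1..<q. real k powr (- e)) \<le> 9 * T powr (1 - e) / (1 - e)" .
        have "real q powr (1 - e) * (\<Sum>k=1..<q. real k powr (- e)) * (1 + ln (real q))
          \<le> (9 * T powr (1 - e)) * (9 * T powr (1 - e) / (1 - e)) * (1 + ln (9 * T))"
          using p S q q1 elim that by (intro mult_mono add_mono mult_nonneg_nonneg sum_nonneg) auto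
        also have "\<dots> = c * ((T powr (1 - e) * T powr (1 - e)) * (1 + ln (9 * T)))" by (simp add: c_def)
        also have "T powr (1 - e) * T powr (1 - e) = T powr (2 - 2 * e)" unfolding powr_add[symmetric] by simp
        finally have "f T \<le> K * (T powr (3/2 - e) + c * (T powr (2 - 2 * e) * (1 + ln (9 * T))))"
          using q(3) K(1) by (meson add_left_mono mult_left_mono order_trans)
        moreover have "f T \<ge> 0" by (simp add: f_def)
        ultimately show ?case
          by (simp add: abs_of_nonneg order_trans[OF _ mult_left_mono[OF abs_ge_self K(1)]])
      qed
      then have "f \<in> O[at_top](\<lambda>T. T powr (3/2 - e) + c * (T powr (2 - 2 * e) * (1 + ln (9 * T))))" by (rule bigoI)
      also have "(\<lambda>T. T powr (3/2 - e) + c * (T powr (2 - 2 * e) * (1 + ln (9 * T)))) \<in> O[at_top](\<lambda>T. T powr (3/2 - e))"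
      proof -
        define d where "d = e - 1/2"
        have d: "d > 0" using e by (simp add: d_def)
        have ex: "3/2 - e = 1 - d" "2 - 2 * e = 1 - d - d" by (auto simp: d_def)
        have "(\<lambda>T::real. T powr (1 - d - d) * (1 + ln (9 * T))) \<in> O[at_top](\<lambda>T. T powr (1 - d))"
          using d by real_asymp
        moreover have "c \<noteq> 0" using that by (simp add: c_def)
        ultimately have "(\<lambda>T::real. c * (T powr (1 - d - d) * (1 + ln (9 * T)))) \<in> O[at_top](\<lambda>T. T powr (1 - d))"
          by simp
        then show ?thesis unfolding ex by (intro sum_in_bigo landau_o.big_refl)
      qed
      finally show ?thesis .
    qed
    \<comment> \<open>Here q^(1-e) = 1 and both remaining factors are logarithms, so T^(1/2) plus
      the square of a logarithm is absorbed by the claimed bound.\<close>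
    have eq: "f \<in> O[at_top](\<lambda>T. sqrt (T * ln T))" if e1: "e = 1"
    proof -
      have "\<forall>\<^sub>F T in at_top. norm (f T) \<le> K * norm (T powr (1/2) + (1 + ln (9 * T)) * (1 + ln (9 * T)))"
        using K(2) eventually_ge_at_top[of 1]
      proof eventually_elim
        case (elim T)
        then obtain q where q: "real q \<le> 9 * T" "real q \<ge> T"
          "f T \<le> K * (T powr (3/2 - e) + real q powr (1 - e) * (\<Sum>k=1..<q. real k powr (- e)) * (1 + ln (real q)))" by blast
        have q1: "q \<ge> 1" using q elim by (cases q) auto
        have "(\<Sum>k=1..<q. real k powr (- e)) = (\<Sum>j=1..<q. 1 / real j)"
          unfolding e1 by (intro sum.cong) (auto simp: powr_minus field_simps)
        also have "\<dots> \<le> 1 + ln (real q)" by (rule harmonic_sum_le[OF q1])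
        also have "\<dots> \<le> 1 + ln (9 * T)" using q q1 by simp
        finally have S: "(\<Sum>k=1..<q. real k powr (- e)) \<le> 1 + ln (9 * T)" .
        have "real q powr (1 - e) * (\<Sum>k=1..<q. real k powr (- e)) * (1 + ln (real q)) \<le> 1 * (1 + ln (9 * T)) * (1 + ln (9 * T))"
          using S q q1 elim e1 by (intro mult_mono add_mono mult_nonneg_nonneg sum_nonneg) auto
        then have "f T \<le> K * (T powr (3/2 - e) + 1 * (1 + ln (9 * T)) * (1 + ln (9 * T)))"
          using q(3) K(1) by (meson add_left_mono mult_left_mono order_trans)
        moreover have "3/2 - e = 1/2" using e1 by simp
        ultimately have "f T \<le> K * (T powr (1/2) + (1 + ln (9 * T)) * (1 + ln (9 * T)))" by simp
        moreover have "f T \<ge> 0" by (simp add: f_def)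
        ultimately show ?case
          by (simp add: abs_of_nonneg order_trans[OF _ mult_left_mono[OF abs_ge_self K(1)]])
      qed
      then have "f \<in> O[at_top](\<lambda>T. T powr (1/2) + (1 + ln (9 * T)) * (1 + ln (9 * T)))" by (rule bigoI)
      also have "(\<lambda>T::real. T powr (1/2) + (1 + ln (9 * T)) * (1 + ln (9 * T))) \<in> O[at_top](\<lambda>T. sqrt (T * ln T))"
        by real_asymp
      finally show ?thesis .
    qed
    show ?thesis
    proof (intro conjI impI)
      assume "Re s1 + Re s2 + \<sigma>3 < 2"
      then have "e < 1" "5/2 - (Re s1 + Re s2 + \<sigma>3) = 3/2 - e" by (auto simp: e_def)
      with lt show "(\<lambda>T. cmod (complex_of_real (integral {2..T} (\<lambda>t. (cmod (zeta_MT2 s1 s2 (Complex \<sigma>3 t)))\<^sup>2))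
                       - zeta_MT2_sq s1 s2 (complex_of_real (2 * \<sigma>3)) * complex_of_real T))
           \<in> O[at_top](\<lambda>T. T powr (5/2 - (Re s1 + Re s2 + \<sigma>3)))" unfolding f_def by simp
    next
      assume "Re s1 + Re s2 + \<sigma>3 = 2"
      then have "e = 1" by (simp add: e_def)
      with eq show "(\<lambda>T. cmod (complex_of_real (integral {2..T} (\<lambda>t. (cmod (zeta_MT2 s1 s2 (Complex \<sigma>3 t)))\<^sup>2))
                       - zeta_MT2_sq s1 s2 (complex_of_real (2 * \<sigma>3)) * complex_of_real T))
           \<in> O[at_top](\<lambda>T. sqrt (T * ln T))" unfolding f_def by simp
    qed
  qed auto
qed

end
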